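(* Let $\{b_k\}_{k\ge1}$ be a sequence of nonnegative weights satisfying conditions (I), (II), (III) listed in the context, with data $r$, $\rho_0=0<\rho_1<\dots<\rho_r$, $A_1,\dots,A_r$, and let $c_n^{(i)}$, $i=1,2,3$, be the associated coefficients, $h_l^{(i)}$ the constants, and $\lambda_1<\dots<\lambda_{|\Upsilon_r|}$ the elements of the finite set $\Upsilon_r$, all as defined in the context. Then for each $i=1,2,3$ there exist real constants $H^{(i)}>0$, $P_l^{(i)}$ ($0\le l\le r$) and $K_{s,l}^{(i)}$ ($0\le l\le r$, $1\le s\le|\Upsilon_r|$, $\lambda_s\le\rho_l$), not depending on $n$, such that, as $n\to\infty$, $$ c_n^{(i)}\sim H^{(i)}\,n^{-\frac{2+\rho_r-2D(0)\mathbf 1(i)}{2(\rho_r+1)}}\exp\Big(\sum_{l=0}^{r}P_l^{(i)}n^{\frac{\rho_l}{\rho_r+1}}+\sum_{l=0}^r h_l^{(i)}\sum_{s:\lambda_s\le \rho_l} K^{(i)}_{s,l}\, n^{\frac{\rho_l-\lambda_s}{\rho_r+1}}\Big), $$ where $\mathbf 1(1)=1$ and $\mathbf 1(2)=\mathbf 1(3)=0$. (The powers $\frac{\rho_l-\lambda_s}{\rho_r+1}$ do not depend on $n$.)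
   Context: Let $b_k\ge0$, $k\ge1$. Define generating functions $$f^{(1)}(z)=\prod_{k\ge1}(1-z^k)^{-b_k},\quad f^{(2)}(z)=\prod_{k\ge1}(1+z^k)^{b_k},\quad f^{(3)}(z)=\exp\Big(\sum_{k\ge1}b_kz^k\Big),$$ and let $c_n^{(i)}$ be defined by $f^{(i)}(z)=\sum_{n\ge0}c_n^{(i)}z^n$ (weighted partitions, selections, assemblies). Each factor, i.e. $(1-z^k)^{-b_k}$, $(1+z^k)^{b_k}$, $\exp(b_kz^k)$ respectively, is assumed to have nonnegative power series coefficients (so for $i=2$ the $b_k$ are nonnegative integers). Let $D(s)=\sum_{k\ge1}b_kk^{-s}$, $s=\sigma+it$, be the Dirichlet generating function. Conditions: (I) $D(s)$ is analytic in the half-plane $\sigma>\rho_r>0$ (the series converges there) and it has $r\ge1$ simple poles at positions $0<\rho_1<\rho_2<\dots<\rho_r$ with positive residues $A_1,\dots,A_r$ respectively. Moreover there is a constant $0<C_0\le1$ such that $D(s)$ has a meromorphic continuation to the half-plane $\mathcal H=\{s:\sigma\ge-C_0\}$, on which it is analytic except for these $r$ simple poles. (II) There is a constant $C_1>0$ such that $D(s)=O(|t|^{C_1})$, $t\to\infty$, uniformly for $s=\sigma+it\in\mathcal H$. (III) For any $\epsilon>0$ and all $\delta>0$ small enough (depending on $\epsilon$), $$2\sum_{k=1}^\infty b_ke^{-k\delta}\sin^2(\pi k\alpha)\ge\Big(1+\frac{\rho_r}{2}+\epsilon\Big)\mathcal M^{(i)}|\log\delta|,\qquad \sqrt\delta\le|\alpha|\le\tfrac12,\quad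 i=1,2,3,$$ where $\mathcal M^{(1)}=4/\log5$, $\mathcal M^{(2)}=4$, $\mathcal M^{(3)}=1$. Values such as $D(0)$, $D'(0)$ refer to the meromorphic continuation. Set $\rho_0=0$. For $l=1,\dots,r$, $$h_l^{(1)}=A_l\Gamma(\rho_l)\zeta(\rho_l+1),\quad h_l^{(2)}=A_l\Gamma(\rho_l)(1-2^{-\rho_l})\zeta(\rho_l+1),\quad h_l^{(3)}=A_l\Gamma(\rho_l),$$ and $h_0^{(1)}=D'(0)$, $h_0^{(2)}=D(0)\log2$, $h_0^{(3)}=D(0)$. With $\mathbb Z_+$ the nonnegative integers, define the finite sets $$\tilde\Upsilon_r=\Big\{\sum_{k=0}^{r-1}d_k(\rho_r-\rho_k):\ d_k\in\mathbb Z_+,\ \sum_{k=0}^{r-1}d_k\ge2\Big\}\cap(0,\rho_r+1],\qquad \Upsilon_r=\tilde\Upsilon_r\cup\{\rho_r-\rho_k:\ k=0,1,\dots,r-1\},$$ and let $0<\lambda_1<\lambda_2<\dots<\lambda_{|\Upsilon_r|}$ be the ordered elements of $\Upsilon_r$. $a_n\sim b_n$ means $a_n/b_n\to1$. *)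

theory Defs
  imports
    "HOL-Complex_Analysis.Complex_Analysis"
    "HOL-Computational_Algebra.Formal_Power_Series"
    "HOL-Library.Landau_Symbols"
begin

text \<open>
  Weights are functions \<open>b :: nat \<Rightarrow> real\<close> of which only the values \<open>b k\<close> with \<open>k \<ge> 1\<close> matter.
  The index \<open>i = 1, 2, 3\<close> is represented by a three-element type.
\<close>

datatype kind = Weighted_Partitions | Selections | Assemblies

section \<open>Generating functions\<close>

text \<open>
  \<^term>\<open>fps_binomial a\<close> is the series of \<open>(1 + X)\<close> to the power \<open>a\<close> and \<^term>\<open>fps_exp a\<close> that of
  \<open>exp (a * X)\<close>, so the three cases are \<open>(1 - z\<^sup>k)\<close> to the power \<open>- b k\<close>, \<open>(1 + z\<^sup>k)\<close> to the
  power \<open>b k\<close>, and \<open>exp (b k * z\<^sup>k)\<close>.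
\<close>

definition gf_factor :: "kind \<Rightarrow> (nat \<Rightarrow> real) \<Rightarrow> nat \<Rightarrow> real fps" where
  "gf_factor i b k = (case i of
      Weighted_Partitions \<Rightarrow> fps_binomial (- b k) oo (- (fps_X ^ k))
    | Selections \<Rightarrow> fps_binomial (b k) oo (fps_X ^ k)
    | Assemblies \<Rightarrow> fps_exp (b k) oo (fps_X ^ k))"

text \<open>The infinite products are taken in the usual (X-adic) topology of formal power series.\<close>

definition gen_fun :: "kind \<Rightarrow> (nat \<Rightarrow> real) \<Rightarrow> real fps" where
  "gen_fun i b = (case i of
      Weighted_Partitions \<Rightarrow> (\<Prod>k. gf_factor Weighted_Partitions b (Suc k))
    | Selections \<Rightarrow> (\<Prod>k. gf_factor Selections b (Suc k))
    | Assemblies \<Rightarrow> fps_exp 1 oo Abs_fps (\<lambda>k. if k = 0 then 0 else b k))"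

definition coeff_c :: "kind \<Rightarrow> (nat \<Rightarrow> real) \<Rightarrow> nat \<Rightarrow> real" where
  "coeff_c i b n = fps_nth (gen_fun i b) n"

definition admissible_weights :: "kind \<Rightarrow> (nat \<Rightarrow> real) \<Rightarrow> bool" where
  "admissible_weights i b \<longleftrightarrow>
     (\<forall>k\<ge>1. b k \<ge> 0) \<and> (\<forall>k\<ge>1. \<forall>n. fps_nth (gf_factor i b k) n \<ge> 0)"

section \<open>Conditions on the Dirichlet generating function\<close>

text \<open>
  \<open>D\<close> stands for the meromorphic continuation of the Dirichlet series to the half-plane
  \<open>Re s \<ge> - C0\<close>. Positions and residues of its poles are \<open>\<rho> l\<close> and \<open>A l\<close> for \<open>1 \<le> l \<le> r\<close>, and
  \<open>\<rho> 0 = 0\<close> by convention. Note that \<open>analytic_on\<close> refers to neighbourhoods of the points of the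
  closed half-plane.
\<close>

definition half_plane :: "real \<Rightarrow> complex set" where
  "half_plane C0 = {s. Re s \<ge> - C0}"

definition condition_I ::
  "(nat \<Rightarrow> real) \<Rightarrow> nat \<Rightarrow> (nat \<Rightarrow> real) \<Rightarrow> (nat \<Rightarrow> real) \<Rightarrow> real \<Rightarrow> (complex \<Rightarrow> complex) \<Rightarrow> bool" where
  "condition_I b r \<rho> A C0 D \<longleftrightarrow>
     r \<ge> 1 \<and> \<rho> 0 = 0 \<and> strict_mono_on {0..r} \<rho> \<and> (\<forall>l\<in>{1..r}. A l > 0) \<and>
     0 < C0 \<and> C0 \<le> 1 \<and>
     (\<forall>s. Re s > \<rho> r \<longrightarrow>
        (\<lambda>k. complex_of_real (b (Suc k)) * of_nat (Suc k) powr (- s)) sums D s) \<and>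
     D meromorphic_on half_plane C0 \<and>
     D analytic_on (half_plane C0 - (\<lambda>l. complex_of_real (\<rho> l)) ` {1..r}) \<and>
     (\<forall>l\<in>{1..r}. is_pole D (of_real (\<rho> l)) \<and> zorder D (of_real (\<rho> l)) = -1 \<and>
        residue D (of_real (\<rho> l)) = of_real (A l))"

definition condition_II :: "real \<Rightarrow> (complex \<Rightarrow> complex) \<Rightarrow> bool" where
  "condition_II C0 D \<longleftrightarrow>
     (\<exists>C1>0. \<exists>K T. \<forall>s\<in>half_plane C0. \<bar>Im s\<bar> \<ge> T \<longrightarrow> norm (D s) \<le> K * \<bar>Im s\<bar> powr C1)"

definition const_M :: "kind \<Rightarrow> real" where
  "const_M i = (case i of Weighted_Partitions \<Rightarrow> 4 / ln 5 | Selections \<Rightarrow> 4 | Assemblies \<Rightarrow> 1)"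

text \<open>The last argument of \<open>condition_III\<close> is the rightmost pole.\<close>

definition condition_III :: "kind \<Rightarrow> (nat \<Rightarrow> real) \<Rightarrow> real \<Rightarrow> bool" where
  "condition_III i b \<rho>r \<longleftrightarrow>
     (\<forall>\<epsilon>>0. \<exists>\<delta>0>0. \<forall>\<delta>. 0 < \<delta> \<and> \<delta> < \<delta>0 \<longrightarrow>
        (\<forall>\<alpha>. sqrt \<delta> \<le> \<bar>\<alpha>\<bar> \<and> \<bar>\<alpha>\<bar> \<le> 1 / 2 \<longrightarrow>
           2 * (\<Sum>k. b (Suc k) * exp (- real (Suc k) * \<delta>) * (sin (pi * real (Suc k) * \<alpha>))\<^sup>2)
             \<ge> (1 + \<rho>r / 2 + \<epsilon>) * const_M i * \<bar>ln \<delta>\<bar>))"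

section \<open>Constants and exponents\<close>

text \<open>Riemann zeta function; only used for arguments greater than 1, where the series converges.\<close>

definition zeta_real :: "real \<Rightarrow> real" where
  "zeta_real x = (\<Sum>n. 1 / real (Suc n) powr x)"

text \<open>
  \<open>D 0\<close> and \<open>deriv D 0\<close> are real, because \<open>D\<close> is real on the real axis; \<open>Re\<close> only adjusts the type.
\<close>

definition const_h ::
  "kind \<Rightarrow> (nat \<Rightarrow> real) \<Rightarrow> (nat \<Rightarrow> real) \<Rightarrow> (complex \<Rightarrow> complex) \<Rightarrow> nat \<Rightarrow> real" where
  "const_h i \<rho> A D l =
     (if l = 0 then
        (case i of
           Weighted_Partitions \<Rightarrow> Re (deriv D 0)
         | Selections \<Rightarrow> Re (D 0) * ln 2
         | Assemblies \<Rightarrow> Re (D 0))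
      else
        (case i of
           Weighted_Partitions \<Rightarrow> A l * Gamma (\<rho> l) * zeta_real (\<rho> l + 1)
         | Selections \<Rightarrow> A l * Gamma (\<rho> l) * (1 - 2 powr (- \<rho> l)) * zeta_real (\<rho> l + 1)
         | Assemblies \<Rightarrow> A l * Gamma (\<rho> l)))"

definition Upsilon_tilde :: "nat \<Rightarrow> (nat \<Rightarrow> real) \<Rightarrow> real set" where
  "Upsilon_tilde r \<rho> =
     {(\<Sum>k<r. real (d k) * (\<rho> r - \<rho> k)) | d :: nat \<Rightarrow> nat. (\<Sum>k<r. d k) \<ge> 2} \<inter> {0<..\<rho> r + 1}"

definition Upsilon :: "nat \<Rightarrow> (nat \<Rightarrow> real) \<Rightarrow> real set" where
  "Upsilon r \<rho> = Upsilon_tilde r \<rho> \<union> {\<rho> r - \<rho> k | k. k < r}"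

text \<open>The \<open>s\<close>-th smallest element of the finite set \<open>Upsilon r \<rho>\<close>, for \<open>1 \<le> s \<le> card (Upsilon r \<rho>)\<close>.\<close>

definition lam :: "nat \<Rightarrow> (nat \<Rightarrow> real) \<Rightarrow> nat \<Rightarrow> real" where
  "lam r \<rho> s = sorted_list_of_set (Upsilon r \<rho>) ! (s - 1)"

definition ind1 :: "kind \<Rightarrow> real" where
  "ind1 i = (if i = Weighted_Partitions then 1 else 0)"

end

theory Submission
  imports Defs "HOL-Probability.Sinc_Integral" "HOL-Probability.Distributions" "HOL-Real_Asymp.Real_Asymp"
begin

text \<open>
  Put \<open>x = exp (- \<delta>)\<close> and let \<open>G(\<delta>)\<close> be the logarithm of the generating function at \<open>x\<close>. Under the
  tilted law proportional to \<open>c\<^sub>m x\<^sup>m\<close>, the coefficient \<open>c\<^sub>n\<close> is a point probability, so it is governed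
  by a local limit theorem once \<open>\<delta>\<close> is chosen as the saddle point for \<open>n\<close>.

  The expansion \<open>G(\<delta>) = \<Sum> h\<^sub>l \<delta> powr (- \<rho>\<^sub>l) - 1(i) D(0) ln \<delta> + const + o(1)\<close> comes from the Mellin transform:
  shifting \<open>\<integral> Gamma(s) D(s) y powr (- s) ds\<close> across the poles gives \<open>\<Sum> b\<^sub>k exp (- k y)\<close> up to a power of
  \<open>y\<close>; weighted partitions are sums of this over \<open>y = j \<delta>\<close> with weights \<open>1 / j\<close>, handled by a Riemann sum (no
  continuation of the zeta function is needed), and selections reduce to partitions through
  \<open>1 + w = (1 - w\<^sup>2) / (1 - w)\<close>. Only real \<open>\<delta>\<close> are needed: since the coefficients are nonnegative, convergence
  of the tilted moment generating functions on the real line extends to the complex plane by Montel's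
  theorem, and this gives the Gaussian limit of the characteristic functions. Away from the centre
  they are bounded by \<open>exp (- (2 / M) \<Sum> b\<^sub>k x\<^sup>k sin\<^sup>2(k \<theta> / 2))\<close>; for \<open>\<bar>\<theta>\<bar>\<close> up to order \<open>sqrt \<delta>\<close> the terms with
  \<open>k \<le> 1 / max \<delta> \<bar>\<theta>\<bar>\<close> already suffice, and beyond that condition (III) applies.

  Finally the saddle point solves \<open>(\<delta> / \<xi>) powr (\<rho>\<^sub>r + 1) = \<rho>\<^sub>r h\<^sub>r + \<Sum>\<^sub>l\<^sub><\<^sub>r \<rho>\<^sub>l h\<^sub>l \<delta> powr (\<rho>\<^sub>r - \<rho>\<^sub>l)\<close> with
  \<open>\<xi> = n powr (- 1 / (\<rho>\<^sub>r + 1))\<close>; each substitution of an expansion in powers of \<open>\<xi>\<close> into the right-hand side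
  improves its order by a fixed amount, so the exponent at the saddle point has an expansion with
  exponents in the semigroup generated by the \<open>\<rho>\<^sub>r - \<rho>\<^sub>l\<close>.
\<close>

section \<open>Generating functions as infinite products\<close>

text \<open>The obstacle is that \<open>log_gf\<close> is known only up to o(1), so asymptotics of
  its derivatives are not at hand. Hence the saddle point \<open>\<Delta> n\<close> is that of
  \<open>main_part\<close> alone, an explicit sum of powers. The logarithmic term and the convergent
  rest enter the local limit theorem only through increments over a window that is short relative to
  \<open>\<Delta> n\<close>, and these tend to 0. This keeps D(0) out of the saddle point equation;
  it reappears only in the power of n in front. The constants of condition (III) come from comparing
  a factor on a circle with its value on the real axis: the chord bound 5^y <= 1 + 4 y on [0, 1]
  gives 4 / log 5, the bound (1 + x)^2 <= 4 gives 4, and an exact real part gives 1. The number 1 +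
  \<rho>_r / 2 there is the exponent of the standard deviation, of order
  \<open>\<delta> powr (- (\<rho> r + 2) / 2)\<close>, and \<epsilon> is the surplus. In the end all
  terms are booked under l = r. This is possible because \<open>h i r\<close> is positive and every
  exponent of n in the saddle value has the form (\<rho>_r - s) / (\<rho>_r + 1).\<close>

lemma sums_compose_X_power:
  fixes f :: "nat \<Rightarrow> complex"
  assumes k: "k > 0" and f: "(\<lambda>n. f n * (z ^ k) ^ n) sums S"
  shows "(\<lambda>n. (if k dvd n then f (n div k) else 0) * z ^ n) sums S"
proof -
  have sm: "strict_mono (\<lambda>n. k * n)" using k by (auto intro!: strict_monoI)
  have "(\<lambda>n. (if k dvd (k*n) then f ((k*n) div k) else 0) * z ^ (k*n)) sums S"
    using f k by (simp add: power_mult)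
  then show ?thesis
    by (subst (asm) sums_mono_reindex[OF sm, where f = "\<lambda>n. (if k dvd n then f (n div k) else 0) * z ^ n"])
       (auto simp: image_iff)
qed

definition factor_value :: "kind \<Rightarrow> real \<Rightarrow> complex \<Rightarrow> complex" where
  "factor_value i \<beta> w = (case i of
      Weighted_Partitions \<Rightarrow> (1 - w) powr (- of_real \<beta>)
    | Selections \<Rightarrow> (1 + w) powr of_real \<beta>
    | Assemblies \<Rightarrow> exp (of_real \<beta> * w))"

definition factor_coeff :: "kind \<Rightarrow> real \<Rightarrow> nat \<Rightarrow> real" where
  "factor_coeff i \<beta> n = (case i of
      Weighted_Partitions \<Rightarrow> (-1) ^ n * ((-\<beta>) gchoose n)
    | Selections \<Rightarrow> \<beta> gchoose n
    | Assemblies \<Rightarrow> \<beta> ^ n / fact n)"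

lemma gf_factor_nth:
  assumes "k > 0"
  shows "gf_factor i b k $ n = (if k dvd n then factor_coeff i (b k) (n div k) else 0)"
proof (cases i)
  case Weighted_Partitions
  have "(- fps_X :: real fps) oo fps_X ^ k = - (fps_X ^ k)"
    using assms by (simp add: fps_compose_uminus fps_X_fps_compose_startby0)
  \<comment> \<open>Moving the sign into an inner series \<open>- fps_X\<close> leaves a composition
    with a plain power of X, whose coefficients are explicit.\<close>
  then have "fps_binomial (- b k) oo (- (fps_X ^ k)) = (fps_binomial (- b k) oo (- fps_X)) oo fps_X ^ k"
    using assms fps_compose_assoc[of "fps_X ^ k" "- fps_X :: real fps" "fps_binomial (- b k)"] by simp
  then show ?thesis using Weighted_Partitions
    by (simp add: gf_factor_def fps_nth_compose_X_power factor_coeff_def fps_compose_uminus')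
next
  case Selections
  then show ?thesis by (simp add: gf_factor_def fps_nth_compose_X_power factor_coeff_def)
next
  case Assemblies
  then show ?thesis by (simp add: gf_factor_def fps_nth_compose_X_power factor_coeff_def)
qed

lemma of_real_gchoose: "(of_real a gchoose n :: complex) = of_real (a gchoose n)"
  by (simp add: gbinomial_prod_rev)

lemma factor_coeff_sums:
  assumes "norm w < 1"
  shows "(\<lambda>n. of_real (factor_coeff i \<beta> n) * w ^ n) sums factor_value i \<beta> w"
proof (cases i)
  case Weighted_Partitions
  have "(\<lambda>n. (of_real (-\<beta>) gchoose n) * (- w) ^ n) sums (1 + (- w)) powr of_real (-\<beta>)"
    by (rule gen_binomial_complex) (use assms in simp)
  then show ?thesis unfolding of_real_gchoose
    using Weighted_Partitions
    by (simp add: factor_coeff_def factor_value_def power_minus[of w] mult_ac)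
next
  case Selections
  have "(\<lambda>n. (of_real \<beta> gchoose n) * w ^ n) sums (1 + w) powr of_real \<beta>"
    by (rule gen_binomial_complex) (use assms in simp)
  then show ?thesis unfolding of_real_gchoose
    using Selections by (simp add: factor_coeff_def factor_value_def)
next
  case Assemblies
  have "(\<lambda>n. (of_real \<beta> * w) ^ n /\<^sub>R fact n) sums exp (of_real \<beta> * w)"
    by (rule exp_converges)
  then show ?thesis using Assemblies
    by (simp add: factor_coeff_def factor_value_def power_mult_distrib scaleR_conv_of_real field_simps)
qed

lemma gf_factor_sums:
  assumes "norm z < 1" "k > 0"
  shows "(\<lambda>n. of_real (gf_factor i b k $ n) * z ^ n) sums factor_value i (b k) (z ^ k)"
proof -
  have "norm (z ^ k) < 1" using assms by (simp add: norm_power power_less_one_iff)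
  from sums_compose_X_power[OF \<open>k > 0\<close> factor_coeff_sums[OF this]] show ?thesis
    by (simp add: gf_factor_nth[OF \<open>k > 0\<close>] if_distrib cong: if_cong)
qed

lemma gf_factor_nth_0 [simp]: "k > 0 \<Longrightarrow> gf_factor i b k $ 0 = 1"
  by (cases i) (simp_all add: gf_factor_nth factor_coeff_def)

lemma gf_factor_nth_small: "0 < n \<Longrightarrow> n < k \<Longrightarrow> gf_factor i b k $ n = 0"
  by (auto simp: gf_factor_nth dest: dvd_imp_le)

section \<open>Finite partial products and their coefficientwise limit\<close>

definition gf_partial :: "kind \<Rightarrow> (nat \<Rightarrow> real) \<Rightarrow> nat \<Rightarrow> real fps" where
  "gf_partial i b N = (\<Prod>k<N. gf_factor i b (Suc k))"

lemma gf_partial_nth_0 [simp]: "gf_partial i b N $ 0 = 1"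
  by (induction N) (simp_all add: gf_partial_def)

lemma gf_partial_Suc: "gf_partial i b (Suc N) = gf_partial i b N * gf_factor i b (Suc N)"
  by (simp add: gf_partial_def)

text \<open>The new factor is 1 plus terms of degree at least N + 1. So the n-th coefficient is
  frozen from N = n on, which is X-adic convergence of the product.\<close>

lemma gf_partial_Suc_nth: "n \<le> N \<Longrightarrow> gf_partial i b (Suc N) $ n = gf_partial i b N $ n"
proof -
  assume "n \<le> N"
  have "gf_partial i b (Suc N) $ n
      = (\<Sum>j=0..n. gf_partial i b N $ j * gf_factor i b (Suc N) $ (n - j))"
    by (simp add: gf_partial_Suc fps_mult_nth)
  also have "\<dots> = (\<Sum>j\<in>{n}. gf_partial i b N $ j * gf_factor i b (Suc N) $ (n - j))"
    using \<open>n \<le> N\<close> by (intro sum.mono_neutral_right) (auto simp: gf_factor_nth_small)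
  finally show ?thesis by simp
qed

lemma gf_partial_nth_stable: "n \<le> N \<Longrightarrow> gf_partial i b N $ n = gf_partial i b n $ n"
  by (induction N rule: dec_induct) (auto simp: gf_partial_Suc_nth)

lemma gf_partial_nonneg:
  assumes "admissible_weights i b"
  shows "gf_partial i b N $ n \<ge> 0"
proof (induction N arbitrary: n)
  case 0 then show ?case by (simp add: gf_partial_def)
next
  case (Suc N)
  then show ?case using assms
    by (auto simp: gf_partial_Suc fps_mult_nth admissible_weights_def intro!: sum_nonneg)
qed

lemma gf_partial_mono:
  assumes "admissible_weights i b"
  shows "gf_partial i b N $ n \<le> gf_partial i b (Suc N) $ n"
proof -
  have "gf_partial i b N $ n = gf_partial i b N $ n * gf_factor i b (Suc N) $ (n - n)" by simp
  also have "\<dots> \<le> (\<Sum>j=0..n. gf_partial i b N $ j * gf_factor i b (Suc N) $ (n - j))"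
    using assms gf_partial_nonneg[OF assms]
    by (intro member_le_sum) (auto simp: admissible_weights_def)
  finally show ?thesis by (simp add: gf_partial_Suc fps_mult_nth)
qed

lemma gf_partial_le:
  assumes "admissible_weights i b"
  shows "gf_partial i b N $ n \<le> gf_partial i b n $ n"
proof (cases "n \<le> N")
  case True then show ?thesis using gf_partial_nth_stable[of n N i b] by linarith
next
  case False
  have "incseq (\<lambda>N. gf_partial i b N $ n)"
    by (rule incseq_SucI) (rule gf_partial_mono[OF assms])
  from incseqD[OF this, of N n] False show ?thesis by simp
qed

lemma prodinf_gf_factor:
  "(\<Prod>k. gf_factor i b (Suc k)) = Abs_fps (\<lambda>n. gf_partial i b n $ n)" (is "_ = ?P")
proof -
  have "(\<lambda>n. \<Prod>k\<le>n. gf_factor i b (Suc k)) \<longlonglongrightarrow> ?P"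
  proof (rule tendsto_fpsI)
    fix n
    show "\<forall>\<^sub>F N in sequentially. (\<Prod>k\<le>N. gf_factor i b (Suc k)) $ n = ?P $ n"
      using eventually_ge_at_top[of n]
    proof eventually_elim
      case (elim N)
      have "(\<Prod>k\<le>N. gf_factor i b (Suc k)) = gf_partial i b (Suc N)"
        by (simp add: gf_partial_def lessThan_Suc_atMost)
      then show ?case using elim gf_partial_nth_stable[of n "Suc N" i b] by simp
    qed
  qed
  \<comment> \<open>\<open>raw_has_prod\<close> includes that the limit is nonzero.\<close>
  moreover have "?P $ 0 \<noteq> 0" by simp
  then have "?P \<noteq> 0" by (metis fps_zero_nth)
  ultimately have "raw_has_prod (\<lambda>k. gf_factor i b (Suc k)) 0 ?P"
    by (simp add: raw_has_prod_def)
  then have "(\<lambda>k. gf_factor i b (Suc k)) has_prod ?P" by (simp add: has_prod_def)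
  then show ?thesis by (rule has_prod_unique[symmetric])
qed

text \<open>Both sides satisfy F' = (p + q)' F with constant term 1, and this equation determines
  the coefficients recursively.\<close>

lemma fps_exp_compose_add:
  fixes p q :: "real fps"
  assumes "p $ 0 = 0" "q $ 0 = 0"
  shows "fps_exp 1 oo (p + q) = (fps_exp 1 oo p) * (fps_exp 1 oo q)"
proof -
  define F where "F = fps_exp 1 oo (p + q)"
  define G where "G = (fps_exp 1 oo p) * (fps_exp 1 oo q)"
  have dF: "fps_deriv F = fps_deriv (p + q) * F"
    unfolding F_def using assms by (subst fps_compose_deriv) (simp_all add: mult_ac)
  have dG: "fps_deriv G = fps_deriv (p + q) * G"
    unfolding G_def using assms by (simp add: fps_compose_deriv algebra_simps)
  have "F $ n = G $ n" for n
  proof (induction n rule: less_induct)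
    case (less n)
    show ?case
    proof (cases n)
      case 0 then show ?thesis by (simp add: F_def G_def)
    next
      case (Suc m)
      have "of_nat (Suc m) * F $ n = (\<Sum>j=0..m. fps_deriv (p+q) $ j * F $ (m - j))"
        using Suc arg_cong[OF dF, of "\<lambda>f. f $ m"] by (simp add: fps_mult_nth)
      also have "\<dots> = (\<Sum>j=0..m. fps_deriv (p+q) $ j * G $ (m - j))"
        using Suc by (intro sum.cong refl arg_cong2[where f = "(*)"] less) auto
      also have "\<dots> = of_nat (Suc m) * G $ n"
        using Suc arg_cong[OF dG, of "\<lambda>f. f $ m"] by (simp add: fps_mult_nth)
      finally show ?thesis by simp
    qed
  qed
  then show ?thesis by (simp add: fps_eq_iff F_def G_def)
qed

text \<open>The generating function of assemblies is defined as one exponential, not as a product.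
  Splitting the exponent one k at a time shows that its truncations are partial products as for the
  other two kinds, so all three are treated together from \<open>coeff_c_eq\<close> on.\<close>

lemma gf_partial_Assemblies:
  "gf_partial Assemblies b N = fps_exp 1 oo Abs_fps (\<lambda>k. if 0 < k \<and> k \<le> N then b k else 0)"
proof (induction N)
  case 0
  have "Abs_fps (\<lambda>k. if 0 < k \<and> k \<le> 0 then b k else 0) = 0" by (simp add: fps_eq_iff)
  then show ?case by (simp add: gf_partial_def)
next
  case (Suc N)
  let ?A = "\<lambda>N. Abs_fps (\<lambda>k. if 0 < k \<and> k \<le> N then b k else 0)"
  have split: "?A (Suc N) = ?A N + fps_const (b (Suc N)) * fps_X ^ Suc N"
    by (auto simp: fps_eq_iff fps_X_power_nth le_Suc_eq simp del: power_Suc)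
  have "gf_factor Assemblies b (Suc N) = (fps_exp 1 oo (fps_const (b (Suc N)) * fps_X)) oo fps_X ^ Suc N"
    by (simp add: gf_factor_def)
  also have "\<dots> = fps_exp 1 oo ((fps_const (b (Suc N)) * fps_X) oo fps_X ^ Suc N)"
    by (rule fps_compose_assoc[symmetric]) auto
  also have "(fps_const (b (Suc N)) * fps_X) oo fps_X ^ Suc N = fps_const (b (Suc N)) * fps_X ^ Suc N"
    by (subst fps_compose_mult_distrib) (simp_all add: fps_X_fps_compose_startby0)
  finally show ?case
    unfolding gf_partial_Suc Suc split by (subst fps_exp_compose_add) (simp_all)
qed

lemma coeff_c_eq: "coeff_c i b n = gf_partial i b n $ n"
proof (cases i)
  case Assemblies
  have "(fps_exp 1 oo Abs_fps (\<lambda>k. if k = 0 then 0 else b k)) $ n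
      = (fps_exp 1 oo Abs_fps (\<lambda>k. if 0 < k \<and> k \<le> n then b k else 0)) $ n"
  proof -
    \<comment> \<open>Low coefficients of a power depend only on equally low coefficients of its
      base, so cutting the weights at n is harmless.\<close>
    have "(Abs_fps (\<lambda>k. if k = 0 then 0 else b k) ^ m) $ j
        = (Abs_fps (\<lambda>k. if 0 < k \<and> k \<le> n then b k else 0) ^ m) $ j" if "j \<le> n" for j m
      using that
    proof (induction m arbitrary: j)
      case (Suc m) then show ?case by (auto simp: fps_mult_nth intro!: sum.cong)
    qed simp
    then show ?thesis by (simp add: fps_compose_nth)
  qed
  then show ?thesis using Assemblies by (simp add: coeff_c_def gen_fun_def gf_partial_Assemblies)
qed (simp_all add: coeff_c_def gen_fun_def prodinf_gf_factor)

lemma gf_partial_sums: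
  assumes "norm z < 1"
  shows "(\<lambda>n. of_real (gf_partial i b N $ n) * z ^ n) sums (\<Prod>k<N. factor_value i (b (Suc k)) (z ^ Suc k))"
  using assms
proof (induction N arbitrary: z)
  case 0
  have "(\<lambda>n. of_real ((1 :: real fps) $ n) * z ^ n) sums (\<Sum>n\<in>{0}. of_real ((1 :: real fps) $ n) * z ^ n)"
    by (rule sums_finite) auto
  then show ?case by (simp add: gf_partial_def)
next
  case (Suc N)
  \<comment> \<open>Convergence at an intermediate radius gives absolute convergence at
    \<open>z\<close>, as the Cauchy product requires. This is why the induction keeps
    \<open>z\<close> arbitrary.\<close>
  obtain r where r: "norm z < r" "r < 1" using Suc.prems dense by blast
  have nr: "norm (of_real r :: complex) < 1" "norm z < norm (of_real r :: complex)"
    using r norm_ge_zero[of z] by (auto simp: abs_less_iff simp del: norm_ge_zero)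
  have s1: "summable (\<lambda>n. norm (of_real (gf_partial i b N $ n) * z ^ n))"
    using powser_insidea[OF sums_summable[OF Suc.IH[OF nr(1)]] nr(2)] .
  have s2: "summable (\<lambda>n. norm (of_real (gf_factor i b (Suc N) $ n) * z ^ n))"
    using powser_insidea[OF sums_summable[OF gf_factor_sums[OF nr(1)]] nr(2)] by blast
  have "(\<lambda>n. \<Sum>j\<le>n. (of_real (gf_partial i b N $ j) * z ^ j) * (of_real (gf_factor i b (Suc N) $ (n - j)) * z ^ (n - j)))
      sums ((\<Prod>k<N. factor_value i (b (Suc k)) (z ^ Suc k)) * factor_value i (b (Suc N)) (z ^ Suc N))"
    using Cauchy_product_sums[OF s1 s2] sums_unique[OF Suc.IH[OF Suc.prems]]
      sums_unique[OF gf_factor_sums[OF Suc.prems, of "Suc N" i b]] by simp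
  also have "(\<lambda>n. \<Sum>j\<le>n. (of_real (gf_partial i b N $ j) * z ^ j) * (of_real (gf_factor i b (Suc N) $ (n - j)) * z ^ (n - j)))
     = (\<lambda>n. of_real (gf_partial i b (Suc N) $ n) * z ^ n)"
  proof
    fix n
    have "z ^ j * z ^ (n - j) = z ^ n" if "j \<le> n" for j using that by (simp flip: power_add)
    then show "(\<Sum>j\<le>n. (of_real (gf_partial i b N $ j) * z ^ j) * (of_real (gf_factor i b (Suc N) $ (n - j)) * z ^ (n - j)))
      = of_real (gf_partial i b (Suc N) $ n) * z ^ n"
      unfolding gf_partial_Suc fps_mult_nth of_real_sum sum_distrib_right atLeast0AtMost
      by (intro sum.cong) (auto simp: mult_ac)
  qed
  finally show ?case by simp
qed

section \<open>Values of the factors on the real axis and their moduli on a circle\<close>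

definition log_factor :: "kind \<Rightarrow> real \<Rightarrow> real" where
  "log_factor i w = (case i of
      Weighted_Partitions \<Rightarrow> - ln (1 - w)
    | Selections \<Rightarrow> ln (1 + w)
    | Assemblies \<Rightarrow> w)"

lemma log_factor_nonneg: "0 \<le> w \<Longrightarrow> w < 1 \<Longrightarrow> log_factor i w \<ge> 0"
  by (auto simp: log_factor_def split: kind.split)

lemma factor_value_real:
  assumes "0 \<le> x" "x < 1"
  shows "factor_value i \<beta> (of_real x) = of_real (exp (\<beta> * log_factor i x))"
proof (cases i)
  case Weighted_Partitions
  have "(1 - complex_of_real x) powr (- of_real \<beta>) = of_real (1 - x) powr of_real (-\<beta>)" by simp
  also have "\<dots> = of_real ((1 - x) powr (-\<beta>))" using assms by (subst powr_of_real) auto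
  finally show ?thesis using Weighted_Partitions assms
    by (simp add: factor_value_def log_factor_def powr_def)
next
  case Selections
  have "(1 + complex_of_real x) powr (of_real \<beta>) = of_real (1 + x) powr of_real \<beta>" by simp
  also have "\<dots> = of_real ((1 + x) powr \<beta>)" using assms by (subst powr_of_real) auto
  finally show ?thesis using Selections assms
    by (simp add: factor_value_def log_factor_def powr_def)
next
  case Assemblies
  then show ?thesis by (simp add: factor_value_def log_factor_def exp_of_real[symmetric])
qed

lemma norm_one_minus_polar:
  fixes x \<phi> :: real
  shows "(norm (1 - of_real x * cis \<phi>))\<^sup>2 = (1 - x)\<^sup>2 + 4 * x * (sin (\<phi> / 2))\<^sup>2"
proof -
  have "(norm (1 - of_real x * cis \<phi>))\<^sup>2 = (1 - x * cos \<phi>)\<^sup>2 + (x * sin \<phi>)\<^sup>2"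
    by (simp add: cmod_power2)
  also have "\<dots> = 1 - 2 * x * cos \<phi> + x\<^sup>2 * ((cos \<phi>)\<^sup>2 + (sin \<phi>)\<^sup>2)"
    by algebra
  also have "\<dots> = 1 - 2 * x * cos \<phi> + x\<^sup>2" by simp
  also have "cos \<phi> = 1 - 2 * (sin (\<phi> / 2))\<^sup>2"
    using cos_double_sin[of "\<phi> / 2"] by simp
  finally show ?thesis
    by (simp add: power2_eq_square algebra_simps)
qed

text \<open>With s = sin^2(\<phi>/2) the identities |1 - w|^2 = (1 - x)^2 + 4 x s, |1 + w|^2 = (1 +
  x)^2 - 4 x s and Re w = x - 2 x s measure the loss against the real point x. The loss in the
  logarithm, per unit of \<open>\<beta> * x * s\<close>, is at least ln 5 / 2, 1 / 2 and 2
  respectively, that is \<open>2 / const_M i\<close>.\<close>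

lemma norm_factor_value_le:
  fixes x \<phi> \<beta> :: real
  assumes x: "0 \<le> x" "x < 1" and \<beta>: "\<beta> \<ge> 0"
  shows "norm (factor_value i \<beta> (of_real x * cis \<phi>))
    \<le> exp (- (2 / const_M i) * (\<beta> * x * (sin (\<phi> / 2))\<^sup>2)) * exp (\<beta> * log_factor i x)"
proof -
  define s where "s = (sin (\<phi> / 2))\<^sup>2"
  have s: "0 \<le> s" "s \<le> 1" by (auto simp: s_def abs_square_le_1)
  have xs: "0 \<le> x * s" "x * s \<le> 1" using s x mult_le_one[of x s] by auto
  show ?thesis
  proof (cases i)
    case Weighted_Partitions
    define N where "N = norm (1 - of_real x * cis \<phi>)"
    have N2: "N\<^sup>2 = (1 - x)\<^sup>2 + 4 * x * s" by (simp add: N_def norm_one_minus_polar s_def)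
    have "N\<^sup>2 > 0" using x s by (auto simp: N2 intro!: add_pos_nonneg)
    then have N: "N > 0" by (simp add: N_def)
    \<comment> \<open>Convexity of 5^y, used as Young's inequality with weights \<open>x * s\<close>
      and \<open>1 - x * s\<close>: on [0, 1] the graph lies below its chord 1 + 4 y.\<close>
    have "(5::real) powr (x * s) * 1 powr (1 - x * s) \<le> (x * s) * 5 + (1 - x * s) * 1"
      by (rule Youngs_inequality_0) (use xs in auto)
    then have "exp (x * s * ln 5) \<le> 1 + 4 * (x * s)"
      by (simp add: powr_def mult_ac)
    then have "(1 - x)\<^sup>2 * exp (x * s * ln 5) \<le> (1 - x)\<^sup>2 * (1 + 4 * (x * s))"
      by (intro mult_left_mono) auto
    also have "\<dots> \<le> N\<^sup>2"
    proof -
      have "(1 - x)\<^sup>2 * (4 * (x * s)) \<le> 1 * (4 * (x * s))"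
        using x xs by (intro mult_right_mono) (auto simp: power_le_one)
      then show ?thesis by (simp add: N2 algebra_simps)
    qed
    finally have "ln ((1 - x)\<^sup>2 * exp (x * s * ln 5)) \<le> ln (N\<^sup>2)"
      using x by (intro ln_mono) auto
    then have "2 * ln (1 - x) + x * s * ln 5 \<le> 2 * ln N"
      using x N by (simp add: ln_mult ln_realpow)
    then have "\<beta> * (2 * ln (1 - x) + x * s * ln 5) \<le> \<beta> * (2 * ln N)"
      using \<beta> by (rule mult_left_mono)
    then have "- \<beta> * ln N \<le> - (ln 5 / 2) * (\<beta> * x * s) + \<beta> * (- ln (1 - x))"
      by (simp add: algebra_simps)
    moreover have "norm (factor_value i \<beta> (of_real x * cis \<phi>)) = N powr (- \<beta>)"
      using Weighted_Partitions norm_powr_real_powr'[of "of_real (- \<beta>)" "1 - of_real x * cis \<phi>"]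
      by (simp add: factor_value_def N_def)
    ultimately show ?thesis using N Weighted_Partitions
      by (simp add: powr_def const_M_def log_factor_def flip: exp_add s_def)
  next
    case Selections
    define N where "N = norm (1 + of_real x * cis \<phi>)"
    have N2: "N\<^sup>2 = (1 + x)\<^sup>2 - 4 * x * s"
      using norm_one_minus_polar[of "-x" \<phi>] by (simp add: N_def s_def)
    have N: "N > 0"
    proof -
      have "norm (of_real x * cis \<phi> :: complex) < 1" using x by (simp add: norm_mult)
      then show ?thesis unfolding N_def
        by (metis add.commute add_eq_0_iff less_irrefl norm_minus_cancel norm_one zero_less_norm_iff)
    qed
    have "N\<^sup>2 \<le> (1 + x)\<^sup>2 * (1 - x * s)"
    proof -
      have "(1 + x)\<^sup>2 \<le> 2\<^sup>2" using x by (intro power_mono) auto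
      then have "(1 + x)\<^sup>2 * (x * s) \<le> 4 * (x * s)" using xs by (intro mult_right_mono) auto
      then show ?thesis by (simp add: N2 algebra_simps)
    qed
    also have "\<dots> \<le> (1 + x)\<^sup>2 * exp (- (x * s))"
      using exp_ge_add_one_self[of "- (x * s)"] by (intro mult_left_mono) auto
    finally have "ln (N\<^sup>2) \<le> ln ((1 + x)\<^sup>2 * exp (- (x * s)))"
      using N x by (intro ln_mono) auto
    then have "2 * ln N \<le> 2 * ln (1 + x) - x * s"
      using x N by (simp add: ln_mult ln_realpow)
    then have "\<beta> * (2 * ln N) \<le> \<beta> * (2 * ln (1 + x) - x * s)"
      using \<beta> by (rule mult_left_mono)
    then have "\<beta> * ln N \<le> - (1 / 2) * (\<beta> * x * s) + \<beta> * ln (1 + x)"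
      by (simp add: algebra_simps)
    moreover have "norm (factor_value i \<beta> (of_real x * cis \<phi>)) = N powr \<beta>"
      using Selections norm_powr_real_powr'[of "of_real \<beta>" "1 + of_real x * cis \<phi>"]
      by (simp add: factor_value_def N_def)
    ultimately show ?thesis using N Selections
      by (simp add: powr_def const_M_def log_factor_def flip: exp_add s_def)
  next
    case Assemblies
    have c: "cos \<phi> = 1 - 2 * s" using cos_double_sin[of "\<phi> / 2"] by (simp add: s_def)
    have "\<beta> * (x * cos \<phi>) = - 2 * (\<beta> * x * s) + \<beta> * x" unfolding c by (simp add: algebra_simps)
    then show ?thesis using Assemblies
      by (simp add: factor_value_def const_M_def log_factor_def flip: exp_add s_def)
  qed
qed

lemma const_M_pos: "const_M i > 0"
  by (simp add: const_M_def split: kind.split)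

lemma coeff_c_nonneg: "admissible_weights i b \<Longrightarrow> coeff_c i b n \<ge> 0"
  by (simp add: coeff_c_eq gf_partial_nonneg)

section \<open>Passage from finite products to the power series at radius \<open>x\<close>\<close>

context
  fixes i b and x :: real
  assumes adm: "admissible_weights i b" and x: "0 \<le> x" "x < 1"
    and summ: "summable (\<lambda>k. b (Suc k) * log_factor i (x ^ Suc k))"
begin

lemma weight_nonneg: "b (Suc k) \<ge> 0"
  using adm by (simp add: admissible_weights_def)

lemma gf_partial_real_sums:
  "(\<lambda>n. gf_partial i b N $ n * x ^ n) sums exp (\<Sum>k<N. b (Suc k) * log_factor i (x ^ Suc k))"
proof -
  have "(\<Prod>k<N. factor_value i (b (Suc k)) (of_real x ^ Suc k))
      = (\<Prod>k<N. of_real (exp (b (Suc k) * log_factor i (x ^ Suc k))))"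
  proof (rule prod.cong)
    fix k
    show "factor_value i (b (Suc k)) (of_real x ^ Suc k) = of_real (exp (b (Suc k) * log_factor i (x ^ Suc k)))"
      using factor_value_real[of "x ^ Suc k" i "b (Suc k)"] x power_Suc_less_one[of x k]
      by (cases "x = 0") (auto simp: of_real_power simp del: power_Suc)
  qed simp
  also have "\<dots> = of_real (exp (\<Sum>k<N. b (Suc k) * log_factor i (x ^ Suc k)))"
    by (simp add: exp_sum)
  finally show ?thesis
    using gf_partial_sums[of "of_real x" i b N] x
    by (simp flip: of_real_power of_real_mult add: sums_of_real_iff)
qed

text \<open>The first N coefficients agree with those of the N-th partial product, whose value at
  \<open>x\<close> is at most the exponential of the full series.\<close>

lemma coeff_c_summable: "summable (\<lambda>n. coeff_c i b n * x ^ n)"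
proof (rule summableI_nonneg_bounded)
  show "0 \<le> coeff_c i b n * x ^ n" for n using x coeff_c_nonneg[OF adm] by simp
  show "(\<Sum>n<N. coeff_c i b n * x ^ n) \<le> exp (\<Sum>k. b (Suc k) * log_factor i (x ^ Suc k))" for N
  proof -
    have nonneg: "b (Suc k) * log_factor i (x ^ Suc k) \<ge> 0" for k
      using x power_Suc_less_one[of x k] weight_nonneg
      by (cases "x = 0") (auto intro!: mult_nonneg_nonneg log_factor_nonneg simp del: power_Suc)
    have "(\<Sum>n<N. coeff_c i b n * x ^ n) = (\<Sum>n<N. gf_partial i b N $ n * x ^ n)"
      by (intro sum.cong) (auto simp: coeff_c_eq gf_partial_nth_stable[OF less_imp_le])
    also have "\<dots> \<le> exp (\<Sum>k<N. b (Suc k) * log_factor i (x ^ Suc k))"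
      using gf_partial_real_sums[of N] gf_partial_nonneg[OF adm] x
      unfolding sums_iff by (metis (no_types, lifting) sum_le_suminf finite_lessThan mult_nonneg_nonneg zero_le_power)
    also have "\<dots> \<le> exp (\<Sum>k. b (Suc k) * log_factor i (x ^ Suc k))"
      using summ nonneg by (auto intro!: sum_le_suminf)
    finally show ?thesis .
  qed
qed

text \<open>Tannery's theorem with majorant \<open>coeff_c i b n * x ^ n\<close>. Convergence is
  wanted on the whole circle and not only at \<open>x\<close>, since the moduli of the factors are
  compared there.\<close>

lemma gf_partial_tendsto:
  assumes z: "norm z = x"
  shows "(\<lambda>N. \<Prod>k<N. factor_value i (b (Suc k)) (z ^ Suc k)) \<longlonglongrightarrow> (\<Sum>n. of_real (coeff_c i b n) * z ^ n)"
proof -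
  have "(\<lambda>N. \<Sum>n. of_real (gf_partial i b N $ n) * z ^ n) \<longlonglongrightarrow> (\<Sum>n. of_real (coeff_c i b n) * z ^ n)"
  proof (rule tannerys_theorem[THEN conjunct2, THEN conjunct2])
    show "(\<lambda>N. of_real (gf_partial i b N $ n) * z ^ n) \<longlonglongrightarrow> of_real (coeff_c i b n) * z ^ n" for n
      using eventually_ge_at_top[of n]
      by (intro tendsto_eventually, elim eventually_mono)
         (metis coeff_c_eq gf_partial_nth_stable)
    show "\<forall>\<^sub>F (n, N) in at_top \<times>\<^sub>F at_top. norm (of_real (gf_partial i b N $ n) * z ^ n) \<le> coeff_c i b n * x ^ n"
      using gf_partial_le[OF adm] gf_partial_nonneg[OF adm] x
      by (intro always_eventually) (auto simp: norm_mult norm_power z coeff_c_eq intro!: mult_right_mono)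
  qed (auto simp: coeff_c_summable)
  also have "(\<lambda>N. \<Sum>n. of_real (gf_partial i b N $ n) * z ^ n)
      = (\<lambda>N. \<Prod>k<N. factor_value i (b (Suc k)) (z ^ Suc k))"
    using gf_partial_sums[of z i b] x z by (auto simp: sums_iff)
  finally show ?thesis .
qed

lemma coeff_c_sums:
  "(\<lambda>n. coeff_c i b n * x ^ n) sums exp (\<Sum>k. b (Suc k) * log_factor i (x ^ Suc k))"
proof -
  have "(\<lambda>N. \<Prod>k<N. factor_value i (b (Suc k)) (of_real x ^ Suc k)) \<longlonglongrightarrow> (\<Sum>n. of_real (coeff_c i b n) * of_real x ^ n)"
    using x by (intro gf_partial_tendsto) auto
  also have "(\<lambda>N. \<Prod>k<N. factor_value i (b (Suc k)) (of_real x ^ Suc k))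
      = (\<lambda>N. of_real (exp (\<Sum>k<N. b (Suc k) * log_factor i (x ^ Suc k))))"
  proof
    fix N
    have "(\<lambda>n. complex_of_real (gf_partial i b N $ n) * of_real x ^ n) sums of_real (exp (\<Sum>k<N. b (Suc k) * log_factor i (x ^ Suc k)))"
      using sums_of_real[OF gf_partial_real_sums[of N], where 'a = complex] by simp
    with gf_partial_sums[of "of_real x" i b N] x
    show "(\<Prod>k<N. factor_value i (b (Suc k)) (of_real x ^ Suc k)) = of_real (exp (\<Sum>k<N. b (Suc k) * log_factor i (x ^ Suc k)))"
      by (simp add: sums_iff)
  qed
  also have "(\<Sum>n. of_real (coeff_c i b n) * of_real x ^ n) = complex_of_real (\<Sum>n. coeff_c i b n * x ^ n)"
    using suminf_of_real[OF coeff_c_summable, where 'a = complex] by simp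
  finally have "(\<lambda>N. exp (\<Sum>k<N. b (Suc k) * log_factor i (x ^ Suc k))) \<longlonglongrightarrow> (\<Sum>n. coeff_c i b n * x ^ n)"
    by (simp add: tendsto_of_real_iff)
  moreover have "(\<lambda>N. exp (\<Sum>k<N. b (Suc k) * log_factor i (x ^ Suc k))) \<longlonglongrightarrow> exp (\<Sum>k. b (Suc k) * log_factor i (x ^ Suc k))"
    by (intro tendsto_intros summable_LIMSEQ summ)
  ultimately have "(\<Sum>n. coeff_c i b n * x ^ n) = exp (\<Sum>k. b (Suc k) * log_factor i (x ^ Suc k))"
    by (rule LIMSEQ_unique)
  then show ?thesis using summable_sums[OF coeff_c_summable] by simp
qed

text \<open>The bound for one factor is multiplicative, so it holds for finite products and survives
  the passage to the limit.\<close>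

lemma norm_coeff_c_suminf_le:
  assumes sum2: "summable (\<lambda>k. b (Suc k) * x ^ Suc k * (sin (real (Suc k) * \<phi> / 2))\<^sup>2)"
  shows "norm (\<Sum>n. of_real (coeff_c i b n) * (of_real x * cis \<phi>) ^ n)
    \<le> exp (- (2 / const_M i) * (\<Sum>k. b (Suc k) * x ^ Suc k * (sin (real (Suc k) * \<phi> / 2))\<^sup>2))
       * exp (\<Sum>k. b (Suc k) * log_factor i (x ^ Suc k))"
proof (rule LIMSEQ_le)
  let ?z = "of_real x * cis \<phi>"
  show "(\<lambda>N. norm (\<Prod>k<N. factor_value i (b (Suc k)) (?z ^ Suc k)))
      \<longlonglongrightarrow> norm (\<Sum>n. of_real (coeff_c i b n) * ?z ^ n)"
    using x by (intro tendsto_norm gf_partial_tendsto) (auto simp: norm_mult)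
  show "(\<lambda>N. exp (- (2 / const_M i) * (\<Sum>k<N. b (Suc k) * x ^ Suc k * (sin (real (Suc k) * \<phi> / 2))\<^sup>2))
       * exp (\<Sum>k<N. b (Suc k) * log_factor i (x ^ Suc k)))
     \<longlonglongrightarrow> exp (- (2 / const_M i) * (\<Sum>k. b (Suc k) * x ^ Suc k * (sin (real (Suc k) * \<phi> / 2))\<^sup>2))
       * exp (\<Sum>k. b (Suc k) * log_factor i (x ^ Suc k))"
    by (intro tendsto_intros summable_LIMSEQ summ sum2)
  have "norm (\<Prod>k<N. factor_value i (b (Suc k)) (?z ^ Suc k))
      \<le> exp (- (2 / const_M i) * (\<Sum>k<N. b (Suc k) * x ^ Suc k * (sin (real (Suc k) * \<phi> / 2))\<^sup>2))
       * exp (\<Sum>k<N. b (Suc k) * log_factor i (x ^ Suc k))" for N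
  proof -
    have "norm (\<Prod>k<N. factor_value i (b (Suc k)) (?z ^ Suc k))
       \<le> (\<Prod>k<N. exp (- (2 / const_M i) * (b (Suc k) * x ^ Suc k * (sin (real (Suc k) * \<phi> / 2))\<^sup>2))
            * exp (b (Suc k) * log_factor i (x ^ Suc k)))"
      unfolding prod_norm[symmetric]
    proof (intro prod_mono conjI)
      fix k
      have xk: "0 \<le> x ^ Suc k" "x ^ Suc k < 1"
        using x power_Suc_less_one[of x k] by (cases "x = 0"; auto simp del: power_Suc)+
      have "?z ^ Suc k = of_real (x ^ Suc k) * cis (real (Suc k) * \<phi>)"
        by (simp only: power_mult_distrib Complex.DeMoivre of_real_power)
      then show "norm (factor_value i (b (Suc k)) (?z ^ Suc k))
         \<le> exp (- (2 / const_M i) * (b (Suc k) * x ^ Suc k * (sin (real (Suc k) * \<phi> / 2))\<^sup>2))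
            * exp (b (Suc k) * log_factor i (x ^ Suc k))"
        using norm_factor_value_le[OF xk weight_nonneg] by (simp only:)
    qed simp
    then show ?thesis by (simp only: prod.distrib exp_sum[symmetric] finite_lessThan sum_distrib_left)
  qed
  then show "\<exists>N0. \<forall>N\<ge>N0. norm (\<Prod>k<N. factor_value i (b (Suc k)) (?z ^ Suc k))
      \<le> exp (- (2 / const_M i) * (\<Sum>k<N. b (Suc k) * x ^ Suc k * (sin (real (Suc k) * \<phi> / 2))\<^sup>2))
       * exp (\<Sum>k<N. b (Suc k) * log_factor i (x ^ Suc k))" by blast
qed

end

section \<open>Shifting vertical lines of integration\<close>

lemma line_integrable:
  fixes f :: "real \<Rightarrow> complex"
  assumes cont: "continuous_on UNIV f"
    and bound: "\<And>t. \<bar>t\<bar> \<ge> T \<Longrightarrow> norm (f t) \<le> K / (1 + t\<^sup>2)"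
  shows "integrable lborel f"
proof -
  have "compact (f ` {-\<bar>T\<bar>..\<bar>T\<bar>})"
    by (intro compact_continuous_image continuous_on_subset[OF cont]) auto
  then obtain L where L: "\<And>t. \<bar>t\<bar> \<le> \<bar>T\<bar> \<Longrightarrow> norm (f t) \<le> L"
    by (fastforce dest!: compact_imp_bounded simp: bounded_iff)
  define K' where "K' = \<bar>K\<bar> + \<bar>L\<bar> * (1 + T\<^sup>2)"
  have "norm (f t) \<le> K' * inverse (1 + t\<^sup>2)" for t
  proof (cases "\<bar>t\<bar> \<ge> \<bar>T\<bar>")
    case True
    then have "norm (f t) \<le> K / (1 + t\<^sup>2)" using bound by auto
    moreover have "K \<le> K'"
      using abs_ge_self[of K] mult_nonneg_nonneg[of "\<bar>L\<bar>" "1 + T\<^sup>2"] unfolding K'_def by (smt (verit) zero_le_power2 abs_ge_zero)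
    then have "K / (1 + t\<^sup>2) \<le> K' / (1 + t\<^sup>2)"
      by (intro divide_right_mono) auto
    ultimately show ?thesis by (simp add: divide_inverse)
  next
    case False
    then have "1 + t\<^sup>2 \<le> 1 + T\<^sup>2" by (simp add: abs_le_square_iff[symmetric])
    have "norm (f t) * (1 + t\<^sup>2) \<le> \<bar>L\<bar> * (1 + T\<^sup>2)"
      using L[of t] False \<open>1 + t\<^sup>2 \<le> 1 + T\<^sup>2\<close> by (intro mult_mono) auto
    also have "\<dots> \<le> K'" by (simp add: K'_def)
    finally show ?thesis
      by (simp add: field_simps add_pos_nonneg)
  qed
  note bd = this
  have int1: "integrable lborel (\<lambda>t. K' * inverse (1 + t\<^sup>2))"
    using integrable_inverse_1_plus_square
    by (simp add: set_integrable_def)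
  show ?thesis
    by (rule Bochner_Integration.integrable_bound[OF int1])
       (use bd borel_measurable_continuous_onI[OF cont] in \<open>auto intro!: order_trans[OF _ abs_ge_self]\<close>)
qed

lemma line_integral_limit:
  fixes f :: "real \<Rightarrow> complex"
  assumes cont: "continuous_on UNIV f" and int: "integrable lborel f"
  shows "(\<lambda>n. integral {-real n..real n} f) \<longlonglongrightarrow> integral\<^sup>L lborel f"
proof -
  have "(\<lambda>n. LINT t|lborel. indicator {-real n..real n} t *\<^sub>R f t) \<longlonglongrightarrow> integral\<^sup>L lborel f"
  proof (rule integral_dominated_convergence[where w = "\<lambda>t. norm (f t)"])
    show "AE t in lborel. (\<lambda>n. indicator {-real n..real n} t *\<^sub>R f t) \<longlonglongrightarrow> f t"
    proof (intro AE_I2 tendsto_eventually)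
      fix t :: real
      obtain N :: nat where "\<bar>t\<bar> \<le> real N" using real_arch_simple by blast
      then show "\<forall>\<^sub>F n in sequentially. indicator {- real n..real n} t *\<^sub>R f t = f t"
        by (intro eventually_sequentiallyI[of N]) (auto simp: indicator_def abs_le_iff)
    qed
  qed (use int in \<open>auto simp: indicator_def\<close>)
  moreover have "(LINT t|lborel. indicator {-real n..real n} t *\<^sub>R f t) = integral {-real n..real n} f" for n
    using set_borel_integral_eq_integral(2)[of "{-real n..real n}" f]
      integrable_mult_indicator[of "{-real n..real n}" lborel f] int
    by (simp add: set_lebesgue_integral_def set_integrable_def)
  ultimately show ?thesis by simp
qed

lemma contour_integral_rectpath:
  assumes cont: "continuous_on (path_image (rectpath z w)) f"
    and less: "Re z < Re w" "Im z < Im w"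
  shows "contour_integral (rectpath z w) f =
    contour_integral (linepath z (Complex (Re w) (Im z))) f
    + \<i> * integral {Im z..Im w} (\<lambda>t. f (Complex (Re w) t))
    - contour_integral (linepath (Complex (Re z) (Im w)) w) f
    - \<i> * integral {Im z..Im w} (\<lambda>t. f (Complex (Re z) t))"
proof -
  let ?a2 = "Complex (Re w) (Im z)" and ?a4 = "Complex (Re z) (Im w)"
  have pi: "path_image (rectpath z w) = path_image (linepath z ?a2) \<union> path_image (linepath ?a2 w)
      \<union> path_image (linepath w ?a4) \<union> path_image (linepath ?a4 z)"
    by (simp add: rectpath_def Let_def path_image_join Un_assoc)
  have ci: "f contour_integrable_on linepath z ?a2" "f contour_integrable_on linepath ?a2 w"
     "f contour_integrable_on linepath w ?a4" "f contour_integrable_on linepath ?a4 z"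
    by (auto intro!: contour_integrable_continuous_linepath continuous_on_subset[OF cont]
        simp: pi path_image_linepath[symmetric] simp del: path_image_linepath)
  have "contour_integral (rectpath z w) f = contour_integral (linepath z ?a2) f +
     contour_integral (linepath ?a2 w) f + contour_integral (linepath w ?a4) f + contour_integral (linepath ?a4 z) f"
    using ci by (simp add: rectpath_def Let_def contour_integral_join valid_path_join contour_integrable_joinI)
  moreover have "contour_integral (linepath ?a2 w) f = \<i> * integral {Im z..Im w} (\<lambda>t. f (Complex (Re w) t))"
    using less by (intro contour_integral_linepath_same_Re) auto
  moreover have "contour_integral (linepath z ?a4) f = \<i> * integral {Im z..Im w} (\<lambda>t. f (Complex (Re z) t))"
    using less by (intro contour_integral_linepath_same_Re) auto
  moreover have "contour_integral (linepath ?a4 z) f = - contour_integral (linepath z ?a4) f"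
    by (intro contour_integral_reverse_linepath continuous_on_subset[OF cont]) (auto simp: pi)
  moreover have "contour_integral (linepath w ?a4) f = - contour_integral (linepath ?a4 w) f"
    by (intro contour_integral_reverse_linepath continuous_on_subset[OF cont]) (auto simp: pi)
  ultimately show ?thesis by simp
qed

text \<open>The residue theorem on rectangles with horizontal sides at heights -n and n; these sides
  vanish by the quadratic decay. The factor is 2 pi rather than 2 pi i because ds = i dt on the
  vertical lines. The slightly wider strip from \<open>a'\<close> to \<open>b'\<close> supplies an
  open set around the closed rectangles.\<close>

theorem vertical_line_shift:
  fixes F :: "complex \<Rightarrow> complex"
  assumes ab: "a' < a" "a < b" "b < b'"
    and holo: "F holomorphic_on ({s. a' < Re s \<and> Re s < b'} - pts)"
    and pts: "finite pts" "pts \<subseteq> {s. a < Re s \<and> Re s < b}"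
    and bound: "\<And>s. a \<le> Re s \<Longrightarrow> Re s \<le> b \<Longrightarrow> \<bar>Im s\<bar> \<ge> T \<Longrightarrow> norm (F s) \<le> K / (1 + (Im s)\<^sup>2)"
  shows "integrable lborel (\<lambda>t. F (Complex a t))" "integrable lborel (\<lambda>t. F (Complex b t))"
    and "(LINT t|lborel. F (Complex b t)) - (LINT t|lborel. F (Complex a t))
       = 2 * pi * (\<Sum>p\<in>pts. residue F p)"
proof -
  define S where "S = {s. a' < Re s \<and> Re s < b'}"
  have S: "open S" "convex S"
  proof -
    have "S = {s. Re s > a'} \<inter> {s. Re s < b'}" by (auto simp: S_def)
    then show "open S" "convex S"
      by (auto intro!: open_Int open_halfspace_Re_gt open_halfspace_Re_lt convex_Int
          convex_halfspace_Re_gt convex_halfspace_Re_lt)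
  qed
  have contF: "continuous_on (S - pts) F"
    using holo by (simp add: S_def holomorphic_on_imp_continuous_on)
  have cont_line: "continuous_on UNIV (\<lambda>t. F (Complex c t))" if "c = a \<or> c = b" for c
  proof (rule continuous_on_compose2[OF contF])
    show "continuous_on UNIV (Complex c)"
      unfolding Complex_eq by (intro continuous_intros)
    show "range (Complex c) \<subseteq> S - pts" using that ab pts by (auto simp: S_def)
  qed
  show ia: "integrable lborel (\<lambda>t. F (Complex a t))"
    by (rule line_integrable[OF cont_line, of a T K]) (use bound[of "Complex a _"] ab in auto)
  show ib: "integrable lborel (\<lambda>t. F (Complex b t))"
    by (rule line_integrable[OF cont_line, of b T K]) (use bound[of "Complex b _"] ab in auto)
  obtain Y where Y: "Y > 0" "\<And>p. p \<in> pts \<Longrightarrow> \<bar>Im p\<bar> < Y"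
  proof
    show "Max (insert 0 ((\<lambda>p. \<bar>Im p\<bar>) ` pts)) + 1 > 0"
      using pts by (intro add_nonneg_pos) auto
    show "\<bar>Im p\<bar> < Max (insert 0 ((\<lambda>p. \<bar>Im p\<bar>) ` pts)) + 1" if "p \<in> pts" for p
    proof -
      have "\<bar>Im p\<bar> \<le> Max (insert 0 ((\<lambda>p. \<bar>Im p\<bar>) ` pts))"
        using pts that by (intro Max_ge) auto
      then show ?thesis by simp
    qed
  qed
  define hor where "hor n s = contour_integral (linepath (Complex a s) (Complex b s)) F" for n :: nat and s :: real
  have rect: "hor n (- real n) + \<i> * integral {-real n..real n} (\<lambda>t. F (Complex b t))
      - hor n (real n) - \<i> * integral {-real n..real n} (\<lambda>t. F (Complex a t))
     = 2 * pi * \<i> * (\<Sum>p\<in>pts. residue F p)" if n: "real n \<ge> Y" for n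
  proof -
    let ?z = "Complex a (- real n)" and ?w = "Complex b (real n)"
    have le: "Re ?z \<le> Re ?w" "Im ?z \<le> Im ?w" using ab n Y by auto
    have sub: "cbox ?z ?w \<subseteq> S" using ab by (auto simp: in_cbox_complex_iff S_def)
    have sub2: "pts \<subseteq> box ?z ?w" 
      using pts Y n by (force simp: in_box_complex_iff abs_less_iff)
    have pi: "path_image (rectpath ?z ?w) \<subseteq> S - pts"
      using path_image_rectpath_cbox_minus_box[OF le] sub sub2 by auto
    have "contour_integral (rectpath ?z ?w) F
      = 2 * pi * \<i> * (\<Sum>p\<in>pts. winding_number (rectpath ?z ?w) p * residue F p)"
    proof (rule Residue_theorem)
      show "open S" "connected S" using S convex_connected by auto
      show "F holomorphic_on S - pts" using holo by (simp add: S_def)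
      show "\<forall>z. z \<notin> S \<longrightarrow> winding_number (rectpath ?z ?w) z = 0"
        using sub by (auto intro!: winding_number_rectpath_outside[OF le])
    qed (use pts pi in auto)
    also have "(\<Sum>p\<in>pts. winding_number (rectpath ?z ?w) p * residue F p) = (\<Sum>p\<in>pts. residue F p)"
      using sub2 by (intro sum.cong) (auto simp: winding_number_rectpath)
    finally show ?thesis
      using contour_integral_rectpath[OF continuous_on_subset[OF contF pi]] ab n Y
      by (simp add: hor_def)
  qed
  have hor_bound: "norm (hor n s) \<le> K / (1 + s\<^sup>2) * (b - a)" if "\<bar>s\<bar> \<ge> T" "\<bar>s\<bar> \<ge> Y" for n s
  proof -
    have seg: "Im x = s \<and> a \<le> Re x \<and> Re x \<le> b" if "x \<in> closed_segment (Complex a s) (Complex b s)" for x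
      using that ab by (auto simp: closed_segment_same_Im closed_segment_eq_real_ivl)
    have "0 \<le> K / (1 + s\<^sup>2)" using bound[of "Complex a s"] that ab by (auto intro: order_trans[OF norm_ge_zero])
    have "norm (hor n s) \<le> K / (1 + s\<^sup>2) * norm (Complex b s - Complex a s)"
      unfolding hor_def
    proof (rule contour_integral_bound_linepath)
      show "F contour_integrable_on linepath (Complex a s) (Complex b s)"
      proof (intro contour_integrable_continuous_linepath continuous_on_subset[OF contF] subsetI)
        fix x assume "x \<in> closed_segment (Complex a s) (Complex b s)"
        with seg[of x] Y(2)[of x] that(2) ab show "x \<in> S - pts" by (auto simp: S_def)
      qed
    qed (use bound seg that \<open>0 \<le> K / (1 + s\<^sup>2)\<close> in auto)
    also have "Complex b s - Complex a s = of_real (b - a)" by (simp add: complex_eq_iff)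
    finally show ?thesis using ab by (simp del: of_real_diff)
  qed
  have lim0: "(\<lambda>n. K / (1 + (real n)\<^sup>2) * (b - a)) \<longlonglongrightarrow> 0"
    by real_asymp
  have hor_lim: "(\<lambda>n. hor n (\<sigma> * real n)) \<longlonglongrightarrow> 0" if "\<sigma> = 1 \<or> \<sigma> = -1" for \<sigma>
  proof (rule Lim_null_comparison[OF _ lim0])
    show "\<forall>\<^sub>F n in sequentially. norm (hor n (\<sigma> * real n)) \<le> K / (1 + (real n)\<^sup>2) * (b - a)"
      using eventually_ge_at_top[of "nat \<lceil>max T Y\<rceil>"]
    proof eventually_elim
      case (elim n)
      then have "real n \<ge> T" "real n \<ge> Y" by linarith+
      then show ?case using hor_bound[of "\<sigma> * real n" n] that by auto
    qed
  qed
  have "(\<lambda>n. hor n (- real n) + \<i> * integral {-real n..real n} (\<lambda>t. F (Complex b t))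
      - hor n (real n) - \<i> * integral {-real n..real n} (\<lambda>t. F (Complex a t)))
    \<longlonglongrightarrow> 0 + \<i> * (LINT t|lborel. F (Complex b t)) - 0 - \<i> * (LINT t|lborel. F (Complex a t))"
    using hor_lim[of 1] hor_lim[of "-1"]
    by (intro tendsto_intros line_integral_limit cont_line ia ib) auto
  moreover have "\<forall>\<^sub>F n in sequentially. hor n (- real n) + \<i> * integral {-real n..real n} (\<lambda>t. F (Complex b t))
      - hor n (real n) - \<i> * integral {-real n..real n} (\<lambda>t. F (Complex a t))
     = 2 * pi * \<i> * (\<Sum>p\<in>pts. residue F p)"
    using eventually_ge_at_top[of "nat \<lceil>Y\<rceil>"] by eventually_elim (use rect in \<open>auto simp: nat_le_iff ceiling_le_iff\<close>)
  ultimately have "(\<lambda>n::nat. 2 * pi * \<i> * (\<Sum>p\<in>pts. residue F p))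
    \<longlonglongrightarrow> 0 + \<i> * (LINT t|lborel. F (Complex b t)) - 0 - \<i> * (LINT t|lborel. F (Complex a t))"
    by (rule Lim_transform_eventually)
  then have "2 * pi * \<i> * (\<Sum>p\<in>pts. residue F p) = 0 + \<i> * (LINT t|lborel. F (Complex b t)) - 0 - \<i> * (LINT t|lborel. F (Complex a t))"
    by (simp add: tendsto_const_iff)
  then have "\<i> * (2 * pi * (\<Sum>p\<in>pts. residue F p)) = \<i> * ((LINT t|lborel. F (Complex b t)) - (LINT t|lborel. F (Complex a t)))"
    by (simp add: algebra_simps)
  then show "(LINT t|lborel. F (Complex b t)) - (LINT t|lborel. F (Complex a t))
       = 2 * pi * (\<Sum>p\<in>pts. residue F p)" by simp
qed

section \<open>The Cahen--Mellin integral\<close>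

lemma norm_Gamma_le:
  fixes s :: complex
  assumes "Re s > 0"
  shows "norm (Gamma s) \<le> Gamma (Re s)"
proof -
  have 1: "((\<lambda>t. of_real t powr (s - 1) / of_real (exp t)) has_integral Gamma s) {0<..}"
    by (rule Gamma_integral_complex'[OF assms])
  have "((\<lambda>t. t powr (Re s - 1) / exp t) has_integral Gamma (Re s)) {0..}"
    by (rule Gamma_integral_real[OF assms])
  also have "?this \<longleftrightarrow> ((\<lambda>t. t powr (Re s - 1) / exp t) has_integral Gamma (Re s)) {0<..}"
    by (rule has_integral_spike_set_eq; rule negligible_subset[OF negligible_sing[of "0::real"]]) (auto simp: less_le)
  finally have 2: "((\<lambda>t. t powr (Re s - 1) / exp t) has_integral Gamma (Re s)) {0<..}" .
  have "norm (integral {0<..} (\<lambda>t. of_real t powr (s - 1) / of_real (exp t)))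
     \<le> integral {0<..} (\<lambda>t. t powr (Re s - 1) / exp t)"
    by (rule integral_norm_bound_integral)
       (use 1 2 in \<open>auto simp: norm_divide norm_powr_real_powr intro: has_integral_integrable\<close>)
  then show ?thesis using 1 2 by (simp add: integral_unique)
qed

lemma Gamma_eq_shift_div_pochhammer:
  fixes s :: complex
  assumes "s \<notin> \<int>\<^sub>\<le>\<^sub>0"
  shows "Gamma s = Gamma (s + of_nat n) / pochhammer s n"
proof -
  have "pochhammer s n \<noteq> 0" using assms by (auto simp: pochhammer_eq_0_iff)
  moreover have "Gamma s * pochhammer s n = Gamma (s + of_nat n)"
    using assms by (simp add: pochhammer_Gamma Gamma_eq_zero_iff)
  ultimately show ?thesis by (metis nonzero_eq_divide_eq)
qed

text \<open>Decay of arbitrary order from the functional equation: applied \<open>m\<close> times it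
  moves \<open>s\<close> into the right half-plane, where |Gamma(s)| <= Gamma(Re s) is bounded for
  real parts in a compact interval, and each of the \<open>m\<close> denominators has modulus at
  least |Im s|.\<close>

lemma Gamma_vertical_bound:
  obtains K where "\<And>s. a \<le> Re s \<Longrightarrow> Re s \<le> b \<Longrightarrow> \<bar>Im s\<bar> \<ge> 1 \<Longrightarrow> norm (Gamma s) \<le> K / \<bar>Im s\<bar> ^ N"
proof -
  define m where "m = N + nat \<lceil>\<bar>a\<bar>\<rceil> + 1"
  have m: "a + real m > 0" "m \<ge> N" unfolding m_def by linarith+
  have "compact (Gamma ` {a + real m..b + real m})"
    using m by (intro compact_continuous_image continuous_on_Gamma) (auto elim!: nonpos_Ints_cases)
  then obtain K where K: "\<And>x. a + real m \<le> x \<Longrightarrow> x \<le> b + real m \<Longrightarrow> norm (Gamma x) \<le> K"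
    by (fastforce dest!: compact_imp_bounded simp: bounded_iff)
  show ?thesis
  proof (rule that)
    fix s assume s: "a \<le> Re s" "Re s \<le> b" "\<bar>Im s\<bar> \<ge> 1"
    have "s \<notin> \<int>\<^sub>\<le>\<^sub>0" using s by (auto elim!: nonpos_Ints_cases)
    then have "norm (Gamma s) = norm (Gamma (s + of_nat m)) / norm (pochhammer s m)"
      by (subst Gamma_eq_shift_div_pochhammer[of s m]) (auto simp: norm_divide)
    also have "\<dots> \<le> K / \<bar>Im s\<bar> ^ N"
    proof (rule frac_le)
      have "norm (Gamma (s + of_nat m)) \<le> Gamma (Re s + real m)"
        using norm_Gamma_le[of "s + of_nat m"] m s by simp
      also have "\<dots> \<le> K" using K[of "Re s + real m"] s by auto
      finally show "norm (Gamma (s + of_nat m)) \<le> K" .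
      then show "0 \<le> K" by (rule order_trans[OF norm_ge_zero])
      have "\<bar>Im s\<bar> ^ N \<le> \<bar>Im s\<bar> ^ m" using m s by (intro power_increasing) auto
      also have "\<dots> = (\<Prod>i<m. \<bar>Im s\<bar>)" by simp
      also have "\<dots> \<le> (\<Prod>i<m. norm (s + of_nat i))"
        using abs_Im_le_cmod[of "s + of_nat _"] by (intro prod_mono) auto
      also have "\<dots> = norm (pochhammer s m)"
        by (simp add: pochhammer_prod prod_norm atLeast0LessThan)
      finally show "\<bar>Im s\<bar> ^ N \<le> norm (pochhammer s m)" .
    qed (use s in auto)
    finally show "norm (Gamma s) \<le> K / \<bar>Im s\<bar> ^ N" .
  qed
qed

text \<open>As \<open>x\<close> may lie on either side of 1, both ends of the strip enter a bound
  that is uniform in the real part.\<close>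

lemma powr_neg_le_endpoints:
  fixes x :: real
  assumes "x > 0" "a \<le> \<sigma>" "\<sigma> \<le> b"
  shows "x powr (-\<sigma>) \<le> x powr (-a) + x powr (-b)"
proof (cases "x \<ge> 1")
  case True
  then have "x powr (-\<sigma>) \<le> x powr (-a)" using assms by (intro powr_mono) auto
  then show ?thesis using powr_ge_zero[of x "-b"] by linarith
next
  case False
  then have "x powr (-\<sigma>) \<le> x powr (-b)" using assms by (intro powr_mono') auto
  then show ?thesis using powr_ge_zero[of x "-a"] by linarith
qed

lemma norm_real_powr_neg:
  "x > 0 \<Longrightarrow> norm (of_real x powr (- s) :: complex) = x powr (- Re s)"
  by (simp add: norm_powr_real_powr)

lemma inverse_power_le:
  fixes t :: real
  assumes "\<bar>t\<bar> \<ge> 1" "K \<ge> 0"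
  shows "K / \<bar>t\<bar> ^ 2 \<le> 2 * K / (1 + t\<^sup>2)"
proof -
  have "1 \<le> t\<^sup>2" using assms by (simp add: abs_le_square_iff[of 1 t, simplified])
  have "2 * K / (2 * t\<^sup>2) \<le> 2 * K / (1 + t\<^sup>2)"
    using \<open>1 \<le> t\<^sup>2\<close> assms by (intro divide_left_mono mult_pos_pos) (auto intro: add_pos_nonneg)
  then show ?thesis by simp
qed

lemma Gamma_powr_bound:
  assumes "x > 0"
  obtains K where "\<And>s. a \<le> Re s \<Longrightarrow> Re s \<le> b \<Longrightarrow> \<bar>Im s\<bar> \<ge> 1
    \<Longrightarrow> norm (Gamma s * of_real x powr (-s)) \<le> K / (1 + (Im s)\<^sup>2)"
proof -
  obtain K where K: "\<And>s. a \<le> Re s \<Longrightarrow> Re s \<le> b \<Longrightarrow> \<bar>Im s\<bar> \<ge> 1 \<Longrightarrow> norm (Gamma s) \<le> K / \<bar>Im s\<bar> ^ 2"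
    using Gamma_vertical_bound by blast
  show ?thesis
  proof (rule that[of "2 * (K * (x powr (-a) + x powr (-b)))"])
    fix s assume s: "a \<le> Re s" "Re s \<le> b" "\<bar>Im s\<bar> \<ge> 1"
    have "0 \<le> K / \<bar>Im s\<bar> ^ 2" using K[OF s] by (rule order_trans[OF norm_ge_zero])
    then have "K \<ge> 0" using s by (auto simp: zero_le_divide_iff)
    have "norm (Gamma s * of_real x powr (-s)) \<le> K / \<bar>Im s\<bar> ^ 2 * (x powr (-a) + x powr (-b))"
      unfolding norm_mult norm_real_powr_neg[OF assms]
      using K[OF s] powr_neg_le_endpoints[OF assms s(1,2)] \<open>0 \<le> K / \<bar>Im s\<bar> ^ 2\<close> by (intro mult_mono) auto
    also have "\<dots> = (K * (x powr (-a) + x powr (-b))) / \<bar>Im s\<bar> ^ 2" by simp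
    also have "\<dots> \<le> 2 * (K * (x powr (-a) + x powr (-b))) / (1 + (Im s)\<^sup>2)"
      using s \<open>K \<ge> 0\<close> by (intro inverse_power_le) auto
    finally show "norm (Gamma s * of_real x powr (-s)) \<le> 2 * (K * (x powr (-a) + x powr (-b))) / (1 + (Im s)\<^sup>2)" .
  qed
qed

lemma holomorphic_Gamma_powr:
  assumes "x > 0" "A \<inter> \<int>\<^sub>\<le>\<^sub>0 = {}"
  shows "(\<lambda>s. Gamma s * of_real x powr (-s)) holomorphic_on A"
  using assms by (intro holomorphic_intros) auto

lemma tendsto_real_powr_neg:
  assumes "x > 0"
  shows "((\<lambda>s. complex_of_real x powr (- s)) \<longlongrightarrow> of_real x powr (- p)) (at p)"
proof -
  have eq: "complex_of_real x powr (-s) = exp (- s * Ln (of_real x))" for s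
    using assms by (simp add: powr_def)
  show ?thesis unfolding eq by (intro tendsto_intros)
qed

lemma residue_Gamma_powr:
  assumes "x > 0"
  shows "residue (\<lambda>s. Gamma s * of_real x powr (-s)) (- of_nat j) = (- of_real x) ^ j / fact j"
proof (rule residue_simple')
  show "open (- (\<int>\<^sub>\<le>\<^sub>0 - {-of_nat j}) :: complex set)"
    by (intro open_Compl closed_subset_Ints) auto
  show "(\<lambda>s. Gamma s * of_real x powr (-s)) holomorphic_on (- (\<int>\<^sub>\<le>\<^sub>0 - {-of_nat j}) - {- of_nat j})"
    by (rule holomorphic_Gamma_powr[OF assms]) auto
  have "(\<lambda>s. complex_of_real x powr (-s)) \<midarrow>(- of_nat j)\<rightarrow> of_real x powr (- (- of_nat j))"
    by (rule tendsto_real_powr_neg[OF assms])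
  then have "(\<lambda>s. (Gamma s * (s - (- of_nat j))) * complex_of_real x powr (-s)) \<midarrow>(- of_nat j)\<rightarrow>
      (-1) ^ j / fact j * of_real x powr (- (- of_nat j))"
    using Gamma_residues[of j, where 'a = complex] by (intro tendsto_mult) auto
  then show "(\<lambda>s. Gamma s * complex_of_real x powr (-s) * (s - (- of_nat j))) \<midarrow>(- of_nat j)\<rightarrow> (- of_real x) ^ j / fact j"
    using assms by (simp add: mult_ac powr_nat power_minus[of "of_real x"])
qed auto

text \<open>Moving the line to Re s = -J - 1/2 collects the residues (-x)^j / j! for j <= J, a
  Taylor polynomial of exp(-x). Comparison with the fixed line Re s = 1/2 bounds the remaining
  integral by a constant times x^(J+1) / J!, which tends to 0.\<close>

theorem cahen_mellin:
  fixes x c :: real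
  assumes x: "x > 0" and c: "c > 0"
  shows "integrable lborel (\<lambda>t. Gamma (Complex c t) * of_real x powr (- Complex c t))" (is "integrable _ (\<lambda>t. ?F (Complex c t))")
    and "(LINT t|lborel. Gamma (Complex c t) * of_real x powr (- Complex c t)) = of_real (2 * pi * exp (- x))"
proof -
  define I where "I \<sigma> = (LINT t|lborel. ?F (Complex \<sigma> t))" for \<sigma>
  have shift: "integrable lborel (\<lambda>t. ?F (Complex (- real J - 1/2) t)) \<and>
      integrable lborel (\<lambda>t. ?F (Complex c t)) \<and>
      I c - I (- real J - 1/2) = 2 * pi * (\<Sum>j\<le>J. (- complex_of_real x) ^ j / fact j)" for J
  proof -
    obtain K where K: "\<And>s. - real J - 1/2 \<le> Re s \<Longrightarrow> Re s \<le> c \<Longrightarrow> \<bar>Im s\<bar> \<ge> 1 \<Longrightarrow> norm (?F s) \<le> K / (1 + (Im s)\<^sup>2)"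
      using Gamma_powr_bound[OF x, of "- real J - 1/2" c] by blast
    define pts :: "complex set" where "pts = (\<lambda>j. - of_nat j) ` {..J}"
    have holo: "?F holomorphic_on {s. - real J - 3/4 < Re s \<and> Re s < c + 1} - pts"
    proof (rule holomorphic_Gamma_powr[OF x])
      show "({s. - real J - 3/4 < Re s \<and> Re s < c + 1} - pts) \<inter> \<int>\<^sub>\<le>\<^sub>0 = {}"
      proof safe
        fix s :: complex assume s: "s \<in> \<int>\<^sub>\<le>\<^sub>0" "- real J - 3/4 < Re s" "s \<notin> pts"
        then obtain n where n: "s = - of_nat n" by (auto elim: nonpos_Ints_cases')
        then have "real n < real J + 3/4" using s by simp
        then have "n \<le> J" by linarith
        with s n show "s \<in> {}" by (auto simp: pts_def)
      qed
    qed
    note vs = vertical_line_shift[OF _ _ _ holo, of "- real J - 1/2" c 1 K]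
    have p: "finite pts" "pts \<subseteq> {s. - real J - 1/2 < Re s \<and> Re s < c}"
      using c by (auto simp: pts_def)
    have "(\<Sum>p\<in>pts. residue ?F p) = (\<Sum>j\<le>J. residue ?F (- of_nat j))"
      unfolding pts_def by (subst sum.reindex) (auto simp: inj_on_def)
    also have "\<dots> = (\<Sum>j\<le>J. (- complex_of_real x) ^ j / fact j)"
      by (simp only: residue_Gamma_powr[OF x])
    finally show ?thesis
      using vs p c K unfolding I_def by auto
  qed
  then show "integrable lborel (\<lambda>t. ?F (Complex c t))" by blast
  have half: "integrable lborel (\<lambda>t. ?F (Complex (1/2) t))"
  proof -
    obtain K where K: "\<And>s. 1/2 \<le> Re s \<Longrightarrow> Re s \<le> 1/2 \<Longrightarrow> \<bar>Im s\<bar> \<ge> 1 \<Longrightarrow> norm (?F s) \<le> K / (1 + (Im s)\<^sup>2)"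
      using Gamma_powr_bound[OF x, of "1/2" "1/2"] by blast
    show ?thesis
    proof (rule line_integrable[of _ 1 K])
      have "continuous_on {s. Re s > 0} ?F"
        by (intro holomorphic_on_imp_continuous_on holomorphic_Gamma_powr[OF x]) (auto elim!: nonpos_Ints_cases)
      moreover have "continuous_on UNIV (Complex (1/2))" unfolding Complex_eq by (intro continuous_intros)
      ultimately show "continuous_on UNIV (\<lambda>t. ?F (Complex (1/2) t))"
        by (rule continuous_on_compose2) auto
    qed (use K[of "Complex (1/2) _"] in auto)
  qed
  define L where "L = (LINT t|lborel. norm (?F (Complex (1/2) t)))"
  have bound: "norm (I (- real J - 1/2)) \<le> 2 * x ^ Suc J / fact J * L" for J
  proof -
    have "norm (I (- real J - 1/2)) \<le> (LINT t|lborel. norm (?F (Complex (- real J - 1/2) t)))"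
      unfolding I_def by (rule integral_norm_bound)
    also have "\<dots> \<le> (LINT t|lborel. 2 * x ^ Suc J / fact J * norm (?F (Complex (1/2) t)))"
    proof (rule integral_mono)
      show "integrable lborel (\<lambda>t. norm (?F (Complex (- real J - 1/2) t)))"
        using shift[of J] by (intro integrable_norm) blast
      show "integrable lborel (\<lambda>t. 2 * x ^ Suc J / fact J * norm (?F (Complex (1/2) t)))"
        using half by auto
      fix t :: real
      let ?s = "Complex (- real J - 1/2) t"
      have "?s \<notin> \<int>\<^sub>\<le>\<^sub>0"
      proof
        assume "?s \<in> \<int>\<^sub>\<le>\<^sub>0"
        then obtain n where "?s = - of_nat n" by (auto elim: nonpos_Ints_cases')
        then have "real (2 * n) = real (2 * J + 1)" by (simp add: complex_eq_iff)
        then have "2 * n = 2 * J + 1" by (simp only: of_nat_eq_iff)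
        then show False by presburger
      qed
      moreover have "?s + of_nat (Suc J) = Complex (1/2) t" by (simp add: complex_eq_iff)
      ultimately have "norm (Gamma ?s) = norm (Gamma (Complex (1/2) t)) / norm (pochhammer ?s (Suc J))"
        by (metis Gamma_eq_shift_div_pochhammer norm_divide)
      also have "\<dots> \<le> norm (Gamma (Complex (1/2) t)) / (fact J / 2)"
      proof (rule divide_left_mono)
        \<comment> \<open>The factor \<open>?s + of_nat i\<close> has real part i - J - 1/2, so its
          modulus is at least J - i for i < J and 1/2 for i = J. These bounds multiply to J! /
          2.\<close>
        have "fact J / 2 = (\<Prod>i<Suc J. if i = J then 1/2 else real (J - i))"
          by (simp add: fact_prod_rev atLeast0LessThan)
        also have "\<dots> \<le> (\<Prod>i<Suc J. norm (?s + of_nat i))"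
        proof (intro prod_mono conjI)
          fix i assume "i \<in> {..<Suc J}"
          then have "real J - real i + 1/2 \<le> \<bar>Re (?s + of_nat i)\<bar>" by auto
          also have "\<dots> \<le> norm (?s + of_nat i)" by (rule abs_Re_le_cmod)
          finally show "(if i = J then 1/2 else real (J - i)) \<le> norm (?s + of_nat i)"
            using \<open>i \<in> {..<Suc J}\<close> by (auto split: if_splits)
        qed auto
        also have "\<dots> = norm (pochhammer ?s (Suc J))"
          by (simp add: pochhammer_prod prod_norm atLeast0LessThan)
        finally show "fact J / 2 \<le> norm (pochhammer ?s (Suc J))" .
        then show "0 < norm (pochhammer ?s (Suc J)) * (fact J / 2)"
          using fact_gt_zero[of J, where 'a = real]
          by (metis half_gt_zero less_le_trans mult_pos_pos)
      qed auto
      finally have G: "norm (Gamma ?s) \<le> norm (Gamma (Complex (1/2) t)) / (fact J / 2)" .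
      have P: "x powr (- Re ?s) = x ^ Suc J * x powr (- Re (Complex (1/2) t))"
        using x by (simp add: powr_realpow[symmetric] powr_add[symmetric] algebra_simps del: power_Suc)
      have re: "N / (f / 2) * (X * Y) = 2 * X / f * (N * Y)" for N f X Y :: real by simp
      show "norm (?F ?s) \<le> 2 * x ^ Suc J / fact J * norm (?F (Complex (1/2) t))"
        unfolding norm_mult norm_real_powr_neg[OF x] P
        using mult_right_mono[OF G, of "x ^ Suc J * x powr (- Re (Complex (1/2) t))"] x
        by (simp only: re powr_ge_zero zero_le_power mult_nonneg_nonneg less_imp_le)
    qed
    also have "\<dots> = 2 * x ^ Suc J / fact J * L" by (simp add: L_def)
    finally show ?thesis .
  qed
  have "(\<lambda>J. x ^ J / fact J) \<longlonglongrightarrow> 0"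
    using summable_LIMSEQ_zero[OF summable_exp[of x]] by (simp add: divide_inverse mult.commute)
  then have "(\<lambda>J. 2 * x * L * (x ^ J / fact J)) \<longlonglongrightarrow> 2 * x * L * 0" by (intro tendsto_intros)
  then have g: "(\<lambda>J. 2 * x * L * (x ^ J / fact J)) \<longlonglongrightarrow> 0" by simp
  have "norm (I (- real J - 1/2)) \<le> 2 * x * L * (x ^ J / fact J)" for J
    using bound[of J] by (simp add: mult_ac)
  then have "(\<lambda>J. I (- real J - 1/2)) \<longlonglongrightarrow> 0"
    by (intro Lim_null_comparison[OF _ g] always_eventually allI)
  moreover have "I (- real J - 1/2) = I c - 2 * pi * (\<Sum>j\<le>J. (- complex_of_real x) ^ j / fact j)" for J
    using shift[of J] by (simp add: algebra_simps)
  ultimately have lim1: "(\<lambda>J. I c - 2 * pi * (\<Sum>j\<le>J. (- complex_of_real x) ^ j / fact j)) \<longlonglongrightarrow> 0"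
    by simp
  have "(\<lambda>j. (- complex_of_real x) ^ j / fact j) sums exp (- complex_of_real x)"
    using exp_converges[of "- complex_of_real x"] by (simp add: scaleR_conv_of_real divide_inverse mult.commute)
  then have "(\<lambda>J. \<Sum>j\<le>J. (- complex_of_real x) ^ j / fact j) \<longlonglongrightarrow> exp (- complex_of_real x)"
    by (simp add: sums_def_le)
  then have "(\<lambda>J. I c - 2 * pi * (\<Sum>j\<le>J. (- complex_of_real x) ^ j / fact j)) \<longlonglongrightarrow> I c - 2 * pi * exp (- complex_of_real x)"
    by (rule tendsto_diff[OF tendsto_const tendsto_mult[OF tendsto_const]])
  from LIMSEQ_unique[OF this lim1] have "I c - 2 * pi * exp (- complex_of_real x) = 0" .
  then show "(LINT t|lborel. ?F (Complex c t)) = of_real (2 * pi * exp (- x))"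
    by (simp add: I_def exp_of_real[symmetric])
qed

section \<open>Expansion of the Lambert series\<close>

text \<open>No kind is fixed here: all three logarithms are expressed through the same series
  \<open>lambert\<close>, so its expansion is shared.\<close>

locale dirichlet_data =
  fixes b :: "nat \<Rightarrow> real" and r :: nat and \<rho> A :: "nat \<Rightarrow> real" and C0 :: real
    and D :: "complex \<Rightarrow> complex"
  assumes weight_nonneg: "\<And>k. k \<ge> 1 \<Longrightarrow> b k \<ge> 0"
    and condI: "condition_I b r \<rho> A C0 D"
    and condII: "condition_II C0 D"
begin

lemma r_pos: "r \<ge> 1" and C0: "0 < C0" "C0 \<le> 1" and rho_0: "\<rho> 0 = 0"
  using condI by (auto simp: condition_I_def)

lemma rho_less: "j < l \<Longrightarrow> l \<le> r \<Longrightarrow> \<rho> j < \<rho> l"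
  using condI unfolding condition_I_def by (auto dest: strict_mono_onD[of _ _ j l])

lemma rho_pos: "l \<in> {1..r} \<Longrightarrow> \<rho> l > 0"
  using rho_less[of 0 l] rho_0 by auto

lemma rho_r_pos: "\<rho> r > 0"
  using rho_pos[of r] r_pos by auto

lemma rho_le: "l \<le> r \<Longrightarrow> \<rho> l \<le> \<rho> r"
  using rho_less[of l r] by (cases "l = r") auto

lemma A_pos: "l \<in> {1..r} \<Longrightarrow> A l > 0"
  using condI by (auto simp: condition_I_def)

lemma b_nonneg: "b (Suc k) \<ge> 0"
  by (rule weight_nonneg) simp

lemma dirichlet_sums: "Re s > \<rho> r \<Longrightarrow> (\<lambda>k. of_real (b (Suc k)) * of_nat (Suc k) powr (- s)) sums D s"
  using condI by (auto simp: condition_I_def)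

lemma summable_dirichlet:
  assumes "\<sigma> > \<rho> r"
  shows "summable (\<lambda>k. b (Suc k) * real (Suc k) powr (- \<sigma>))"
proof -
  have "of_nat (Suc k) powr (- complex_of_real \<sigma>) = of_real (real (Suc k) powr (- \<sigma>))" for k
    using powr_of_real[of "real (Suc k)" "- \<sigma>"] by simp
  then have "(\<lambda>k. complex_of_real (b (Suc k) * real (Suc k) powr (- \<sigma>))) sums D (of_real \<sigma>)"
    using dirichlet_sums[of "of_real \<sigma>"] assms by simp
  then show ?thesis by (metis sums_summable summable_complex_of_real)
qed

definition lambert :: "real \<Rightarrow> real" where
  "lambert x = (\<Sum>k. b (Suc k) * exp (- (real (Suc k) * x)))"

lemma summable_lambert:
  assumes "x > 0"
  shows "summable (\<lambda>k. b (Suc k) * exp (- (real (Suc k) * x)))"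
proof (rule summable_comparison_test_bigo)
  let ?\<sigma> = "\<rho> r + 1"
  show "summable (\<lambda>k. norm (b (Suc k) * real (Suc k) powr (- ?\<sigma>)))"
    using summable_dirichlet[of ?\<sigma>] b_nonneg by simp
  have "(\<lambda>k. exp (- (real (Suc k) * x))) \<in> O(\<lambda>k. real (Suc k) powr (- ?\<sigma>))"
    using assms rho_r_pos by real_asymp
  then show "(\<lambda>k. b (Suc k) * exp (- (real (Suc k) * x))) \<in> O(\<lambda>k. b (Suc k) * real (Suc k) powr (- ?\<sigma>))"
    by (rule landau_o.big.mult_left)
qed

abbreviation poles :: "complex set" where
  "poles \<equiv> (\<lambda>l. complex_of_real (\<rho> l)) ` {1..r}"

lemma D_holomorphic: "D holomorphic_on ({s. Re s > - C0} - poles)"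
proof -
  have "D analytic_on (half_plane C0 - poles)" using condI by (simp add: condition_I_def)
  then have "D analytic_on ({s. Re s > - C0} - poles)"
    by (rule analytic_on_subset) (auto simp: half_plane_def)
  then show ?thesis by (rule analytic_imp_holomorphic)
qed

lemma open_domain: "finite P \<Longrightarrow> open ({s. Re s > - C0} - P)"
  by (intro open_Diff finite_imp_closed open_halfspace_Re_gt)

lemma rho_inj: "inj_on \<rho> {0..r}"
  using condI by (auto simp: condition_I_def strict_mono_on_imp_inj_on)

text \<open>Near a simple pole p the product D(s) (s - p) coincides with the holomorphic function
  \<open>zor_poly\<close>, whose value at p is the residue. In the form of a limit this multiplies
  directly with the continuous factors Gamma(s) and x^(-s).\<close>

lemma D_limit_pole:
  assumes l: "l \<in> {1..r}"
  shows "((\<lambda>s. D s * (s - of_real (\<rho> l))) \<longlongrightarrow> of_real (A l)) (at (of_real (\<rho> l)))"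
proof -
  let ?p = "complex_of_real (\<rho> l)"
  have pole: "is_pole D ?p" "zorder D ?p = -1" "residue D ?p = of_real (A l)"
    using condI l by (auto simp: condition_I_def)
  let ?S = "{s. Re s > - C0} - (poles - {?p})"
  have "D holomorphic_on (?S - {?p})"
    by (rule holomorphic_on_subset[OF D_holomorphic]) auto
  moreover have S: "open ?S" by (intro open_domain) auto
  moreover have pS: "?p \<in> ?S" using rho_pos[OF l] C0 by auto
  ultimately obtain R where R: "R > 0" "zor_poly D ?p holomorphic_on cball ?p R"
    and eq: "\<And>w. w \<in> cball ?p R - {?p} \<Longrightarrow> D w = zor_poly D ?p w / (w - ?p) ^ nat (- zorder D ?p)"
    using zorder_exist_pole[of D ?S ?p] pole(1) by blast
  have iso: "isolated_singularity_at D ?p"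
    using S pS by (intro isolated_singularity_at_holomorphic[OF \<open>D holomorphic_on (?S - {?p})\<close>])
  have "zor_poly D ?p field_differentiable at ?p"
    using R by (intro holomorphic_on_imp_differentiable_at[of _ "ball ?p R"] holomorphic_on_subset[OF R(2)]) auto
  then have "isCont (zor_poly D ?p) ?p" by (rule field_differentiable_imp_continuous_at)
  then have lim: "zor_poly D ?p \<midarrow>?p\<rightarrow> zor_poly D ?p ?p" unfolding isCont_def .
  have ev: "\<forall>\<^sub>F w in at ?p. zor_poly D ?p w = D w * (w - ?p)"
    using eventually_at_ball'[OF R(1), of ?p UNIV]
    by eventually_elim (use eq pole(2) in auto)
  have val: "zor_poly D ?p ?p = of_real (A l)"
    using residue_simple_pole[OF iso pole(1,2)] pole(3) by simp
  from Lim_transform_eventually[OF lim ev] show ?thesis unfolding val .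
qed

definition mellin_integrand :: "real \<Rightarrow> complex \<Rightarrow> complex" where
  "mellin_integrand x s = Gamma s * of_real x powr (- s) * D s"

text \<open>On the line Re s = \<open>\<rho> r + 1\<close> the Dirichlet series converges
  absolutely, uniformly in Im s, so sum and integral may be exchanged. Each summand is then a
  Cahen--Mellin integral at \<open>real (Suc k) * x\<close>.\<close>

lemma lambert_mellin:
  assumes x: "x > 0"
  defines "c \<equiv> \<rho> r + 1"
  shows "(LINT t|lborel. mellin_integrand x (Complex c t)) = of_real (2 * pi * lambert x)"
proof -
  define G where "G t = Gamma (Complex c t) * complex_of_real x powr (- Complex c t)" for t
  define f where "f k t = of_real (b (Suc k)) * of_nat (Suc k) powr (- Complex c t) * G t" for k t
  have c: "c > 0" "c > \<rho> r" using rho_r_pos by (auto simp: c_def)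
  have G: "integrable lborel G" unfolding G_def by (rule cahen_mellin[OF x c(1)])
  have f_alt: "f k t = of_real (b (Suc k)) * (Gamma (Complex c t) * complex_of_real (real (Suc k) * x) powr (- Complex c t))" for k t
  proof -
    have "complex_of_real (real (Suc k) * x) powr (- Complex c t)
      = of_real (real (Suc k)) powr (- Complex c t) * of_real x powr (- Complex c t)"
      unfolding of_real_mult using x by (intro powr_times_real) auto
    then show ?thesis by (simp add: f_def G_def)
  qed
  have kx: "real (Suc k) * x > 0" for k using x by simp
  have nf: "norm (f k t) = b (Suc k) * real (Suc k) powr (- c) * norm (G t)" for k t
    using b_nonneg[of k] norm_real_powr_neg[of "real (Suc k)" "Complex c t"]
    by (simp add: f_def norm_mult del: of_nat_Suc)
  have "(\<lambda>k. LINT t|lborel. f k t) sums (LINT t|lborel. (\<Sum>k. f k t))"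
  proof (rule sums_integral)
    show "integrable lborel (f k)" for k
      unfolding f_alt using cahen_mellin(1)[OF kx c(1)] by (intro integrable_mult_right) auto
    show "AE t in lborel. summable (\<lambda>k. norm (f k t))"
      unfolding nf using summable_dirichlet[OF c(2)] by (intro AE_I2 summable_mult2)
    have "summable (\<lambda>k. b (Suc k) * real (Suc k) powr (- c) * (LINT t|lborel. norm (G t)))"
      using summable_dirichlet[OF c(2)] by (intro summable_mult2)
    then show "summable (\<lambda>k. LINT t|lborel. norm (f k t))" unfolding nf by simp
  qed
  also have "(\<lambda>k. LINT t|lborel. f k t) = (\<lambda>k. of_real (2 * pi * (b (Suc k) * exp (- (real (Suc k) * x)))))"
  proof
    fix k
    have "(LINT t|lborel. f k t) = of_real (b (Suc k)) * of_real (2 * pi * exp (- (real (Suc k) * x)))"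
      unfolding f_alt by (simp only: integral_mult_right_zero cahen_mellin(2)[OF kx c(1)])
    then show "(LINT t|lborel. f k t) = of_real (2 * pi * (b (Suc k) * exp (- (real (Suc k) * x))))"
      by (simp add: mult_ac)
  qed
  also have "(\<lambda>t. \<Sum>k. f k t) = (\<lambda>t. mellin_integrand x (Complex c t))"
  proof
    fix t
    have "(\<lambda>k. f k t) sums (D (Complex c t) * G t)"
      unfolding f_def using dirichlet_sums[of "Complex c t"] c by (intro sums_mult2) auto
    then show "(\<Sum>k. f k t) = mellin_integrand x (Complex c t)"
      by (simp add: sums_iff mellin_integrand_def G_def mult_ac)
  qed
  finally have "(\<lambda>k. complex_of_real (2 * pi * (b (Suc k) * exp (- (real (Suc k) * x)))))
      sums (LINT t|lborel. mellin_integrand x (Complex c t))" .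
  moreover have "(\<lambda>k. complex_of_real (2 * pi * (b (Suc k) * exp (- (real (Suc k) * x)))))
      sums of_real (2 * pi * lambert x)"
    unfolding lambert_def using summable_lambert[OF x]
    by (intro sums_of_real sums_mult summable_sums)
  ultimately show ?thesis by (rule sums_unique2)
qed

lemma mellin_bound:
  assumes x: "x > 0"
  obtains T K where "\<And>s. - C0 \<le> Re s \<Longrightarrow> Re s \<le> \<rho> r + 1 \<Longrightarrow> \<bar>Im s\<bar> \<ge> T
    \<Longrightarrow> norm (mellin_integrand x s) \<le> K / (1 + (Im s)\<^sup>2)"
proof -
  obtain C1 K1 T1 where C1: "C1 > 0" and
    D: "\<And>s. s \<in> half_plane C0 \<Longrightarrow> \<bar>Im s\<bar> \<ge> T1 \<Longrightarrow> norm (D s) \<le> K1 * \<bar>Im s\<bar> powr C1"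
    using condII unfolding condition_II_def by blast
  \<comment> \<open>Of the \<open>N + 2\<close> powers of decay taken from Gamma, \<open>N\<close>
    absorb the growth of D allowed by condition (II), and two remain for integrability.\<close>
  define N where "N = nat \<lceil>C1\<rceil>"
  obtain K2 where K2: "\<And>s. - C0 \<le> Re s \<Longrightarrow> Re s \<le> \<rho> r + 1 \<Longrightarrow> \<bar>Im s\<bar> \<ge> 1 \<Longrightarrow> norm (Gamma s) \<le> K2 / \<bar>Im s\<bar> ^ (N + 2)"
    using Gamma_vertical_bound by blast
  define X where "X = x powr (- (- C0)) + x powr (- (\<rho> r + 1))"
  have X: "X \<ge> 0" by (simp add: X_def)
  show ?thesis
  proof (rule that[of "max 1 T1" "2 * (\<bar>K2\<bar> * X * \<bar>K1\<bar>)"])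
    fix s assume s: "- C0 \<le> Re s" "Re s \<le> \<rho> r + 1" "\<bar>Im s\<bar> \<ge> max 1 T1"
    have t: "\<bar>Im s\<bar> \<ge> 1" using s by simp
    have "norm (Gamma s) \<le> K2 / \<bar>Im s\<bar> ^ (N + 2)" using K2 s by auto
    also have "\<dots> \<le> \<bar>K2\<bar> / \<bar>Im s\<bar> ^ (N + 2)" by (intro divide_right_mono) auto
    finally have 1: "norm (Gamma s) \<le> \<bar>K2\<bar> / \<bar>Im s\<bar> ^ (N + 2)" .
    have 2: "norm (of_real x powr (- s)) \<le> X"
      unfolding norm_real_powr_neg[OF x] X_def using s by (intro powr_neg_le_endpoints[OF x]) auto
    have "norm (D s) \<le> K1 * \<bar>Im s\<bar> powr C1" using D[of s] s by (auto simp: half_plane_def)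
    also have "\<dots> \<le> \<bar>K1\<bar> * \<bar>Im s\<bar> powr (real N)"
      using t real_nat_ceiling_ge[of C1] by (intro mult_mono powr_mono) (auto simp: N_def)
    also have "\<dots> = \<bar>K1\<bar> * \<bar>Im s\<bar> ^ N" using t by (simp add: powr_realpow)
    finally have 3: "norm (D s) \<le> \<bar>K1\<bar> * \<bar>Im s\<bar> ^ N" .
    have "norm (mellin_integrand x s) \<le> \<bar>K2\<bar> / \<bar>Im s\<bar> ^ (N + 2) * X * (\<bar>K1\<bar> * \<bar>Im s\<bar> ^ N)"
      unfolding mellin_integrand_def norm_mult
      using 1 2 3 X by (intro mult_mono mult_nonneg_nonneg) auto
    also have "\<dots> = (\<bar>K2\<bar> * X * \<bar>K1\<bar>) / \<bar>Im s\<bar> ^ 2"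
      using t by (auto simp: power_add power2_eq_square)
    also have "\<dots> \<le> 2 * (\<bar>K2\<bar> * X * \<bar>K1\<bar>) / (1 + (Im s)\<^sup>2)"
      using t X by (intro inverse_power_le) auto
    finally show "norm (mellin_integrand x s) \<le> 2 * (\<bar>K2\<bar> * X * \<bar>K1\<bar>) / (1 + (Im s)\<^sup>2)" .
  qed
qed

lemma mellin_holomorphic:
  assumes "x > 0"
  shows "mellin_integrand x holomorphic_on ({s. Re s > - C0} - insert 0 poles)"
proof -
  have "s \<notin> \<int>\<^sub>\<le>\<^sub>0" if "s \<in> {s. Re s > - C0} - insert 0 poles" for s
  proof
    assume "s \<in> \<int>\<^sub>\<le>\<^sub>0"
    then obtain n where "s = - of_nat n" by (auto elim: nonpos_Ints_cases')
    with that C0 show False by (cases n) auto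
  qed
  then have "(\<lambda>s. Gamma s * of_real x powr (-s)) holomorphic_on ({s. Re s > - C0} - insert 0 poles)"
    by (intro holomorphic_Gamma_powr[OF assms]) auto
  moreover have "D holomorphic_on ({s. Re s > - C0} - insert 0 poles)"
    by (rule holomorphic_on_subset[OF D_holomorphic]) auto
  ultimately show ?thesis unfolding mellin_integrand_def by (rule holomorphic_on_mult)
qed

lemma residue_mellin:
  assumes x: "x > 0" and p: "p \<in> insert 0 poles"
    and lim: "((\<lambda>s. mellin_integrand x s * (s - p)) \<longlongrightarrow> c) (at p)"
  shows "residue (mellin_integrand x) p = c"
proof (rule residue_simple'[OF _ _ _ lim])
  show "open ({s. Re s > - C0} - (insert 0 poles - {p}))" by (rule open_domain) auto
  show "mellin_integrand x holomorphic_on ({s. Re s > - C0} - (insert 0 poles - {p})) - {p}"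
    by (rule holomorphic_on_subset[OF mellin_holomorphic[OF x]]) auto
  show "p \<in> {s. Re s > - C0} - (insert 0 poles - {p})"
    using p C0 rho_pos by force
qed

lemma residue_mellin_0:
  assumes x: "x > 0"
  shows "residue (mellin_integrand x) 0 = D 0"
proof (rule residue_mellin[OF x])
  have "D field_differentiable at 0"
  proof (rule holomorphic_on_imp_differentiable_at[OF D_holomorphic])
    show "open ({s. Re s > - C0} - poles)" by (rule open_domain) auto
    show "0 \<in> {s. Re s > - C0} - poles" using C0 rho_pos by force
  qed
  then have "isCont D 0" by (rule field_differentiable_imp_continuous_at)
  then have "(D \<longlongrightarrow> D 0) (at 0)" by (simp add: isCont_def)
  then have "((\<lambda>s. (Gamma s * (s + of_nat 0)) * complex_of_real x powr (- s) * D s)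
     \<longlongrightarrow> ((-1) ^ 0 / fact 0) * complex_of_real x powr (- 0) * D 0) (at 0)"
    using Gamma_residues[of 0, where 'a = complex] tendsto_real_powr_neg[OF x, of 0]
    by (intro tendsto_mult) auto
  then show "((\<lambda>s. mellin_integrand x s * (s - 0)) \<longlongrightarrow> D 0) (at 0)"
    using x by (simp add: mellin_integrand_def mult_ac)
qed simp

lemma residue_mellin_pole:
  assumes x: "x > 0" and l: "l \<in> {1..r}"
  shows "residue (mellin_integrand x) (of_real (\<rho> l)) = of_real (A l * Gamma (\<rho> l) * x powr (- \<rho> l))"
proof (rule residue_mellin[OF x])
  let ?p = "complex_of_real (\<rho> l)"
  have np: "?p \<notin> \<int>\<^sub>\<le>\<^sub>0" using rho_pos[OF l] by (auto elim!: nonpos_Ints_cases' simp: complex_eq_iff)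
  have "isCont Gamma ?p"
    by (intro field_differentiable_imp_continuous_at field_differentiable_Gamma np)
  then have "(Gamma \<longlongrightarrow> Gamma ?p) (at ?p)" unfolding isCont_def .
  then have "((\<lambda>s. Gamma s * complex_of_real x powr (- s) * (D s * (s - ?p)))
     \<longlongrightarrow> Gamma ?p * complex_of_real x powr (- ?p) * of_real (A l)) (at ?p)"
    by (intro tendsto_mult tendsto_real_powr_neg[OF x] D_limit_pole[OF l])
  moreover have "Gamma ?p * complex_of_real x powr (- ?p) * of_real (A l) = of_real (A l * Gamma (\<rho> l) * x powr (- \<rho> l))"
    using powr_of_real[of x "- \<rho> l"] x by (simp add: Gamma_complex_of_real)
  moreover have "(\<lambda>s. mellin_integrand x s * (s - ?p))
      = (\<lambda>s. Gamma s * complex_of_real x powr (- s) * (D s * (s - ?p)))"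
    by (simp add: mellin_integrand_def fun_eq_iff)
  ultimately show "((\<lambda>s. mellin_integrand x s * (s - ?p)) \<longlongrightarrow> of_real (A l * Gamma (\<rho> l) * x powr (- \<rho> l))) (at ?p)"
    by (simp only:)
qed (use l in auto)

definition polar_part :: "real \<Rightarrow> real" where
  "polar_part x = (\<Sum>l=1..r. A l * Gamma (\<rho> l) * x powr (- \<rho> l))"

text \<open>On the line Re s = - C0 / 2 the modulus of the integrand depends on x only through
  |x^(-s)| = x^(C0/2), so one integral, at x = 1, bounds the remainder for all x. The line lies
  inside the domain of the continuation and, as C0 <= 1, to the right of the pole of Gamma at -1;
  hence 0 is the only pole that Gamma contributes.\<close>

theorem lambert_expansion:
  obtains K where "\<And>x. x > 0 \<Longrightarrow> \<bar>lambert x - polar_part x - Re (D 0)\<bar> \<le> K * x powr (C0 / 2)"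
proof -
  define I where "I x = (LINT t|lborel. mellin_integrand x (Complex (- (C0/2)) t))" for x
  have shift: "integrable lborel (\<lambda>t. mellin_integrand x (Complex (- (C0/2)) t))
     \<and> of_real (2 * pi * lambert x) - I x = 2 * pi * (D 0 + of_real (polar_part x))"
    if x: "x > 0" for x
  proof -
    obtain T K where TK: "\<And>s. - C0 \<le> Re s \<Longrightarrow> Re s \<le> \<rho> r + 1 \<Longrightarrow> \<bar>Im s\<bar> \<ge> T
      \<Longrightarrow> norm (mellin_integrand x s) \<le> K / (1 + (Im s)\<^sup>2)" using mellin_bound[OF x] by blast
    have holo: "mellin_integrand x holomorphic_on ({s. - C0 < Re s \<and> Re s < \<rho> r + 2} - insert 0 poles)"
      by (rule holomorphic_on_subset[OF mellin_holomorphic[OF x]]) auto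
    have pts: "insert 0 poles \<subseteq> {s. - (C0/2) < Re s \<and> Re s < \<rho> r + 1}"
      using rho_pos rho_le C0 rho_r_pos by force
    have bd: "norm (mellin_integrand x s) \<le> K / (1 + (Im s)\<^sup>2)"
      if "- (C0/2) \<le> Re s" "Re s \<le> \<rho> r + 1" "\<bar>Im s\<bar> \<ge> T" for s
      using TK that C0 by auto
    have o: "- C0 < - (C0/2)" "- (C0/2) < \<rho> r + 1" "\<rho> r + 1 < \<rho> r + 2"
      using C0 rho_r_pos by auto
    have fin: "finite (insert 0 poles)" by simp
    have "(\<Sum>p\<in>insert 0 poles. residue (mellin_integrand x) p)
      = residue (mellin_integrand x) 0 + (\<Sum>p\<in>poles. residue (mellin_integrand x) p)"
      using rho_pos by (subst sum.insert) force+
    also have "(\<Sum>p\<in>poles. residue (mellin_integrand x) p)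
      = (\<Sum>l=1..r. residue (mellin_integrand x) (of_real (\<rho> l)))"
      by (subst sum.reindex) (auto simp: inj_on_def intro: inj_onD[OF rho_inj])
    also have "\<dots> = of_real (polar_part x)"
      by (simp add: residue_mellin_pole[OF x] polar_part_def)
    finally show ?thesis
      using vertical_line_shift(1,3)[OF o holo fin pts bd] lambert_mellin[OF x] residue_mellin_0[OF x]
      by (simp add: I_def)
  qed
  define L where "L = (LINT t|lborel. norm (mellin_integrand 1 (Complex (- (C0/2)) t)))"
  show ?thesis
  proof (rule that[of "L / (2 * pi)"])
    fix x :: real assume x: "x > 0"
    have "norm (I x) \<le> (LINT t|lborel. norm (mellin_integrand x (Complex (- (C0/2)) t)))"
      unfolding I_def by (rule integral_norm_bound)
    also have "\<dots> = (LINT t|lborel. x powr (C0/2) * norm (mellin_integrand 1 (Complex (- (C0/2)) t)))"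
      using norm_real_powr_neg[OF x] by (simp add: mellin_integrand_def norm_mult mult_ac)
    also have "\<dots> = x powr (C0/2) * L" by (simp add: L_def)
    finally have I: "norm (I x) \<le> x powr (C0/2) * L" .
    have "of_real (2 * pi * lambert x) - I x = 2 * pi * (D 0 + of_real (polar_part x))"
      using shift[OF x] by blast
    from arg_cong[OF this, of Re] have "2 * pi * (lambert x - polar_part x - Re (D 0)) = Re (I x)"
      by (simp add: algebra_simps)
    then have "lambert x - polar_part x - Re (D 0) = Re (I x) / (2 * pi)"
      by (simp add: nonzero_eq_divide_eq mult.commute)
    then have "\<bar>lambert x - polar_part x - Re (D 0)\<bar> = \<bar>Re (I x)\<bar> / (2 * pi)"
      by (simp add: abs_mult)
    also have "\<dots> \<le> (x powr (C0/2) * L) / (2 * pi)"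
      using I abs_Re_le_cmod[of "I x"] by (intro divide_right_mono) auto
    finally show "\<bar>lambert x - polar_part x - Re (D 0)\<bar> \<le> L / (2 * pi) * x powr (C0 / 2)"
      by (simp add: mult.commute)
  qed
qed

end

section \<open>Expansion of the logarithm of the generating function\<close>

lemma powr_envelope_integrable:
  fixes c q :: real
  assumes "c > 0" "q > 0"
  defines "h \<equiv> (\<lambda>x. if x \<le> 0 then 0 else if x \<le> 1 then x powr (c - 1) else x powr (- q - 1))"
  shows "integrable lborel h"
proof -
  have 1: "((\<lambda>x. x powr (c - 1)) has_integral (1 powr (c - 1 + 1) / (c - 1 + 1))) {0..1}"
    using assms by (intro has_integral_powr_from_0) auto
  have 2: "((\<lambda>x. x powr (- q - 1)) has_integral (-(1 powr (- q - 1 + 1)) / (- q - 1 + 1))) {1..}"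
    using assms by (intro has_integral_powr_to_inf) auto
  have "(\<lambda>x. x powr (c - 1)) absolutely_integrable_on {0..1}"
    using 1 by (intro nonnegative_absolutely_integrable_1) (auto simp: has_integral_integrable)
  then have 1: "integrable lborel (\<lambda>x. indicator {0..1} x *\<^sub>R x powr (c - 1))"
    unfolding set_integrable_def by (subst (asm) integrable_completion) auto
  have "(\<lambda>x. x powr (- q - 1)) absolutely_integrable_on {1..}"
    using 2 by (intro nonnegative_absolutely_integrable_1) (auto simp: has_integral_integrable)
  then have 2: "integrable lborel (\<lambda>x. indicator {1..} x *\<^sub>R x powr (- q - 1))"
    unfolding set_integrable_def by (subst (asm) integrable_completion) auto
  have h: "h \<in> borel_measurable lborel" unfolding h_def by measurable
  show ?thesis
    by (rule Bochner_Integration.integrable_bound[OF Bochner_Integration.integrable_add[OF 1 2] h])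
       (auto simp: h_def indicator_def)
qed

text \<open>The sum is the integral of the step function \<open>F \<delta>\<close>, which samples
  \<open>\<omega>\<close> at right end points. The envelope \<open>h\<close> is decreasing because c
  <= 1, so sampling to the right keeps \<open>F \<delta>\<close> below \<open>K * h\<close>, and
  dominated convergence covers the singularity at 0 and the tail at once.\<close>

lemma riemann_sum_improper:
  fixes \<omega> :: "real \<Rightarrow> real"
  assumes cont: "continuous_on {0<..} \<omega>" and cq: "0 < c" "c \<le> 1" "q > 0"
    and small: "\<And>x. 0 < x \<Longrightarrow> x \<le> 1 \<Longrightarrow> \<bar>\<omega> x\<bar> \<le> K * x powr (c - 1)"
    and large: "\<And>x. 1 \<le> x \<Longrightarrow> \<bar>\<omega> x\<bar> \<le> K * x powr (- q - 1)"
  shows "((\<lambda>\<delta>. \<Sum>j. \<delta> * \<omega> (real (Suc j) * \<delta>)) \<longlongrightarrow> (LINT x|lborel. indicator {0<..} x * \<omega> x)) (at_right 0)"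
proof -
  define h where "h = (\<lambda>x::real. if x \<le> 0 then 0 else if x \<le> 1 then x powr (c - 1) else x powr (- q - 1))"
  have h_int: "integrable lborel h" unfolding h_def by (rule powr_envelope_integrable) (use cq in auto)
  have K: "K \<ge> 0" using small[of 1] by (auto intro: order_trans[OF abs_ge_zero])
  have \<omega>_le: "\<bar>\<omega> x\<bar> \<le> K * h x" if "x > 0" for x
    using that small[of x] large[of x] by (auto simp: h_def)
  have h_dec: "h y \<le> h x" if "0 < x" "x \<le> y" for x y
  proof -
    have "y powr (c - 1) \<le> x powr (c - 1)" using that cq by (intro powr_mono2') auto
    moreover have "y powr (-q - 1) \<le> x powr (- q - 1)" using that cq by (intro powr_mono2') auto
    moreover have "y powr (- q - 1) \<le> 1" if "y \<ge> 1" using that cq powr_mono[of "-q-1" 0 y] by simp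
    moreover have "1 \<le> x powr (c - 1)" if "x \<le> 1" using that \<open>0 < x\<close> cq powr_mono'[of "c-1" 0 x] by simp
    ultimately show ?thesis using that by (auto simp: h_def)
  qed
  define F where "F \<delta> x = (if x > 0 then \<omega> (\<delta> * of_int \<lceil>x / \<delta>\<rceil>) else 0)" for \<delta> x :: real
  define f where "f \<delta> j x = indicator {real j * \<delta><..real (Suc j) * \<delta>} x * \<omega> (real (Suc j) * \<delta>)" for \<delta> x :: real and j
  have F_eq: "F \<delta> x = (\<Sum>j. f \<delta> j x) \<and> summable (\<lambda>j. norm (f \<delta> j x))" if \<delta>: "\<delta> > 0" for \<delta> x
  proof (cases "x > 0")
    case True
    define m where "m = nat \<lceil>x / \<delta>\<rceil> - 1"
    have "\<lceil>x / \<delta>\<rceil> > 0" using True \<delta> by simp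
    then have m: "\<lceil>x / \<delta>\<rceil> = int (Suc m)" unfolding m_def by linarith
    have iff: "x \<in> {real j * \<delta><..real (Suc j) * \<delta>} \<longleftrightarrow> j = m" for j
    proof -
      have "x \<in> {real j * \<delta><..real (Suc j) * \<delta>} \<longleftrightarrow> real j < x / \<delta> \<and> x / \<delta> \<le> real (Suc j)"
        using \<delta> by (simp add: pos_less_divide_eq pos_divide_le_eq)
      also have "\<dots> \<longleftrightarrow> \<lceil>x / \<delta>\<rceil> = int (Suc j)" by (simp add: ceiling_eq_iff)
      finally show ?thesis unfolding m by auto
    qed
    have f: "f \<delta> j x = (if j = m then \<omega> (real (Suc m) * \<delta>) else 0)" for j
      unfolding f_def indicator_def iff by auto
    have "F \<delta> x = \<omega> (real (Suc m) * \<delta>)" using True by (simp add: F_def m mult.commute)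
    moreover have "(\<Sum>j. f \<delta> j x) = \<omega> (real (Suc m) * \<delta>)"
      unfolding f using sums_single[of m "\<lambda>_. \<omega> (real (Suc m) * \<delta>)"] by (simp add: sums_iff)
    moreover have "summable (\<lambda>j. norm (f \<delta> j x))"
      unfolding f by (rule summable_finite[of "{m}"]) auto
    ultimately show ?thesis by simp
  next
    case False
    have "f \<delta> j x = 0" for j
    proof -
      have "real j * \<delta> \<ge> 0" using \<delta> by simp
      then show ?thesis using False by (auto simp: f_def indicator_def)
    qed
    then show ?thesis using False by (simp add: F_def)
  qed
  have sums_F: "(\<lambda>j. \<delta> * \<omega> (real (Suc j) * \<delta>)) sums (LINT x|lborel. F \<delta> x)" if \<delta>: "\<delta> > 0" for \<delta>
  proof -
    have int_ind: "(LINT x|lborel. indicator {real j * \<delta><..real (Suc j) * \<delta>} x * a) = \<delta> * a"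
      "integrable lborel (\<lambda>x. indicator {real j * \<delta><..real (Suc j) * \<delta>} x * a)" for j and a :: real
    proof -
      have "emeasure lborel {real j * \<delta><..real (Suc j) * \<delta>} < \<infinity>" by (subst emeasure_lborel_Ioc) (use \<delta> in \<open>auto simp: algebra_simps\<close>)
      then show "integrable lborel (\<lambda>x. indicator {real j * \<delta><..real (Suc j) * \<delta>} x * a)"
        by (intro integrable_mult_left) (auto intro!: integrable_real_indicator)
      have "measure lborel {real j * \<delta><..real (Suc j) * \<delta>} = \<delta>"
        using \<delta> by (subst measure_lborel_Ioc) (auto simp: algebra_simps)
      then show "(LINT x|lborel. indicator {real j * \<delta><..real (Suc j) * \<delta>} x * a) = \<delta> * a"
        by simp
    qed
    have "(\<lambda>j. LINT x|lborel. f \<delta> j x) sums (LINT x|lborel. (\<Sum>j. f \<delta> j x))"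
    proof (rule sums_integral)
      show "integrable lborel (f \<delta> j)" for j unfolding f_def by (rule int_ind)
      show "AE x in lborel. summable (\<lambda>j. norm (f \<delta> j x))" using F_eq[OF \<delta>] by simp
      have "norm (f \<delta> j x) = indicator {real j * \<delta><..real (Suc j) * \<delta>} x * \<bar>\<omega> (real (Suc j) * \<delta>)\<bar>" for j x
        by (simp add: f_def abs_mult)
      then have eq: "(LINT x|lborel. norm (f \<delta> j x)) = \<delta> * \<bar>\<omega> (real (Suc j) * \<delta>)\<bar>" for j
        using int_ind by simp
      have "summable (\<lambda>j. \<delta> * (K * \<delta> powr (- q - 1)) * (real (Suc j) powr (- q - 1)))"
        using cq summable_Suc_iff[of "\<lambda>n. real n powr (- q - 1)"]
        by (intro summable_mult) (simp add: summable_real_powr_iff del: of_nat_Suc)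
      moreover have "\<forall>\<^sub>F j in sequentially. norm (\<delta> * \<bar>\<omega> (real (Suc j) * \<delta>)\<bar>) \<le> \<delta> * (K * \<delta> powr (- q - 1)) * (real (Suc j) powr (- q - 1))"
        using eventually_ge_at_top[of "nat \<lceil>1 / \<delta>\<rceil>"]
      proof eventually_elim
        case (elim j)
        then have "1 / \<delta> \<le> real (Suc j)" by linarith
        then have "1 \<le> real (Suc j) * \<delta>" using \<delta> by (simp add: pos_divide_le_eq)
        then have "\<bar>\<omega> (real (Suc j) * \<delta>)\<bar> \<le> K * (real (Suc j) * \<delta>) powr (- q - 1)" by (rule large)
        also have "\<dots> = K * \<delta> powr (- q - 1) * real (Suc j) powr (- q - 1)"
          using \<delta> by (simp add: powr_mult mult_ac del: of_nat_Suc)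
        finally have "\<delta> * \<bar>\<omega> (real (Suc j) * \<delta>)\<bar> \<le> \<delta> * (K * \<delta> powr (- q - 1) * real (Suc j) powr (- q - 1))"
          using \<delta> by (intro mult_left_mono) auto
        then show ?case using \<delta> by (simp add: abs_mult mult_ac del: of_nat_Suc)
      qed
      ultimately show "summable (\<lambda>j. LINT x|lborel. norm (f \<delta> j x))"
        unfolding eq by (rule summable_comparison_test_ev[rotated])
    qed
    moreover have "(LINT x|lborel. f \<delta> j x) = \<delta> * \<omega> (real (Suc j) * \<delta>)" for j
      unfolding f_def by (rule int_ind)
    moreover have "(LINT x|lborel. (\<Sum>j. f \<delta> j x)) = (LINT x|lborel. F \<delta> x)"
      using F_eq[OF \<delta>] by simp
    ultimately show ?thesis by simp
  qed
  have F_meas: "F \<delta> \<in> borel_measurable lborel" if \<delta>: "\<delta> > 0" for \<delta>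
  proof -
    have "(\<lambda>x. \<Sum>j. f \<delta> j x) \<in> borel_measurable lborel"
      unfolding f_def by measurable
    then show ?thesis using F_eq[OF \<delta>] by (simp cong: measurable_cong)
  qed
  show ?thesis
    unfolding tendsto_at_iff_sequentially
  proof (intro allI impI)
    fix X :: "nat \<Rightarrow> real" assume X: "\<forall>i. X i \<in> {0<..} - {0}" "X \<longlonglongrightarrow> 0"
    then have Xpos: "X i > 0" for i by auto
    have "(\<lambda>i. LINT x|lborel. F (X i) x) \<longlonglongrightarrow> (LINT x|lborel. indicator {0<..} x * \<omega> x)"
    proof (rule integral_dominated_convergence[where w = "\<lambda>x. K * h x"])
      have "(\<lambda>x. if x \<in> {0<..} then \<omega> x else 0) \<in> borel_measurable borel"
        by (rule borel_measurable_continuous_on_if) (use cont in auto)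
      also have "(\<lambda>x. if x \<in> {0<..} then \<omega> x else 0) = (\<lambda>x. indicator {0<..} x * \<omega> x)"
        by (auto simp: indicator_def)
      finally show "(\<lambda>x. indicator {0<..} x * \<omega> x) \<in> borel_measurable lborel" by simp
      show "F (X i) \<in> borel_measurable lborel" for i using F_meas Xpos by simp
      show "integrable lborel (\<lambda>x. K * h x)" using h_int by simp
      show "AE x in lborel. (\<lambda>i. F (X i) x) \<longlonglongrightarrow> indicator {0<..} x * \<omega> x"
      proof (rule AE_I2)
        fix x :: real
        show "(\<lambda>i. F (X i) x) \<longlonglongrightarrow> indicator {0<..} x * \<omega> x"
        proof (cases "x > 0")
          case True
          have "(\<lambda>i. X i * of_int \<lceil>x / X i\<rceil>) \<longlonglongrightarrow> x"
          proof (rule tendsto_sandwich[where f = "\<lambda>_. x" and h = "\<lambda>i. x + X i"])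
            show "\<forall>\<^sub>F i in sequentially. x \<le> X i * of_int \<lceil>x / X i\<rceil>"
            proof (intro always_eventually allI)
              fix i
              have "X i * (x / X i) \<le> X i * of_int \<lceil>x / X i\<rceil>" using Xpos[of i] by (intro mult_left_mono) auto
              then show "x \<le> X i * of_int \<lceil>x / X i\<rceil>" using Xpos[of i] by simp
            qed
            show "\<forall>\<^sub>F i in sequentially. X i * of_int \<lceil>x / X i\<rceil> \<le> x + X i"
            proof (intro always_eventually allI)
              fix i
              have "of_int \<lceil>x / X i\<rceil> \<le> x / X i + 1" by linarith
              then have "X i * of_int \<lceil>x / X i\<rceil> \<le> X i * (x / X i + 1)" using Xpos[of i] by (intro mult_left_mono) auto
              then show "X i * of_int \<lceil>x / X i\<rceil> \<le> x + X i" using Xpos[of i] by (simp add: distrib_left)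
            qed
            show "(\<lambda>i. x + X i) \<longlonglongrightarrow> x" using tendsto_add[OF tendsto_const[of x] X(2)] by simp
          qed auto
          moreover have "isCont \<omega> x" using cont True by (simp add: continuous_on_eq_continuous_at)
          ultimately have "(\<lambda>i. \<omega> (X i * of_int \<lceil>x / X i\<rceil>)) \<longlonglongrightarrow> \<omega> x"
            by (rule isCont_tendsto_compose[rotated])
          then show ?thesis using True by (simp add: F_def)
        qed (simp add: F_def)
      qed
      show "AE x in lborel. norm (F (X i) x) \<le> K * h x" for i
      proof (rule AE_I2)
        fix x :: real
        show "norm (F (X i) x) \<le> K * h x"
        proof (cases "x > 0")
          case True
          have ge: "x \<le> X i * of_int \<lceil>x / X i\<rceil>"
          proof -
            have "X i * (x / X i) \<le> X i * of_int \<lceil>x / X i\<rceil>" using Xpos[of i] by (intro mult_left_mono) auto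
            then show ?thesis using Xpos[of i] by simp
          qed
          then have "\<bar>\<omega> (X i * of_int \<lceil>x / X i\<rceil>)\<bar> \<le> K * h (X i * of_int \<lceil>x / X i\<rceil>)"
            using True by (intro \<omega>_le) auto
          also have "\<dots> \<le> K * h x" using h_dec[OF True ge] K by (intro mult_left_mono)
          finally show ?thesis using True by (simp add: F_def)
        qed (simp add: F_def h_def)
      qed
    qed
    moreover have "(\<Sum>j. X i * \<omega> (real (Suc j) * X i)) = (LINT x|lborel. F (X i) x)" for i
      using sums_F[OF Xpos] by (simp add: sums_iff)
    ultimately show "((\<lambda>\<delta>. \<Sum>j. \<delta> * \<omega> (real (Suc j) * \<delta>)) \<circ> X) \<longlonglongrightarrow> (LINT x|lborel. indicator {0<..} x * \<omega> x)"
      by (simp add: o_def)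
  qed
qed

lemma sums_minus_ln:
  fixes w :: real
  assumes "\<bar>w\<bar> < 1"
  shows "(\<lambda>j. w ^ Suc j / real (Suc j)) sums - ln (1 - w)"
proof -
  have "(\<lambda>n. - ((-(-w)) ^ n) / real n) sums ln (1 + (-w))" by (rule ln_series') (use assms in simp)
  then have "(\<lambda>n. - (- ((-(-w)) ^ n) / real n)) sums - ln (1 + (-w))" by (rule sums_minus)
  then have "(\<lambda>n. w ^ n / real n) sums - ln (1 - w)" by simp
  then show ?thesis using sums_Suc_iff[of "\<lambda>n. w ^ n / real n" "- ln (1 - w)"] by simp
qed

lemma exp_minus_power: "exp (- \<delta>) ^ n = exp (- (real n * \<delta>))"
  by (simp add: exp_of_nat_mult[symmetric])

lemma log_factor_le:
  assumes "0 \<le> w" "w \<le> q" "q < 1"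
  shows "log_factor i w \<le> w / (1 - q)"
proof -
  have ww: "w \<le> w / (1 - q)" using assms by (simp add: pos_le_divide_eq mult_left_le)
  show ?thesis
  proof (cases i)
    case Weighted_Partitions
    have "- ln (1 - w) = ln (1 / (1 - w))" using assms by (simp add: ln_div)
    also have "\<dots> \<le> 1 / (1 - w) - 1" using assms by (intro ln_le_minus_one) auto
    also have "\<dots> = w / (1 - w)" using assms by (simp add: field_simps)
    also have "\<dots> \<le> w / (1 - q)" using assms by (intro divide_left_mono) auto
    finally show ?thesis using Weighted_Partitions by (simp add: log_factor_def)
  next
    case Selections
    then show ?thesis using assms ww ln_add_one_self_le_self[of w] by (simp add: log_factor_def)
  next
    case Assemblies
    then show ?thesis using ww by (simp add: log_factor_def)
  qed
qed

section \<open>Logarithms of the generating functions as sums over multiples of \<delta>\<close>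

context dirichlet_data
begin

definition log_gf :: "kind \<Rightarrow> real \<Rightarrow> real" where
  "log_gf i \<delta> = (\<Sum>k. b (Suc k) * log_factor i (exp (- \<delta>) ^ Suc k))"

lemma summable_log_gf:
  assumes "\<delta> > 0"
  shows "summable (\<lambda>k. b (Suc k) * log_factor i (exp (- \<delta>) ^ Suc k))"
proof (rule summable_comparison_test')
  show "summable (\<lambda>k. b (Suc k) * exp (- (real (Suc k) * \<delta>)) / (1 - exp (- \<delta>)))"
    using summable_lambert[OF assms] by (rule summable_divide)
  fix k :: nat
  have w: "0 \<le> exp (- \<delta>) ^ Suc k" "exp (- \<delta>) ^ Suc k \<le> exp (- \<delta>)" "exp (- \<delta>) < 1"
    using assms power_decreasing[of 1 "Suc k" "exp (- \<delta>)"] by auto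
  have "log_factor i (exp (- \<delta>) ^ Suc k) \<ge> 0" using w by (intro log_factor_nonneg) linarith+
  moreover have "b (Suc k) * log_factor i (exp (- \<delta>) ^ Suc k) \<le> b (Suc k) * (exp (- \<delta>) ^ Suc k / (1 - exp (- \<delta>)))"
    using b_nonneg[of k] log_factor_le[OF w] by (intro mult_left_mono)
  ultimately show "norm (b (Suc k) * log_factor i (exp (- \<delta>) ^ Suc k)) \<le> b (Suc k) * exp (- (real (Suc k) * \<delta>)) / (1 - exp (- \<delta>))"
    using b_nonneg[of k] unfolding exp_minus_power by simp
qed

text \<open>The logarithm -ln(1 - w) is expanded in powers of w = exp(-k \<delta>) and the sums over
  k and j are exchanged. The partial sums of the logarithm are nonnegative and dominated by the
  logarithm itself, which is what Tannery's theorem asks for.\<close>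

lemma log_gf_Weighted_Partitions_sums:
  assumes \<delta>: "\<delta> > 0"
  shows "(\<lambda>j. lambert (real (Suc j) * \<delta>) / real (Suc j)) sums log_gf Weighted_Partitions \<delta>"
proof -
  define f where "f k J = b (Suc k) * (\<Sum>j<J. (exp (- \<delta>) ^ Suc k) ^ Suc j / real (Suc j))" for k J
  have w: "\<bar>exp (- \<delta>) ^ Suc k\<bar> < 1" for k
    using \<delta> power_Suc_less_one[of "exp (- \<delta>)" k] by simp
  have ln: "(\<lambda>j. (exp (- \<delta>) ^ Suc k) ^ Suc j / real (Suc j)) sums log_factor Weighted_Partitions (exp (- \<delta>) ^ Suc k)" for k
    unfolding log_factor_def by (simp only: kind.case) (rule sums_minus_ln[OF w])
  have "(\<lambda>J. \<Sum>k. f k J) \<longlonglongrightarrow> log_gf Weighted_Partitions \<delta>"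
    unfolding log_gf_def
  proof (rule tannerys_theorem[THEN conjunct2, THEN conjunct2])
    show "f k \<longlonglongrightarrow> b (Suc k) * log_factor Weighted_Partitions (exp (- \<delta>) ^ Suc k)" for k
      unfolding f_def using ln[of k] unfolding sums_def by (intro tendsto_intros)
    show "\<forall>\<^sub>F (k, J) in at_top \<times>\<^sub>F at_top. norm (f k J) \<le> b (Suc k) * log_factor Weighted_Partitions (exp (- \<delta>) ^ Suc k)"
    proof (intro always_eventually allI, clarify)
      fix k J :: nat
      have "(\<Sum>j<J. (exp (- \<delta>) ^ Suc k) ^ Suc j / real (Suc j)) \<le> log_factor Weighted_Partitions (exp (- \<delta>) ^ Suc k)"
        using ln[of k] sums_unique[OF ln[of k]] by (auto intro!: sum_le_suminf dest: sums_summable)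
      moreover have "(\<Sum>j<J. (exp (- \<delta>) ^ Suc k) ^ Suc j / real (Suc j)) \<ge> 0" by (intro sum_nonneg) auto
      ultimately show "norm (f k J) \<le> b (Suc k) * log_factor Weighted_Partitions (exp (- \<delta>) ^ Suc k)"
        unfolding f_def using b_nonneg[of k] by (simp add: abs_mult mult_left_mono del: of_nat_Suc power_Suc)
    qed
  qed (use summable_log_gf[OF \<delta>] in auto)
  moreover have "(\<Sum>k. f k J) = (\<Sum>j<J. lambert (real (Suc j) * \<delta>) / real (Suc j))" for J
  proof -
    have t: "b (Suc k) * ((exp (- \<delta>) ^ Suc k) ^ Suc j / real (Suc j)) = b (Suc k) * exp (- (real (Suc k) * (real (Suc j) * \<delta>))) / real (Suc j)" for j k
    proof -
      have "(exp (- \<delta>) ^ Suc k) ^ Suc j = exp (- (real (Suc k) * (real (Suc j) * \<delta>)))"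
        by (simp only: power_mult[symmetric] exp_minus_power of_nat_mult mult.assoc mult.left_commute[of "real (Suc j)"])
      then show ?thesis by simp
    qed
    have "(\<Sum>k. f k J) = (\<Sum>k. \<Sum>j<J. b (Suc k) * exp (- (real (Suc k) * (real (Suc j) * \<delta>))) / real (Suc j))"
      unfolding f_def sum_distrib_left t ..
    also have "\<dots> = (\<Sum>j<J. \<Sum>k. b (Suc k) * exp (- (real (Suc k) * (real (Suc j) * \<delta>))) / real (Suc j))"
      using \<delta> by (intro suminf_sum summable_divide summable_lambert) auto
    also have "\<dots> = (\<Sum>j<J. lambert (real (Suc j) * \<delta>) / real (Suc j))"
      unfolding lambert_def using \<delta> by (intro sum.cong refl suminf_divide summable_lambert) auto
    finally show ?thesis .
  qed
  ultimately show ?thesis unfolding sums_def by simp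
qed

lemma lambert_nonneg: "x > 0 \<Longrightarrow> lambert x \<ge> 0"
  unfolding lambert_def using b_nonneg by (intro suminf_nonneg summable_lambert) auto

lemma lambert_decay:
  assumes "x \<ge> 1"
  shows "lambert x \<le> lambert 1 * exp (1 - x)"
proof -
  have "lambert x \<le> (\<Sum>k. b (Suc k) * exp (- (real (Suc k) * 1)) * exp (1 - x))"
    unfolding lambert_def
  proof (rule suminf_le)
    fix k
    have "(1 + real k) * 1 \<le> (1 + real k) * x" "0 \<le> real k * (x - 1)" using assms by (auto intro!: mult_left_mono)
    then have "- (real (Suc k) * x) \<le> - (real (Suc k) * 1) + (1 - x)" by (simp add: algebra_simps)
    then show "b (Suc k) * exp (- (real (Suc k) * x)) \<le> b (Suc k) * exp (- (real (Suc k) * 1)) * exp (1 - x)"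
      unfolding mult.assoc exp_add[symmetric] using b_nonneg[of k] by (intro mult_left_mono) auto
    show "summable (\<lambda>k. b (Suc k) * exp (- (real (Suc k) * x)))"
      using assms by (intro summable_lambert) auto
    show "summable (\<lambda>k. b (Suc k) * exp (- (real (Suc k) * 1)) * exp (1 - x))"
      by (intro summable_mult2 summable_lambert) auto
  qed
  also have "\<dots> = lambert 1 * exp (1 - x)"
    unfolding lambert_def by (intro suminf_mult2[symmetric] summable_lambert) auto
  finally show ?thesis .
qed

text \<open>The series is exp(-x) times a power series in exp(-x), evaluated inside its disc of
  convergence.\<close>

lemma continuous_on_lambert: "continuous_on {0<..} lambert"
proof (intro continuous_at_imp_continuous_on ballI)
  fix x :: real assume x: "x \<in> {0<..}"
  have t: "b (Suc k) * exp (- (real (Suc k) * y)) = exp (- y) * (b (Suc k) * exp (- y) ^ k)" for k y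
    unfolding exp_minus_power[symmetric] by simp
  have s: "summable (\<lambda>k. b (Suc k) * exp (- y) ^ k)" if "y > 0" for y
    using summable_lambert[OF that] unfolding t by (simp only: summable_cmult_iff exp_not_eq_zero simp_thms)
  have lam: "lambert y = exp (- y) * (\<Sum>k. b (Suc k) * exp (- y) ^ k)" if "y > 0" for y
    unfolding lambert_def t by (rule suminf_mult[OF s[OF that]])
  have "summable (\<lambda>k. b (Suc k) * exp (- (x / 2)) ^ k)" using x by (intro s) auto
  then have "isCont (\<lambda>z. \<Sum>k. b (Suc k) * z ^ k) (exp (- x))"
    by (rule isCont_powser) (use x in auto)
  then have "isCont (\<lambda>y. exp (- y) * (\<Sum>k. b (Suc k) * exp (- y) ^ k)) x"
    by (intro continuous_intros isCont_o2[of x "\<lambda>y. exp (- y)" "\<lambda>z. \<Sum>k. b (Suc k) * z ^ k"]) auto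
  moreover have "\<forall>\<^sub>F y in nhds x. lambert y = exp (- y) * (\<Sum>k. b (Suc k) * exp (- y) ^ k)"
    using eventually_nhds_in_open[of "{0<..}" x] x by (auto elim!: eventually_mono simp: lam)
  ultimately show "isCont lambert x"
    using isCont_cong[of lambert "\<lambda>y. exp (- y) * (\<Sum>k. b (Suc k) * exp (- y) ^ k)" x] by blast
qed

text \<open>Subtracting D(0) exp(-x) instead of the constant D(0) changes only terms of order x at
  0, but it makes the remainder decay at infinity, so that \<open>remainder x / x\<close> is
  integrable on the half-line. Summed over multiples of \<delta> with weights 1/j, the exponential
  yields exactly -D(0) ln(1 - exp(-\<delta>)).\<close>

definition remainder :: "real \<Rightarrow> real" where
  "remainder x = lambert x - polar_part x - Re (D 0) * exp (- x)"

lemma remainder_small: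
  obtains K where "\<And>x. 0 < x \<Longrightarrow> x \<le> 1 \<Longrightarrow> \<bar>remainder x\<bar> \<le> K * x powr (C0 / 2)"
proof -
  obtain K where K: "\<And>x. x > 0 \<Longrightarrow> \<bar>lambert x - polar_part x - Re (D 0)\<bar> \<le> K * x powr (C0 / 2)"
    using lambert_expansion by blast
  show ?thesis
  proof (rule that[of "K + \<bar>Re (D 0)\<bar>"])
    fix x :: real assume x: "0 < x" "x \<le> 1"
    have "1 - exp (- x) \<le> x" using exp_ge_add_one_self[of "-x"] by simp
    also have "x = x powr 1" using x by simp
    also have "\<dots> \<le> x powr (C0 / 2)" using x C0 by (intro powr_mono') auto
    finally have "\<bar>Re (D 0)\<bar> * (1 - exp (- x)) \<le> \<bar>Re (D 0)\<bar> * x powr (C0 / 2)" by (intro mult_left_mono) auto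
    moreover have "remainder x = (lambert x - polar_part x - Re (D 0)) + Re (D 0) * (1 - exp (- x))"
      by (simp add: remainder_def algebra_simps)
    then have "\<bar>remainder x\<bar> \<le> \<bar>lambert x - polar_part x - Re (D 0)\<bar> + \<bar>Re (D 0)\<bar> * (1 - exp (- x))"
      using x abs_triangle_ineq[of "lambert x - polar_part x - Re (D 0)" "Re (D 0) * (1 - exp (- x))"] by (simp add: abs_mult)
    ultimately show "\<bar>remainder x\<bar> \<le> (K + \<bar>Re (D 0)\<bar>) * x powr (C0 / 2)"
      using K[OF x(1)] by (simp add: distrib_right)
  qed
qed

lemma remainder_large:
  obtains K q where "q > 0" "\<And>x. x \<ge> 1 \<Longrightarrow> \<bar>remainder x\<bar> \<le> K * x powr (- q)"
proof -
  \<comment> \<open>\<open>\<rho> 1\<close> is the smallest exponent in the polar part. The cap 1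
    makes \<open>inverse x\<close>, which dominates \<open>exp (1 - x)\<close>, at most
    x^(-q).\<close>
  define q where "q = min 1 (\<rho> 1)"
  have "\<rho> 1 \<le> \<rho> l" if "l \<in> {1..r}" for l
    using that rho_less[of 1 l] by (cases "l = 1") auto
  then have q: "0 < q" "q \<le> 1" "\<And>l. l \<in> {1..r} \<Longrightarrow> q \<le> \<rho> l"
    using rho_pos[of 1] r_pos by (auto simp: q_def min.coboundedI2)
  define K where "K = lambert 1 + (\<Sum>l=1..r. \<bar>A l * Gamma (\<rho> l)\<bar>) + \<bar>Re (D 0)\<bar>"
  show ?thesis
  proof (rule that[OF q(1)])
    fix x :: real assume x: "x \<ge> 1"
    have e1: "exp (1 - x) \<le> x powr (- q)"
    proof -
      have "x \<le> exp (x - 1)" using exp_ge_add_one_self[of "x - 1"] by simp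
      then have "exp (- (x - 1)) \<le> inverse x" unfolding exp_minus using x by (intro le_imp_inverse_le) auto
      also have "inverse x = x powr (- 1)" using x by (simp add: powr_minus)
      also have "\<dots> \<le> x powr (- q)" using x q by (intro powr_mono) auto
      finally show ?thesis by simp
    qed
    have "lambert x \<le> lambert 1 * x powr (- q)"
      using lambert_decay[OF x] mult_left_mono[OF e1 lambert_nonneg[of 1]] by simp
    then have 1: "\<bar>lambert x\<bar> \<le> lambert 1 * x powr (- q)" using lambert_nonneg[of x] x by simp
    have "\<bar>polar_part x\<bar> \<le> (\<Sum>l=1..r. \<bar>A l * Gamma (\<rho> l) * x powr (- \<rho> l)\<bar>)"
      unfolding polar_part_def by (rule sum_abs)
    also have "\<dots> \<le> (\<Sum>l=1..r. \<bar>A l * Gamma (\<rho> l)\<bar> * x powr (- q))"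
      unfolding abs_mult[of _ "_ powr _"] using q x by (intro sum_mono mult_left_mono) (auto intro: powr_mono)
    finally have 2: "\<bar>polar_part x\<bar> \<le> (\<Sum>l=1..r. \<bar>A l * Gamma (\<rho> l)\<bar>) * x powr (- q)"
      by (simp add: sum_distrib_right)
    have "exp (- x) \<le> exp (1 - x)" by simp
    with e1 have "exp (- x) \<le> x powr (- q)" by linarith
    then have 3: "\<bar>Re (D 0) * exp (- x)\<bar> \<le> \<bar>Re (D 0)\<bar> * x powr (- q)"
      unfolding abs_mult by (intro mult_left_mono) auto
    have "\<bar>remainder x\<bar> \<le> \<bar>lambert x\<bar> + \<bar>polar_part x\<bar> + \<bar>Re (D 0) * exp (- x)\<bar>"
      unfolding remainder_def by linarith
    also have "\<dots> \<le> K * x powr (- q)" using 1 2 3 unfolding K_def distrib_right by linarith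
    finally show "\<bar>remainder x\<bar> \<le> K * x powr (- q)" .
  qed
qed

text \<open>With \<omega>(x) = \<open>remainder x / x\<close> the terms are \<delta> \<omega>(j
  \<delta>), so this is a Riemann sum. Only the existence of the limit matters: it ends up in the
  constant \<open>H\<close>.\<close>

lemma remainder_sum_tendsto:
  "\<exists>L. ((\<lambda>\<delta>. \<Sum>j. remainder (real (Suc j) * \<delta>) / real (Suc j)) \<longlongrightarrow> L) (at_right 0)"
proof -
  obtain K1 where K1: "\<And>x. 0 < x \<Longrightarrow> x \<le> 1 \<Longrightarrow> \<bar>remainder x\<bar> \<le> K1 * x powr (C0 / 2)" using remainder_small by blast
  obtain K2 q where q: "q > 0" and K2: "\<And>x. x \<ge> 1 \<Longrightarrow> \<bar>remainder x\<bar> \<le> K2 * x powr (- q)" using remainder_large by blast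
  define K where "K = max K1 K2"
  have div: "\<bar>remainder x / x\<bar> \<le> K * x powr (e - 1)" if "x > 0" "\<bar>remainder x\<bar> \<le> K' * x powr e" "K' \<le> K" for x e K'
  proof -
    have "\<bar>remainder x / x\<bar> = \<bar>remainder x\<bar> / x" using that by simp
    also have "\<dots> \<le> (K * x powr e) / x"
      using that order_trans[OF that(2) mult_right_mono[OF that(3)]] by (intro divide_right_mono) auto
    also have "\<dots> = K * x powr (e - 1)" using that by (simp add: powr_diff)
    finally show ?thesis .
  qed
  have "continuous_on {0<..} (\<lambda>x. remainder x / x)"
    unfolding remainder_def polar_part_def
    by (intro continuous_intros continuous_on_lambert) auto
  then have "((\<lambda>\<delta>. \<Sum>j. \<delta> * (remainder (real (Suc j) * \<delta>) / (real (Suc j) * \<delta>)))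
     \<longlongrightarrow> (LINT x|lborel. indicator {0<..} x * (remainder x / x))) (at_right 0)"
  proof (rule riemann_sum_improper[where c = "C0/2" and q = q and K = K])
    show "\<bar>remainder x / x\<bar> \<le> K * x powr (C0/2 - 1)" if "0 < x" "x \<le> 1" for x
      using that K1 by (intro div[of _ K1]) (auto simp: K_def)
    show "\<bar>remainder x / x\<bar> \<le> K * x powr (- q - 1)" if "1 \<le> x" for x
      using that K2 by (intro div[of _ K2]) (auto simp: K_def)
  qed (use C0 q in auto)
  moreover have "\<forall>\<^sub>F \<delta> in at_right 0. (\<Sum>j. \<delta> * (remainder (real (Suc j) * \<delta>) / (real (Suc j) * \<delta>)))
     = (\<Sum>j. remainder (real (Suc j) * \<delta>) / real (Suc j))"
    using eventually_at_right_less[of 0]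
  proof eventually_elim
    case (elim \<delta>)
    have "\<delta> * (R / (s * \<delta>)) = R / s" for R s using elim by simp
    then show ?case by (intro suminf_cong)
  qed
  ultimately have "((\<lambda>\<delta>. \<Sum>j. remainder (real (Suc j) * \<delta>) / real (Suc j))
     \<longlongrightarrow> (LINT x|lborel. indicator {0<..} x * (remainder x / x))) (at_right 0)"
    by (rule Lim_transform_eventually)
  then show ?thesis by blast
qed

abbreviation h :: "kind \<Rightarrow> nat \<Rightarrow> real" where
  "h i \<equiv> const_h i \<rho> A D"

definition main_part :: "kind \<Rightarrow> real \<Rightarrow> real" where
  "main_part i \<delta> = (\<Sum>l=1..r. h i l * \<delta> powr (- \<rho> l))"

lemma zeta_sums:
  assumes "\<sigma> > 0"
  shows "(\<lambda>j. 1 / real (Suc j) powr (\<sigma> + 1)) sums zeta_real (\<sigma> + 1)"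
proof -
  have "summable (\<lambda>n. real n powr (- (\<sigma> + 1)))" using assms by (subst summable_real_powr_iff) auto
  then have "summable (\<lambda>j. real (Suc j) powr (- (\<sigma> + 1)))" by (subst summable_Suc_iff)
  then show ?thesis unfolding zeta_real_def powr_minus_divide by (rule summable_sums)
qed

lemma zeta_real_pos: "\<sigma> > 0 \<Longrightarrow> zeta_real (\<sigma> + 1) > 0"
  using zeta_sums[of \<sigma>] unfolding zeta_real_def
  by (intro suminf_pos) (auto dest: sums_summable simp del: of_nat_Suc)

lemma h_pos: "l \<in> {1..r} \<Longrightarrow> h i l > 0"
  using rho_pos[of l] A_pos[of l] zeta_real_pos[of "\<rho> l"]
  by (auto simp: const_h_def Gamma_real_pos powr_less_one split: kind.split intro!: mult_pos_pos)

text \<open>The three parts of \<open>lambert\<close> are summed over multiples of \<delta> with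
  weights 1/j: a power x^(-\<rho>) produces zeta(\<rho> + 1), the exponential produces the
  logarithm, and the rest is the Riemann sum above.\<close>

lemma log_gf_Weighted_Partitions_eq:
  assumes \<delta>: "\<delta> > 0"
  shows "log_gf Weighted_Partitions \<delta> = main_part Weighted_Partitions \<delta> - Re (D 0) * ln (1 - exp (- \<delta>))
    + (\<Sum>j. remainder (real (Suc j) * \<delta>) / real (Suc j))"
proof -
  have "(\<lambda>j. (\<Sum>l=1..r. A l * Gamma (\<rho> l) * (1 / real (Suc j) powr (\<rho> l + 1)) * \<delta> powr (- \<rho> l)))
     sums (\<Sum>l=1..r. A l * Gamma (\<rho> l) * zeta_real (\<rho> l + 1) * \<delta> powr (- \<rho> l))"
    by (intro sums_sum sums_mult sums_mult2 zeta_sums rho_pos)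
  also have "(\<lambda>j. (\<Sum>l=1..r. A l * Gamma (\<rho> l) * (1 / real (Suc j) powr (\<rho> l + 1)) * \<delta> powr (- \<rho> l)))
     = (\<lambda>j. polar_part (real (Suc j) * \<delta>) / real (Suc j))"
    unfolding polar_part_def sum_divide_distrib using \<delta>
    by (intro ext sum.cong) (simp_all add: powr_mult powr_minus powr_add divide_simps del: of_nat_Suc)
  finally have 1: "(\<lambda>j. polar_part (real (Suc j) * \<delta>) / real (Suc j)) sums main_part Weighted_Partitions \<delta>"
    by (simp add: main_part_def const_h_def)
  have "(\<lambda>j. Re (D 0) * (exp (- \<delta>) ^ Suc j / real (Suc j))) sums (Re (D 0) * - ln (1 - exp (- \<delta>)))"
    using \<delta> by (intro sums_mult sums_minus_ln) auto
  then have 2: "(\<lambda>j. Re (D 0) * exp (- (real (Suc j) * \<delta>)) / real (Suc j)) sums (Re (D 0) * - ln (1 - exp (- \<delta>)))"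
    unfolding exp_minus_power by simp
  from sums_diff[OF sums_diff[OF log_gf_Weighted_Partitions_sums[OF \<delta>] 1] 2]
  have "(\<lambda>j. remainder (real (Suc j) * \<delta>) / real (Suc j)) sums
    (log_gf Weighted_Partitions \<delta> - main_part Weighted_Partitions \<delta> - Re (D 0) * - ln (1 - exp (- \<delta>)))"
    by (simp add: remainder_def diff_divide_distrib)
  then show ?thesis by (simp add: sums_iff)
qed

lemma log_gf_Selections_eq:
  assumes \<delta>: "\<delta> > 0"
  shows "log_gf Selections \<delta> = log_gf Weighted_Partitions \<delta> - log_gf Weighted_Partitions (2 * \<delta>)"
proof -
  have eq: "log_factor Selections (exp (- \<delta>) ^ Suc k)
    = log_factor Weighted_Partitions (exp (- \<delta>) ^ Suc k) - log_factor Weighted_Partitions (exp (- (2 * \<delta>)) ^ Suc k)" for k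
  proof -
    define w where "w = exp (- \<delta>) ^ Suc k"
    have w: "0 < w" "w < 1" using \<delta> power_Suc_less_one[of "exp (- \<delta>)" k] by (auto simp: w_def)
    have sq: "exp (- (2 * \<delta>)) ^ Suc k = w ^ 2"
      unfolding w_def exp_minus_power power_mult[symmetric] by (simp add: algebra_simps)
    have l: "ln (1 - w ^ 2) = ln (1 - w) + ln (1 + w)"
    proof -
      have "1 - w ^ 2 = (1 - w) * (1 + w)" by (simp add: power2_eq_square algebra_simps)
      then show ?thesis using w by (simp add: ln_mult)
    qed
    show ?thesis unfolding log_factor_def kind.case w_def[symmetric] sq l by simp
  qed
  have "2 * \<delta> > 0" using \<delta> by simp
  then show ?thesis
    unfolding log_gf_def eq right_diff_distrib
    by (rule suminf_diff[OF summable_log_gf[OF \<delta>] summable_log_gf, symmetric])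
qed

theorem log_gf_expansion:
  "\<exists>\<kappa>. ((\<lambda>\<delta>. log_gf i \<delta> - main_part i \<delta> + ind1 i * Re (D 0) * ln \<delta>) \<longlongrightarrow> \<kappa>) (at_right 0)"
proof -
  obtain L where L: "((\<lambda>\<delta>. \<Sum>j. remainder (real (Suc j) * \<delta>) / real (Suc j)) \<longlongrightarrow> L) (at_right 0)"
    using remainder_sum_tendsto by blast
  have "((\<lambda>\<delta>::real. ln \<delta> - ln (1 - exp (- \<delta>))) \<longlongrightarrow> 0) (at_right 0)" by real_asymp
  then have "((\<lambda>\<delta>. Re (D 0) * (ln \<delta> - ln (1 - exp (- \<delta>))) + (\<Sum>j. remainder (real (Suc j) * \<delta>) / real (Suc j)))
      \<longlongrightarrow> Re (D 0) * 0 + L) (at_right 0)"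
    by (intro tendsto_intros L)
  moreover have "\<forall>\<^sub>F \<delta> in at_right 0. Re (D 0) * (ln \<delta> - ln (1 - exp (- \<delta>))) + (\<Sum>j. remainder (real (Suc j) * \<delta>) / real (Suc j))
     = log_gf Weighted_Partitions \<delta> - main_part Weighted_Partitions \<delta> + Re (D 0) * ln \<delta>"
    using eventually_at_right_less[of 0]
    by eventually_elim (simp add: log_gf_Weighted_Partitions_eq right_diff_distrib)
  ultimately have WP: "((\<lambda>\<delta>. log_gf Weighted_Partitions \<delta> - main_part Weighted_Partitions \<delta> + Re (D 0) * ln \<delta>) \<longlongrightarrow> L) (at_right 0)"
    using Lim_transform_eventually by fastforce
  show ?thesis
  proof (cases i)
    case Weighted_Partitions
    with WP show ?thesis by (auto simp: ind1_def)
  next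
    case Selections
    have "filterlim (\<lambda>\<delta>::real. 2 * \<delta>) (at_right 0) (at_right 0)" by real_asymp
    \<comment> \<open>The limits \<open>L\<close> cancel, and D(0) (ln \<delta> - ln(2 \<delta>))
      leaves -D(0) ln 2. So the limit for selections is D(0) ln 2 and no logarithm of \<delta>
      survives. The same difference produces the factor 1 - 2^(-\<rho>) in \<open>h\<close>.\<close>
    from tendsto_diff[OF WP filterlim_compose[OF WP this]]
    have "((\<lambda>\<delta>. (log_gf Weighted_Partitions \<delta> - main_part Weighted_Partitions \<delta> + Re (D 0) * ln \<delta>)
       - (log_gf Weighted_Partitions (2 * \<delta>) - main_part Weighted_Partitions (2 * \<delta>) + Re (D 0) * ln (2 * \<delta>))
        + Re (D 0) * ln 2) \<longlongrightarrow> L - L + Re (D 0) * ln 2) (at_right 0)"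
      by (intro tendsto_add tendsto_const)
    moreover have "\<forall>\<^sub>F \<delta> in at_right 0. (log_gf Weighted_Partitions \<delta> - main_part Weighted_Partitions \<delta> + Re (D 0) * ln \<delta>)
       - (log_gf Weighted_Partitions (2 * \<delta>) - main_part Weighted_Partitions (2 * \<delta>) + Re (D 0) * ln (2 * \<delta>))
        + Re (D 0) * ln 2 = log_gf Selections \<delta> - main_part Selections \<delta> + ind1 Selections * Re (D 0) * ln \<delta>"
      using eventually_at_right_less[of 0]
    proof eventually_elim
      case (elim \<delta>)
      have "main_part Selections \<delta> = main_part Weighted_Partitions \<delta> - main_part Weighted_Partitions (2 * \<delta>)"
        unfolding main_part_def sum_subtractf[symmetric]
        using elim by (intro sum.cong) (auto simp: const_h_def powr_mult algebra_simps)
      then show ?case using elim by (simp add: log_gf_Selections_eq ind1_def ln_mult algebra_simps)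
    qed
    ultimately have "((\<lambda>\<delta>. log_gf Selections \<delta> - main_part Selections \<delta> + ind1 Selections * Re (D 0) * ln \<delta>)
      \<longlongrightarrow> L - L + Re (D 0) * ln 2) (at_right 0)"
      by (rule Lim_transform_eventually)
    then show ?thesis unfolding Selections by blast
  next
    case Assemblies
    obtain K where K: "\<And>x. x > 0 \<Longrightarrow> \<bar>lambert x - polar_part x - Re (D 0)\<bar> \<le> K * x powr (C0 / 2)"
      using lambert_expansion by blast
    have "((\<lambda>x. K * x powr (C0 / 2)) \<longlongrightarrow> 0) (at_right 0)" using C0 by real_asymp
    then have "((\<lambda>x. lambert x - polar_part x - Re (D 0)) \<longlongrightarrow> 0) (at_right 0)"
      by (rule Lim_null_comparison[rotated])
         (use eventually_at_right_less[of 0] K in \<open>auto elim!: eventually_mono\<close>)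
    then have "((\<lambda>x. lambert x - polar_part x) \<longlongrightarrow> Re (D 0)) (at_right 0)"
      using LIM_zero_iff by blast
    moreover have "log_gf i x = lambert x" for x
      unfolding Assemblies log_gf_def lambert_def log_factor_def kind.case exp_minus_power ..
    moreover have "main_part i x = polar_part x" for x
      by (simp add: main_part_def polar_part_def const_h_def Assemblies)
    ultimately show ?thesis by (auto simp: ind1_def Assemblies)
  qed
qed

end

section \<open>Lower bounds for the sine sums\<close>

lemma abs_sin_ge:
  fixes y :: real
  assumes "\<bar>y\<bar> \<le> 1"
  shows "\<bar>y\<bar> / 2 \<le> \<bar>sin y\<bar>"
proof -
  have pos: "y / 2 \<le> sin y" if y: "0 < y" "y \<le> 1" for y :: real
  proof -
    have "\<exists>z>0. z < y \<and> sin y - sin 0 = (y - 0) * cos z"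
      using y by (intro MVT2) (auto intro!: derivative_eq_intros)
    then obtain z where z: "0 < z" "z < y" "sin y = y * cos z" by auto
    have "(sin (z / 2))\<^sup>2 \<le> (1 / 2)\<^sup>2"
      using z y sin_x_le_x[of "z/2"] sin_ge_zero[of "z/2"] pi_gt3 by (intro power_mono) auto
    then have "cos z \<ge> 1 / 2" using cos_double_sin[of "z/2"] by (simp add: power2_eq_square)
    then have "y * (1 / 2) \<le> y * cos z" using y by (intro mult_left_mono) auto
    then show ?thesis using z by simp
  qed
  show ?thesis
  proof (cases y "0 :: real" rule: linorder_cases)
    case less
    then show ?thesis using pos[of "-y"] assms by simp
  next
    case greater
    then show ?thesis using pos[of y] assms by simp
  qed simp
qed

context dirichlet_data
begin

definition a_r :: real where "a_r = A r * Gamma (\<rho> r)"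

lemma a_r_pos: "a_r > 0"
  using A_pos[of r] rho_r_pos r_pos by (simp add: a_r_def Gamma_real_pos)

lemma lambert_asymp: "((\<lambda>x. lambert x * x powr \<rho> r) \<longlongrightarrow> a_r) (at_right 0)"
proof -
  obtain K where K: "\<And>x. x > 0 \<Longrightarrow> \<bar>lambert x - polar_part x - Re (D 0)\<bar> \<le> K * x powr (C0 / 2)"
    using lambert_expansion by blast
  have "((\<lambda>x. K * x powr (C0 / 2)) \<longlongrightarrow> 0) (at_right 0)" using C0 by real_asymp
  then have "((\<lambda>x. lambert x - polar_part x - Re (D 0)) \<longlongrightarrow> 0) (at_right 0)"
    by (rule Lim_null_comparison[rotated])
       (use eventually_at_right_less[of 0] K in \<open>auto elim!: eventually_mono\<close>)
  moreover have p: "((\<lambda>x::real. x powr \<rho> r) \<longlongrightarrow> 0) (at_right 0)" using rho_r_pos by real_asymp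
  moreover have "((\<lambda>x. \<Sum>l=1..r. A l * Gamma (\<rho> l) * x powr (\<rho> r - \<rho> l)) \<longlongrightarrow> (\<Sum>l=1..r. A l * Gamma (\<rho> l) * (if l = r then 1 else 0))) (at_right 0)"
  proof (intro tendsto_sum tendsto_mult tendsto_const)
    fix l assume l: "l \<in> {1..r}"
    show "((\<lambda>x::real. x powr (\<rho> r - \<rho> l)) \<longlongrightarrow> (if l = r then 1 else 0)) (at_right 0)"
    proof (cases "l = r")
      case True
      have "\<forall>\<^sub>F x::real in at_right 0. x powr (\<rho> r - \<rho> l) = 1"
        using eventually_at_right_less[of "0::real"] by eventually_elim (simp add: True)
      then show ?thesis using True by (simp add: tendsto_eventually)
    next
      case False
      then have "\<rho> r - \<rho> l > 0" using rho_less[of l r] l by auto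
      then have "((\<lambda>x::real. x powr (\<rho> r - \<rho> l)) \<longlongrightarrow> 0) (at_right 0)" by real_asymp
      then show ?thesis using False by simp
    qed
  qed
  moreover have "(\<Sum>l=1..r. A l * Gamma (\<rho> l) * (if l = r then 1 else 0)) = a_r"
    using r_pos by (simp add: a_r_def sum.delta if_distrib cong: if_cong)
  ultimately have "((\<lambda>x. (lambert x - polar_part x - Re (D 0)) * x powr \<rho> r + (\<Sum>l=1..r. A l * Gamma (\<rho> l) * x powr (\<rho> r - \<rho> l)) + Re (D 0) * x powr \<rho> r)
     \<longlongrightarrow> 0 * 0 + a_r + Re (D 0) * 0) (at_right 0)"
    by (intro tendsto_add tendsto_mult tendsto_const) auto
  moreover have "\<forall>\<^sub>F x in at_right 0. (lambert x - polar_part x - Re (D 0)) * x powr \<rho> r + (\<Sum>l=1..r. A l * Gamma (\<rho> l) * x powr (\<rho> r - \<rho> l)) + Re (D 0) * x powr \<rho> r = lambert x * x powr \<rho> r"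
    using eventually_at_right_less[of 0]
  proof eventually_elim
    case (elim x)
    have "polar_part x * x powr \<rho> r = (\<Sum>l=1..r. A l * Gamma (\<rho> l) * x powr (\<rho> r - \<rho> l))"
      unfolding polar_part_def sum_distrib_right mult.assoc powr_add[symmetric] by (simp add: add.commute)
    then show ?case by (simp add: algebra_simps)
  qed
  ultimately have "((\<lambda>x. lambert x * x powr \<rho> r) \<longlongrightarrow> 0 * 0 + a_r + Re (D 0) * 0) (at_right 0)"
    by (rule Lim_transform_eventually)
  then show ?thesis by simp
qed

lemma lambert_bounds:
  obtains x0 where "x0 > 0" "\<And>x. 0 < x \<Longrightarrow> x < x0 \<Longrightarrow> a_r / 2 * x powr (- \<rho> r) \<le> lambert x \<and> lambert x \<le> 2 * a_r * x powr (- \<rho> r)"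
proof -
  have "\<forall>\<^sub>F x in at_right 0. a_r / 2 < lambert x * x powr \<rho> r"
    using a_r_pos by (intro order_tendstoD(1)[OF lambert_asymp]) auto
  moreover have "\<forall>\<^sub>F x in at_right 0. lambert x * x powr \<rho> r < 2 * a_r"
    using a_r_pos by (intro order_tendstoD(2)[OF lambert_asymp]) auto
  ultimately have "\<forall>\<^sub>F x in at_right 0. a_r / 2 * x powr (- \<rho> r) \<le> lambert x \<and> lambert x \<le> 2 * a_r * x powr (- \<rho> r)"
    using eventually_at_right_less[of 0]
  proof eventually_elim
    case (elim x)
    have "x powr \<rho> r > 0" using elim by simp
    then show ?case using elim by (simp add: powr_minus pos_divide_le_eq pos_le_divide_eq divide_inverse[symmetric])
  qed
  then show ?thesis using that unfolding eventually_at_right_field by auto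
qed

section \<open>Chebyshev-type bounds for the summatory function of the weights\<close>

definition weight_count :: "real \<Rightarrow> real" where
  "weight_count X = (\<Sum>k | real (Suc k) \<le> X. b (Suc k))"

lemma finite_le_real: "finite {k. real (Suc k) \<le> X}"
  by (rule finite_subset[of _ "{..nat \<lceil>X\<rceil>}"]) (auto, linarith)

lemma weight_count_le:
  assumes "X > 0"
  shows "weight_count X \<le> exp 1 * lambert (1 / X)"
proof -
  have "weight_count X \<le> (\<Sum>k | real (Suc k) \<le> X. exp 1 * (b (Suc k) * exp (- (real (Suc k) * (1 / X)))))"
    unfolding weight_count_def
  proof (rule sum_mono)
    fix k assume "k \<in> {k. real (Suc k) \<le> X}"
    then have "real (Suc k) * (1 / X) \<le> 1" using assms by simp
    then have "1 \<le> exp 1 * exp (- (real (Suc k) * (1 / X)))" unfolding exp_add[symmetric] by (subst one_le_exp_iff) linarith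
    then have "b (Suc k) * 1 \<le> b (Suc k) * (exp 1 * exp (- (real (Suc k) * (1 / X))))"
      using b_nonneg[of k] by (intro mult_left_mono)
    then show "b (Suc k) \<le> exp 1 * (b (Suc k) * exp (- (real (Suc k) * (1 / X))))" by (simp only: mult_1_right mult.left_commute)
  qed
  also have "\<dots> = exp 1 * (\<Sum>k | real (Suc k) \<le> X. b (Suc k) * exp (- (real (Suc k) * (1 / X))))"
    by (rule sum_distrib_left[symmetric])
  also have "\<dots> \<le> exp 1 * lambert (1 / X)"
    unfolding lambert_def using assms b_nonneg
    by (intro mult_left_mono sum_le_suminf summable_lambert finite_le_real) auto
  finally show ?thesis .
qed

text \<open>For k > X half of the exponent is given away: exp(-k y / X) <= exp(-y / 2) exp(-k y / (2
  X)). The tail is thus a Lambert value of the same order times a factor that a large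
  \<open>y\<close> makes small.\<close>

lemma weight_count_ge:
  assumes "X > 0" "y > 0"
  shows "lambert (y / X) \<le> weight_count X + exp (- (y / 2)) * lambert (y / (2 * X))"
proof -
  let ?f = "\<lambda>k. b (Suc k) * exp (- (real (Suc k) * (y / X)))"
  let ?g = "\<lambda>k. exp (- (y / 2)) * (b (Suc k) * exp (- (real (Suc k) * (y / (2 * X)))))"
  let ?i = "\<lambda>k. if k \<in> {k. real (Suc k) \<le> X} then b (Suc k) else 0"
  have pos: "y / X > 0" "y / (2 * X) > 0" using assms by auto
  have s: "summable ?f" "summable ?g"
    by (rule summable_lambert[OF pos(1)]) (rule summable_mult[OF summable_lambert[OF pos(2)]])
  have si: "?i sums weight_count X"
    unfolding weight_count_def by (rule sums_If_finite_set[OF finite_le_real])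
  have "lambert (y / X) \<le> (\<Sum>k. ?i k + ?g k)"
    unfolding lambert_def
  proof (rule suminf_le)
    show "summable ?f" by fact
    show "summable (\<lambda>k. ?i k + ?g k)" using sums_summable[OF si] s by (intro summable_add)
    fix k
    show "?f k \<le> ?i k + ?g k"
    proof (cases "real (Suc k) \<le> X")
      case True
      have "exp (- (real (Suc k) * (y / X))) \<le> 1" using assms by simp
      then have "?f k \<le> b (Suc k) * 1" using b_nonneg[of k] by (intro mult_left_mono)
      moreover have "?g k \<ge> 0" using b_nonneg[of k] by simp
      ultimately show ?thesis using True by simp
    next
      case False
      have e: "real (Suc k) * (y / X) = real (Suc k) * (y / (2 * X)) + real (Suc k) * y / (2 * X)"
        using assms by (simp add: field_simps)
      have "y / 2 = X * y / (2 * X)" using assms by simp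
      also have "\<dots> \<le> real (Suc k) * y / (2 * X)" using False assms by (intro divide_right_mono mult_right_mono) auto
      finally have "- (real (Suc k) * (y / X)) \<le> - (y / 2) + - (real (Suc k) * (y / (2 * X)))" using e by linarith
      then have "exp (- (real (Suc k) * (y / X))) \<le> exp (- (y / 2)) * exp (- (real (Suc k) * (y / (2 * X))))"
        unfolding exp_add[symmetric] by (simp only: exp_le_cancel_iff)
      then have "?f k \<le> b (Suc k) * (exp (- (y / 2)) * exp (- (real (Suc k) * (y / (2 * X)))))"
        using b_nonneg[of k] by (intro mult_left_mono)
      also have "\<dots> = ?g k" by (rule mult.left_commute)
      finally show ?thesis using False by simp
    qed
  qed
  also have "\<dots> = weight_count X + (\<Sum>k. ?g k)"
    using suminf_add[OF sums_summable[OF si] s(2)] unfolding sums_unique[OF si, symmetric] by (rule sym)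
  also have "(\<Sum>k. ?g k) = exp (- (y / 2)) * lambert (y / (2 * X))"
    unfolding lambert_def by (rule suminf_mult[OF summable_lambert[OF pos(2)]])
  finally show ?thesis .
qed

text \<open>The Lambert asymptotics bound \<open>weight_count X\<close> from both sides by constants
  times X^\<rho>, with \<rho> = \<rho>_r. For a small \<open>e\<close> the indices between e X and X
  therefore still carry weight of order X^\<rho>, and there k^2 is at least (e X)^2.\<close>

lemma weighted_squares_ge:
  obtains c X0 where "c > 0" "X0 > 0"
    "\<And>X. X \<ge> X0 \<Longrightarrow> (\<Sum>k | real (Suc k) \<le> X. b (Suc k) * (real (Suc k))\<^sup>2) \<ge> c * X powr (\<rho> r + 2)"
proof -
  obtain x0 where x0: "x0 > 0" "\<And>x. 0 < x \<Longrightarrow> x < x0 \<Longrightarrow> a_r / 2 * x powr (- \<rho> r) \<le> lambert x \<and> lambert x \<le> 2 * a_r * x powr (- \<rho> r)"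
    using lambert_bounds by blast
  \<comment> \<open>Chosen so that exp(-y/2) 2^\<rho> = 1/8, with \<rho> = \<rho>_r. The tail is
    then at most half of the lower bound for \<open>lambert (y / X)\<close>, and a quarter of
    \<open>a_r\<close> survives in \<open>c1\<close>.\<close>
  define y where "y = 2 * ((3 + \<rho> r) * ln 2)"
  have y: "y > 0" using rho_r_pos by (simp add: y_def)
  have ey: "exp (- (y / 2)) * 2 powr \<rho> r = 1 / 8"
  proof -
    have "exp (- (y / 2)) * 2 powr \<rho> r = 2 powr (- (3 + \<rho> r)) * 2 powr \<rho> r"
      unfolding y_def powr_def by (simp add: algebra_simps)
    also have "\<dots> = 2 powr (-3)" unfolding powr_add[symmetric] by simp
    finally show ?thesis by (simp add: powr_minus powr_numeral)
  qed
  define c1 where "c1 = a_r * y powr (- \<rho> r) / 4"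
  have c1: "c1 > 0" using a_r_pos y by (simp add: c1_def)
  have count_ge: "weight_count X \<ge> c1 * X powr \<rho> r" if X: "X > y / x0" for X
  proof -
    have Xp: "X > 0" using X y x0 by (smt (verit) divide_pos_pos)
    have "y / X < x0" using X x0 Xp y by (simp add: pos_divide_less_eq mult.commute)
    moreover have "y / (2 * X) \<le> y / X" using Xp y by (simp add: field_simps)
    ultimately have lt: "y / X < x0" "y / (2 * X) < x0" by linarith+
    have p1: "(y / X) powr (- \<rho> r) = y powr (- \<rho> r) * X powr \<rho> r"
      using Xp y by (simp add: powr_divide powr_minus divide_simps)
    have p2: "(y / (2 * X)) powr (- \<rho> r) = 2 powr \<rho> r * (y powr (- \<rho> r) * X powr \<rho> r)"
      using Xp y by (simp add: powr_divide powr_mult powr_minus divide_simps)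
    have "a_r / 2 * (y powr (- \<rho> r) * X powr \<rho> r) \<le> lambert (y / X)"
      using x0(2)[of "y / X"] lt Xp y unfolding p1 by simp
    also have "\<dots> \<le> weight_count X + exp (- (y / 2)) * lambert (y / (2 * X))" by (rule weight_count_ge[OF Xp y])
    also have "lambert (y / (2 * X)) \<le> 2 * a_r * (2 powr \<rho> r * (y powr (- \<rho> r) * X powr \<rho> r))"
      using x0(2)[of "y / (2 * X)"] lt Xp y unfolding p2 by simp
    finally have "a_r / 2 * (y powr (- \<rho> r) * X powr \<rho> r) \<le> weight_count X + exp (- (y / 2)) * (2 * a_r * (2 powr \<rho> r * (y powr (- \<rho> r) * X powr \<rho> r)))"
      by (simp add: mult_left_mono)
    also have "exp (- (y / 2)) * (2 * a_r * (2 powr \<rho> r * (y powr (- \<rho> r) * X powr \<rho> r)))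
      = (exp (- (y / 2)) * 2 powr \<rho> r) * (2 * a_r * (y powr (- \<rho> r) * X powr \<rho> r))" by (simp only: mult_ac)
    finally have fin: "a_r / 2 * (y powr (- \<rho> r) * X powr \<rho> r) \<le> weight_count X + 1 / 8 * (2 * a_r * (y powr (- \<rho> r) * X powr \<rho> r))"
      unfolding ey .
    define Z where "Z = a_r * (y powr (- \<rho> r) * X powr \<rho> r)"
    have "Z / 2 \<le> weight_count X + 1 / 8 * (2 * Z)" using fin by (simp add: Z_def)
    moreover have "c1 * X powr \<rho> r = Z / 4" by (simp add: c1_def Z_def)
    ultimately show ?thesis by linarith
  qed
  have count_le: "weight_count X \<le> (2 * exp 1 * a_r) * X powr \<rho> r" if X: "X > 1 / x0" for X
  proof -
    have Xp: "X > 0" using X x0 by (smt (verit) divide_pos_pos)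
    have "1 / X < x0" using X x0 Xp by (simp add: pos_divide_less_eq mult.commute)
    then have "lambert (1 / X) \<le> 2 * a_r * (1 / X) powr (- \<rho> r)" using x0(2)[of "1/X"] Xp by simp
    also have "(1 / X) powr (- \<rho> r) = X powr \<rho> r" using Xp by (simp add: powr_divide powr_minus)
    finally have "exp 1 * lambert (1 / X) \<le> exp 1 * (2 * a_r * X powr \<rho> r)" by (intro mult_left_mono) auto
    also have "\<dots> = (2 * exp 1 * a_r) * X powr \<rho> r" by simp
    finally show ?thesis using weight_count_le[OF Xp] by linarith
  qed
  define c2 where "c2 = 2 * exp 1 * a_r"
  have c2: "c2 > 0" using a_r_pos by (simp add: c2_def)
  \<comment> \<open>With this \<open>e\<close> the upper bound at e X is half of the lower bound at
    X.\<close>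
  define e where "e = (c1 / (2 * c2)) powr (1 / \<rho> r)"
  have e: "e > 0" using c1 c2 by (simp add: e_def)
  have e_powr: "e powr \<rho> r = c1 / (2 * c2)" using c1 c2 rho_r_pos by (simp add: e_def powr_powr)
  show ?thesis
  proof (rule that[of "e\<^sup>2 * (c1 / 2)" "(y + 1 / e) / x0 + 1"])
    show "e\<^sup>2 * (c1 / 2) > 0" using e c1 by simp
    show "(y + 1 / e) / x0 + 1 > 0" using e x0 y by (intro add_nonneg_pos) auto
    fix X assume X: "X \<ge> (y + 1 / e) / x0 + 1"
    have "y / x0 \<ge> 0" "(1 / e) / x0 \<ge> 0" using y x0 e by auto
    then have X1: "X > y / x0" "X > (1 / e) / x0" "X > 0" using X unfolding add_divide_distrib by linarith+
    have "e * X > 1 / x0" using mult_strict_left_mono[OF X1(2) e] e by simp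
    then have le: "weight_count (e * X) \<le> c1 / 2 * X powr \<rho> r"
      using count_le[of "e * X"] e X1 c2 by (simp add: powr_mult e_powr c2_def[symmetric])
    let ?S = "\<lambda>X. {k. real (Suc k) \<le> X}"
    have "c1 / 2 * X powr \<rho> r \<le> weight_count X - weight_count (e * X)"
      using count_ge[OF X1(1)] le by simp
    also have "\<dots> \<le> (\<Sum>k \<in> ?S X - ?S (e * X). b (Suc k))"
    proof -
      have "weight_count X = (\<Sum>k \<in> ?S X \<inter> ?S (e * X). b (Suc k)) + (\<Sum>k \<in> ?S X - ?S (e * X). b (Suc k))"
        unfolding weight_count_def by (rule sum.Int_Diff[OF finite_le_real])
      moreover have "(\<Sum>k \<in> ?S X \<inter> ?S (e * X). b (Suc k)) \<le> weight_count (e * X)"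
        unfolding weight_count_def by (rule sum_mono2[OF finite_le_real]) (auto simp: b_nonneg)
      ultimately show ?thesis by linarith
    qed
    finally have "(e * X)\<^sup>2 * (c1 / 2 * X powr \<rho> r) \<le> (e * X)\<^sup>2 * (\<Sum>k \<in> ?S X - ?S (e * X). b (Suc k))"
      by (rule mult_left_mono) auto
    also have "\<dots> = (\<Sum>k \<in> ?S X - ?S (e * X). b (Suc k) * (e * X)\<^sup>2)" by (simp add: sum_distrib_left mult.commute)
    also have "\<dots> \<le> (\<Sum>k \<in> ?S X - ?S (e * X). b (Suc k) * (real (Suc k))\<^sup>2)"
      using e X1 by (intro sum_mono mult_left_mono b_nonneg power_mono) auto
    also have "\<dots> \<le> (\<Sum>k \<in> ?S X. b (Suc k) * (real (Suc k))\<^sup>2)"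
      by (rule sum_mono2[OF finite_le_real]) (auto simp: b_nonneg)
    also have "(e * X)\<^sup>2 * (c1 / 2 * X powr \<rho> r) = e\<^sup>2 * (c1 / 2) * X powr (\<rho> r + 2)"
      using X1 by (simp add: powr_add power_mult_distrib powr_numeral mult_ac)
    finally show "e\<^sup>2 * (c1 / 2) * X powr (\<rho> r + 2) \<le> (\<Sum>k \<in> ?S X. b (Suc k) * (real (Suc k))\<^sup>2)" .
  qed
qed

definition sine_energy :: "real \<Rightarrow> real \<Rightarrow> real" where
  "sine_energy \<delta> \<theta> = (\<Sum>k. b (Suc k) * exp (- \<delta>) ^ Suc k * (sin (real (Suc k) * \<theta> / 2))\<^sup>2)"

lemma summable_sine_energy:
  assumes "\<delta> > 0"
  shows "summable (\<lambda>k. b (Suc k) * exp (- \<delta>) ^ Suc k * (sin (real (Suc k) * \<theta> / 2))\<^sup>2)"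
proof (rule summable_comparison_test'[OF summable_lambert[OF assms]])
  fix k :: nat
  have "(sin (real (Suc k) * \<theta> / 2))\<^sup>2 \<le> 1" by (simp add: abs_square_le_1)
  then show "norm (b (Suc k) * exp (- \<delta>) ^ Suc k * (sin (real (Suc k) * \<theta> / 2))\<^sup>2) \<le> b (Suc k) * exp (- (real (Suc k) * \<delta>))"
    unfolding exp_minus_power using b_nonneg[of k] by (simp add: abs_mult mult_left_le)
qed

text \<open>Only the terms with k <= 1 / \<eta> are kept: there exp(-k \<delta>) >= exp(-1) and
  |sin(k \<theta> / 2)| >= k |\<theta>| / 4, so the sum of weighted squares applies. The free
  parameter \<open>\<eta>\<close> is taken as \<delta> near the centre and as |\<theta>| further
  out.\<close>

lemma sine_energy_ge:
  obtains c \<eta>0 where "c > 0" "\<eta>0 > 0"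
    "\<And>\<delta> \<theta> \<eta>. 0 < \<delta> \<Longrightarrow> \<delta> \<le> \<eta> \<Longrightarrow> \<bar>\<theta>\<bar> \<le> \<eta> \<Longrightarrow> \<eta> \<le> \<eta>0 \<Longrightarrow> sine_energy \<delta> \<theta> \<ge> c * \<theta>\<^sup>2 * \<eta> powr (- (\<rho> r + 2))"
proof -
  obtain c X0 where c: "c > 0" "X0 > 0" and
    sq: "\<And>X. X \<ge> X0 \<Longrightarrow> (\<Sum>k | real (Suc k) \<le> X. b (Suc k) * (real (Suc k))\<^sup>2) \<ge> c * X powr (\<rho> r + 2)"
    using weighted_squares_ge by blast
  show ?thesis
  proof (rule that[of "exp (-1) / 16 * c" "1 / X0"])
    fix \<delta> \<theta> \<eta> :: real assume a: "0 < \<delta>" "\<delta> \<le> \<eta>" "\<bar>\<theta>\<bar> \<le> \<eta>" "\<eta> \<le> 1 / X0"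
    have \<eta>: "\<eta> > 0" using a by linarith
    have X: "1 / \<eta> \<ge> X0" using a \<eta> c by (simp add: pos_le_divide_eq mult.commute)
    have "exp (-1) / 16 * c * \<theta>\<^sup>2 * \<eta> powr (- (\<rho> r + 2)) = exp (-1) / 16 * \<theta>\<^sup>2 * (c * (1 / \<eta>) powr (\<rho> r + 2))"
    proof -
      have "(1 / \<eta>) powr (\<rho> r + 2) = \<eta> powr (- (\<rho> r + 2))"
        unfolding powr_minus_divide using \<eta> by (simp add: powr_divide)
      then show ?thesis by (simp only: mult_ac)
    qed
    also have "\<dots> \<le> exp (-1) / 16 * \<theta>\<^sup>2 * (\<Sum>k | real (Suc k) \<le> 1 / \<eta>. b (Suc k) * (real (Suc k))\<^sup>2)"
      using sq[OF X] by (intro mult_left_mono) auto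
    also have "\<dots> = (\<Sum>k | real (Suc k) \<le> 1 / \<eta>. b (Suc k) * (exp (-1) * (real (Suc k) * \<theta> / 4)\<^sup>2))"
      unfolding sum_distrib_left by (intro sum.cong) (auto simp: power_mult_distrib power_divide)
    also have "\<dots> \<le> (\<Sum>k | real (Suc k) \<le> 1 / \<eta>. b (Suc k) * exp (- \<delta>) ^ Suc k * (sin (real (Suc k) * \<theta> / 2))\<^sup>2)"
    proof (rule sum_mono)
      fix k assume "k \<in> {k. real (Suc k) \<le> 1 / \<eta>}"
      then have k: "real (Suc k) * \<eta> \<le> 1" using \<eta> by (simp add: pos_le_divide_eq)
      have "real (Suc k) * \<delta> \<le> real (Suc k) * \<eta>" "real (Suc k) * \<bar>\<theta>\<bar> \<le> real (Suc k) * \<eta>"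
        using a by (auto intro!: mult_left_mono)
      moreover have "\<bar>real (Suc k) * \<theta> / 2\<bar> = real (Suc k) * \<bar>\<theta>\<bar> / 2" by (simp add: abs_mult del: of_nat_Suc)
      ultimately have k1: "real (Suc k) * \<delta> \<le> 1" "\<bar>real (Suc k) * \<theta> / 2\<bar> \<le> 1"
        using k by linarith+
      have e: "exp (-1) \<le> exp (- \<delta>) ^ Suc k" unfolding exp_minus_power using k1 by simp
      have "\<bar>real (Suc k) * \<theta> / 4\<bar> \<le> \<bar>sin (real (Suc k) * \<theta> / 2)\<bar>" using abs_sin_ge[OF k1(2)] by simp
      then have s: "(real (Suc k) * \<theta> / 4)\<^sup>2 \<le> (sin (real (Suc k) * \<theta> / 2))\<^sup>2" by (simp only: abs_le_square_iff)
      show "b (Suc k) * (exp (-1) * (real (Suc k) * \<theta> / 4)\<^sup>2) \<le> b (Suc k) * exp (- \<delta>) ^ Suc k * (sin (real (Suc k) * \<theta> / 2))\<^sup>2"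
        unfolding mult.assoc using e s by (intro mult_left_mono mult_mono b_nonneg) auto
    qed
    also have "\<dots> \<le> sine_energy \<delta> \<theta>"
      unfolding sine_energy_def
      by (intro sum_le_suminf summable_sine_energy a finite_le_real) (auto intro!: mult_nonneg_nonneg b_nonneg)
    finally show "sine_energy \<delta> \<theta> \<ge> exp (-1) / 16 * c * \<theta>\<^sup>2 * \<eta> powr (- (\<rho> r + 2))" .
  qed (use c in auto)
qed

end

section \<open>A local limit theorem\<close>

text \<open>If convergence failed at \<open>z\<close>, a subsequence would stay away from
  \<open>f z\<close>. Montel's theorem extracts from it a convergent one on the disc of radius |z| +
  1, whose limit agrees with \<open>f\<close> on the real diameter and hence at \<open>z\<close>, by
  the identity theorem. The hypotheses hold only eventually for each radius because in the
  application the domains grow with n.\<close>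

lemma vitali_entire:
  fixes F :: "nat \<Rightarrow> complex \<Rightarrow> complex" and f :: "complex \<Rightarrow> complex"
  assumes holo: "\<And>R. R > 0 \<Longrightarrow> \<forall>\<^sub>F n in sequentially. F n holomorphic_on ball 0 R"
    and bounded: "\<And>R. R > 0 \<Longrightarrow> \<exists>C. \<forall>\<^sub>F n in sequentially. \<forall>z\<in>ball 0 R. norm (F n z) \<le> C"
    and real: "\<And>u::real. (\<lambda>n. F n (of_real u)) \<longlonglongrightarrow> f (of_real u)"
    and f: "f holomorphic_on UNIV"
  shows "(\<lambda>n. F n z) \<longlonglongrightarrow> f z"
proof (rule ccontr)
  assume "\<not> ?thesis"
  then obtain e where e: "e > 0" "\<not> (\<forall>\<^sub>F n in sequentially. dist (F n z) (f z) < e)"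
    unfolding tendsto_iff by blast
  define R where "R = norm z + 1"
  have R: "R > 0" by (simp add: R_def add_nonneg_pos)
  obtain C where "\<forall>\<^sub>F n in sequentially. F n holomorphic_on ball 0 R \<and> (\<forall>z\<in>ball 0 R. norm (F n z) \<le> C)"
    using eventually_conj[OF holo[OF R]] bounded[OF R] by blast
  then obtain N where N: "\<And>n. n \<ge> N \<Longrightarrow> F n holomorphic_on ball 0 R \<and> (\<forall>z\<in>ball 0 R. norm (F n z) \<le> C)"
    unfolding eventually_sequentially by blast
  have "\<exists>n\<ge>max N m. dist (F n z) (f z) \<ge> e" for m
    using e(2) unfolding eventually_sequentially by (meson not_le)
  then have "\<exists>n>m. n \<ge> N \<and> dist (F n z) (f z) \<ge> e" for m
    by (metis Suc_le_lessD max.bounded_iff)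
  then obtain s :: "nat \<Rightarrow> nat" where s: "strict_mono s" "\<And>n. s n \<ge> N \<and> dist (F (s n) z) (f z) \<ge> e"
  proof -
    have inf: "infinite {n. n \<ge> N \<and> dist (F n z) (f z) \<ge> e}"
      unfolding infinite_nat_iff_unbounded using \<open>\<And>m. \<exists>n>m. n \<ge> N \<and> dist (F n z) (f z) \<ge> e\<close> by auto
    show ?thesis
      using that[of "enumerate {n. n \<ge> N \<and> dist (F n z) (f z) \<ge> e}"] enumerate_in_set[OF inf] strict_mono_enumerate[OF inf]
      by auto
  qed
  define H where "H = {h. h holomorphic_on ball 0 R \<and> (\<forall>z\<in>ball 0 R. norm (h z) \<le> C)}"
  obtain g r where g: "g holomorphic_on ball 0 R" "strict_mono r"
    and lim: "\<And>x. x \<in> ball 0 R \<Longrightarrow> (\<lambda>n. F (s (r n)) x) \<longlonglongrightarrow> g x"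
  proof (rule Montel[of "ball 0 R" H "\<lambda>n. F (s n)"])
    show "\<exists>B. \<forall>h\<in>H. \<forall>z\<in>K. norm (h z) \<le> B" if "compact K" "K \<subseteq> ball 0 R" for K
      using that unfolding H_def by (intro exI[of _ C]) blast
    show "range (\<lambda>n. F (s n)) \<subseteq> H" using N s(2) by (auto simp: H_def)
  qed (auto simp: H_def)
  have sr: "strict_mono (\<lambda>n. s (r n))" using s(1) g(2) by (auto simp: strict_mono_def)
  have greal: "g (of_real u) = f (of_real u)" if "\<bar>u\<bar> < R" for u :: real
  proof (rule LIMSEQ_unique)
    show "(\<lambda>n. F (s (r n)) (of_real u)) \<longlonglongrightarrow> g (of_real u)" using that by (intro lim) auto
    show "(\<lambda>n. F (s (r n)) (of_real u)) \<longlonglongrightarrow> f (of_real u)"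
      using LIMSEQ_subseq_LIMSEQ[OF real[of u] sr] by (simp add: o_def)
  qed
  have zR: "z \<in> ball 0 R" by (simp add: R_def)
  have "g z - f z = 0"
  proof (rule analytic_continuation[of "\<lambda>z. g z - f z" "ball 0 R" "complex_of_real ` {-R<..<R}" 0])
    show "(\<lambda>z. g z - f z) holomorphic_on ball 0 R"
      using g(1) holomorphic_on_subset[OF f] by (intro holomorphic_intros) auto
    show "0 islimpt complex_of_real ` {-R<..<R}"
      unfolding islimpt_approachable
    proof (intro allI impI)
      fix e :: real assume "e > 0"
      then show "\<exists>x'\<in>complex_of_real ` {-R<..<R}. x' \<noteq> 0 \<and> dist x' 0 < e"
        using R by (intro bexI[of _ "complex_of_real (min e R / 2)"] conjI imageI) (auto simp: dist_norm min_def norm_divide)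
    qed
    show "g w - f w = 0" if "w \<in> complex_of_real ` {-R<..<R}" for w
      using that greal by (auto simp: abs_less_iff)
  qed (use R zR in auto)
  then have "(\<lambda>n. F (s (r n)) z) \<longlonglongrightarrow> f z" using lim[OF zR] by simp
  then have "\<forall>\<^sub>F n in sequentially. dist (F (s (r n)) z) (f z) < e" using e(1) by (rule tendstoD)
  then obtain n where "dist (F (s (r n)) z) (f z) < e" by (auto simp: eventually_sequentially)
  with s(2)[of "r n"] show False by simp
qed

lemma integral_cis_period:
  fixes k :: int
  shows "(LINT \<theta>|lborel. indicator {-pi..pi} \<theta> *\<^sub>R cis (of_int k * \<theta>)) = (if k = 0 then of_real (2 * pi) else 0)"
proof -
  have int: "(\<lambda>\<theta>. cis (of_int k * \<theta>)) absolutely_integrable_on {-pi..pi}"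
    by (intro absolutely_integrable_continuous_real continuous_intros)
  have m: "(\<lambda>\<theta>. cis (of_int k * \<theta>)) \<in> borel_measurable borel"
    by (intro borel_measurable_continuous_onI continuous_intros)
  have "(LINT \<theta>|lborel. indicator {-pi..pi} \<theta> *\<^sub>R cis (of_int k * \<theta>)) = (LINT \<theta>|lebesgue. indicator {-pi..pi} \<theta> *\<^sub>R cis (of_int k * \<theta>))"
    using m by (intro integral_completion[symmetric] borel_measurable_scaleR borel_measurable_indicator) auto
  also have "\<dots> = integral {-pi..pi} (\<lambda>\<theta>. cis (of_int k * \<theta>))"
    using set_lebesgue_integral_eq_integral(2)[OF int] by (simp add: set_lebesgue_integral_def)
  also have "\<dots> = (if k = 0 then of_real (2 * pi) else 0)"
  proof (cases "k = 0")
    case True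
    then show ?thesis by (simp add: content_real scaleR_conv_of_real)
  next
    case False
    have "((\<lambda>\<theta>. cis (of_int k * \<theta>)) has_integral (cis (of_int k * pi) / (\<i> * of_int k) - cis (of_int k * (-pi)) / (\<i> * of_int k))) {-pi..pi}"
    proof (rule fundamental_theorem_of_calculus)
      fix x :: real
      have "((\<lambda>z. exp (\<i> * of_int k * z) / (\<i> * of_int k)) has_field_derivative exp (\<i> * of_int k * of_real x)) (at (of_real x))"
        using False by (auto intro!: derivative_eq_intros)
      from has_vector_derivative_real_field[OF this, of "{-pi..pi}"]
      show "((\<lambda>\<theta>. cis (of_int k * \<theta>) / (\<i> * of_int k)) has_vector_derivative cis (of_int k * x)) (at x within {-pi..pi})"
        by (simp add: cis_conv_exp mult.assoc)
    qed simp
    moreover have "cis (of_int k * pi) = cis (of_int k * (-pi))"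
    proof -
      have "cis (of_int k * pi) = cis (of_int k * (-pi)) * cis (2 * pi * of_int k)"
        unfolding cis_mult by (simp add: algebra_simps)
      then show ?thesis by (simp add: cis_multiple_2pi)
    qed
    ultimately show ?thesis using False by (simp add: integral_unique)
  qed
  finally show ?thesis .
qed

text \<open>Cauchy's coefficient formula by orthogonality of the characters. The integral over the
  real angle is the form in which \<theta> = t / B can be substituted.\<close>

lemma power_series_coeff_integral:
  fixes c :: "nat \<Rightarrow> real" and x :: real
  assumes summ: "summable (\<lambda>m. norm (c m * x ^ m))"
  shows "(LINT \<theta>|lborel. indicator {-pi..pi} \<theta> *\<^sub>R ((\<Sum>m. of_real (c m) * (of_real x * cis \<theta>) ^ m) * cis (- (real n * \<theta>))))
    = of_real (2 * pi * (c n * x ^ n))"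
proof -
  define f where "f m \<theta> = complex_of_real (c m * x ^ m) * (indicator {-pi..pi} \<theta> *\<^sub>R cis (of_int (int m - int n) * \<theta>))" for m and \<theta> :: real
  have f_eq: "f m \<theta> = indicator {-pi..pi} \<theta> *\<^sub>R (of_real (c m) * (of_real x * cis \<theta>) ^ m * cis (- (real n * \<theta>)))" for m \<theta>
  proof -
    have "cis \<theta> ^ m * cis (- (real n * \<theta>)) = cis (of_int (int m - int n) * \<theta>)"
      by (simp only: Complex.DeMoivre cis_mult) (simp add: algebra_simps)
    then show ?thesis by (simp add: f_def power_mult_distrib scaleR_conv_of_real mult_ac)
  qed
  have int1: "integrable lborel (\<lambda>\<theta>. indicator {-pi..pi} \<theta> *\<^sub>R cis (of_int k * \<theta>))" for k
    by (rule borel_integrable_compact) (auto intro!: continuous_intros)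
  have "(\<lambda>m. LINT \<theta>|lborel. f m \<theta>) sums (LINT \<theta>|lborel. (\<Sum>m. f m \<theta>))"
  proof (rule sums_integral)
    show "integrable lborel (f m)" for m unfolding f_def by (intro integrable_mult_right int1)
    have nf: "norm (f m \<theta>) = norm (c m * x ^ m) * indicator {-pi..pi} \<theta>" for m \<theta>
      by (simp add: f_def norm_mult norm_power abs_mult power_abs indicator_def)
    show "AE \<theta> in lborel. summable (\<lambda>m. norm (f m \<theta>))"
      unfolding nf by (intro AE_I2 summable_mult2 summ)
    have "summable (\<lambda>m. norm (c m * x ^ m) * (2 * pi))" by (intro summable_mult2 summ)
    then show "summable (\<lambda>m. LINT \<theta>|lborel. norm (f m \<theta>))" unfolding nf by simp
  qed
  also have "(\<lambda>m. LINT \<theta>|lborel. f m \<theta>) = (\<lambda>m. if m = n then of_real (2 * pi * (c n * x ^ n)) else 0)"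
  proof
    fix m
    show "(LINT \<theta>|lborel. f m \<theta>) = (if m = n then of_real (2 * pi * (c n * x ^ n)) else 0)"
      unfolding f_def integral_mult_right_zero integral_cis_period by (cases "m = n") simp_all
  qed
  finally have "(\<lambda>m. if m = n then complex_of_real (2 * pi * (c n * x ^ n)) else 0) sums (LINT \<theta>|lborel. (\<Sum>m. f m \<theta>))" .
  from sums_unique2[OF this sums_single[of n "\<lambda>_. complex_of_real (2 * pi * (c n * x ^ n))"]]
  have "(LINT \<theta>|lborel. (\<Sum>m. f m \<theta>)) = of_real (2 * pi * (c n * x ^ n))" .
  moreover have "(\<Sum>m. f m \<theta>) = indicator {-pi..pi} \<theta> *\<^sub>R ((\<Sum>m. of_real (c m) * (of_real x * cis \<theta>) ^ m) * cis (- (real n * \<theta>)))" for \<theta>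
  proof -
    have s: "summable (\<lambda>m. complex_of_real (c m) * (of_real x * cis \<theta>) ^ m)"
    proof (rule summable_norm_cancel)
      have "norm (complex_of_real (c m) * (of_real x * cis \<theta>) ^ m) = norm (c m * x ^ m)" for m
        by (simp add: norm_mult norm_power abs_mult power_abs)
      then show "summable (\<lambda>m. norm (complex_of_real (c m) * (of_real x * cis \<theta>) ^ m))"
        using summ by (simp only:)
    qed
    show ?thesis unfolding f_eq
      by (simp only: suminf_mult2[OF s] suminf_scaleR_right[OF summable_mult2[OF s]])
  qed
  ultimately show ?thesis by (simp only:)
qed

text \<open>Let X have the law with P(X = m) proportional to \<open>c m * exp (- d n) ^ m\<close>.
  The conclusion is that B P(X = n) tends to the normal density at 0, and \<open>clt\<close> says
  that the moment generating function of (X - n) / B converges to the normal one. In the inversion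
  integral the part |\<theta>| <= d, scaled by B, is treated by dominated convergence with majorant
  exp(-\<kappa> t^2); the rest is negligible by \<open>far\<close> and \<open>e\<close>.\<close>

theorem local_limit_gaussian:
  fixes c :: "nat \<Rightarrow> real" and L :: "real \<Rightarrow> real" and d B e :: "nat \<Rightarrow> real" and \<kappa> :: real
  defines "S \<equiv> (\<lambda>w. \<Sum>m. complex_of_real (c m) * w ^ m)"
  assumes c: "\<And>m. c m \<ge> 0"
    and sums: "\<And>\<delta>. \<delta> > 0 \<Longrightarrow> (\<lambda>m. c m * exp (- \<delta>) ^ m) sums exp (L \<delta>)"
    and d: "\<And>n. d n > 0" and B: "\<And>n. B n > 0" and \<kappa>: "\<kappa> > 0"
    and dB: "filterlim (\<lambda>n. d n * B n) at_top sequentially"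
    and d_pi: "\<forall>\<^sub>F n in sequentially. d n \<le> pi"
    and clt: "\<And>u. (\<lambda>n. L (d n - u / B n) - L (d n) - real n * u / B n) \<longlonglongrightarrow> u\<^sup>2 / 2"
    and near: "\<forall>\<^sub>F n in sequentially. \<forall>\<theta>. \<bar>\<theta>\<bar> \<le> d n \<longrightarrow>
       norm (S (of_real (exp (- d n)) * cis \<theta>)) \<le> exp (- \<kappa> * (\<theta> * B n)\<^sup>2) * exp (L (d n))"
    and far: "\<forall>\<^sub>F n in sequentially. \<forall>\<theta>. d n \<le> \<bar>\<theta>\<bar> \<and> \<bar>\<theta>\<bar> \<le> pi \<longrightarrow>
       norm (S (of_real (exp (- d n)) * cis \<theta>)) \<le> e n * exp (L (d n))"
    and e: "(\<lambda>n. B n * e n) \<longlonglongrightarrow> 0"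
  shows "(\<lambda>n. c n * exp (- d n) ^ n / exp (L (d n)) * B n) \<longlonglongrightarrow> 1 / sqrt (2 * pi)"
proof -
  have summ: "summable (\<lambda>m. norm (complex_of_real (c m) * w ^ m))" if w: "norm w < 1" for w
  proof -
    obtain \<delta> where \<delta>: "\<delta> > 0" "norm w \<le> exp (- \<delta>)"
    proof (cases "w = 0")
      case True then show ?thesis using that[of 1] by simp
    next
      case False then show ?thesis using that[of "- ln (norm w)"] w by simp
    qed
    show ?thesis
    proof (rule summable_comparison_test'[OF sums_summable[OF sums[OF \<delta>(1)]]])
      fix m
      show "norm (norm (complex_of_real (c m) * w ^ m)) \<le> c m * exp (- \<delta>) ^ m"
        using c[of m] power_mono[OF \<delta>(2), of m] by (simp add: norm_mult norm_power mult_left_mono)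
    qed
  qed
  have S_holo: "S holomorphic_on ball 0 1"
  proof (rule power_series_holomorphic)
    fix w :: complex assume "w \<in> ball 0 1"
    then have "summable (\<lambda>m. complex_of_real (c m) * w ^ m)" by (intro summable_norm_cancel[OF summ]) simp
    then show "(\<lambda>m. complex_of_real (c m) * (w - 0) ^ m) sums S w" unfolding S_def by (simp add: summable_sums)
  qed
  have S_le: "norm (S w) \<le> exp (L \<delta>)" if "\<delta> > 0" "norm w = exp (- \<delta>)" for w \<delta>
  proof -
    have "norm w < 1" using that by simp
    then have "norm (S w) \<le> (\<Sum>m. norm (complex_of_real (c m) * w ^ m))" unfolding S_def by (intro summable_norm summ)
    also have "(\<lambda>m. norm (complex_of_real (c m) * w ^ m)) = (\<lambda>m. c m * exp (- \<delta>) ^ m)"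
      using c that(2) by (simp add: norm_mult norm_power)
    finally show ?thesis using sums[OF that(1)] by (simp add: sums_iff)
  qed
  \<comment> \<open>The moment generating function of (X - n) / B at a real point x, X having the
    tilted law.\<close>
  define q where "q n x = exp (L (d n - x / B n) - L (d n) - real n * x / B n)" for n x
  have q_lim: "(\<lambda>n. q n x) \<longlonglongrightarrow> exp (x\<^sup>2 / 2)" for x
    unfolding q_def by (intro tendsto_exp clt)
  have dx: "d n - x / B n > 0" if "\<bar>x\<bar> \<le> R" "R < d n * B n" for n x R
    using that B[of n] by (simp add: pos_divide_less_eq)
  have q_sums: "(\<lambda>m. c m * exp (- (real m * d n)) * exp ((real m - real n) * (x / B n)) / exp (L (d n))) sums q n x"
    if "\<bar>x\<bar> \<le> R" "R < d n * B n" for n x R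
  proof -
    have "(\<lambda>m. c m * exp (- (d n - x / B n)) ^ m * exp (- (real n * x / B n)) / exp (L (d n)))
      sums (exp (L (d n - x / B n)) * exp (- (real n * x / B n)) / exp (L (d n)))"
      by (intro sums_divide sums_mult2 sums dx[OF that])
    moreover have "exp (L (d n - x / B n)) * exp (- (real n * x / B n)) / exp (L (d n)) = q n x"
      by (simp add: q_def exp_diff exp_minus divide_inverse)
    moreover have "exp (- (d n - x / B n)) ^ m * exp (- (real n * x / B n)) = exp (- (real m * d n)) * exp ((real m - real n) * (x / B n))" for m
      unfolding exp_of_nat_mult[symmetric] exp_add[symmetric] by (simp add: algebra_simps)
    ultimately show ?thesis by (simp add: mult.assoc)
  qed
  \<comment> \<open>An exponential is monotone in x, so for |x| <= R it is at most the sum of its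
    values at R and -R. This bounds \<open>F n\<close> on a whole disc by two convergent
    sequences.\<close>
  have q_le: "q n x \<le> q n R + q n (- R)" if "\<bar>x\<bar> \<le> R" "R < d n * B n" for n x R
  proof (rule sums_le[OF _ q_sums[OF that] sums_add[OF q_sums[of R R n] q_sums[of "-R" R n]]])
    fix m
    have "exp ((real m - real n) * (x / B n)) \<le> exp ((real m - real n) * (R / B n)) + exp ((real m - real n) * (- R / B n))"
    proof -
      have "\<bar>x / B n\<bar> \<le> R / B n" using that(1) B[of n] by (simp add: divide_right_mono)
      then have "\<bar>real m - real n\<bar> * \<bar>x / B n\<bar> \<le> \<bar>real m - real n\<bar> * (R / B n)" by (intro mult_left_mono) auto
      then have le: "(real m - real n) * (x / B n) \<le> \<bar>real m - real n\<bar> * (R / B n)"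
        using abs_ge_self[of "(real m - real n) * (x / B n)"] unfolding abs_mult by (meson order_trans)
      show ?thesis
      proof (cases "m \<ge> n")
        case True
        then have "exp ((real m - real n) * (x / B n)) \<le> exp ((real m - real n) * (R / B n))" using le by simp
        then show ?thesis using exp_ge_zero[of "(real m - real n) * (- R / B n)"] by linarith
      next
        case False
        then have ab: "\<bar>real m - real n\<bar> = - (real m - real n)" by simp
        have g: "- X * (R / B n) = X * (- R / B n)" for X by simp
        have "(real m - real n) * (x / B n) \<le> (real m - real n) * (- R / B n)" using le unfolding ab g .
        then have "exp ((real m - real n) * (x / B n)) \<le> exp ((real m - real n) * (- R / B n))" by (simp only: exp_le_cancel_iff)
        then show ?thesis using exp_ge_zero[of "(real m - real n) * (R / B n)"] by linarith
      qed
    qed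
    then have "c m * exp (- (real m * d n)) / exp (L (d n)) * exp ((real m - real n) * (x / B n))
      \<le> c m * exp (- (real m * d n)) / exp (L (d n)) * (exp ((real m - real n) * (R / B n)) + exp ((real m - real n) * (- R / B n)))"
      using c[of m] by (intro mult_left_mono) auto
    then show "c m * exp (- (real m * d n)) * exp ((real m - real n) * (x / B n)) / exp (L (d n))
      \<le> c m * exp (- (real m * d n)) * exp ((real m - real n) * (R / B n)) / exp (L (d n)) +
        c m * exp (- (real m * d n)) * exp ((real m - real n) * (- R / B n)) / exp (L (d n))"
      by (simp add: distrib_left)
  qed (use that in auto)
  \<comment> \<open>The extension of \<open>q n\<close> to complex arguments; on the imaginary axis
    it is the rescaled characteristic function. As d B tends to infinity, the argument of
    \<open>S\<close> eventually stays in the unit disc for all |u| < R.\<close>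
  define F where "F n u = S (exp (- of_real (d n) + u / of_real (B n))) * exp (- (of_nat n * u / of_real (B n))) / of_real (exp (L (d n)))" for n u
  have norm_exp: "norm (exp (- of_real (d n) + u / of_real (B n))) = exp (- (d n - Re u / B n))" for n u
    by simp
  have large: "\<forall>\<^sub>F n in sequentially. R < d n * B n" for R
    using dB unfolding filterlim_at_top_dense by blast
  have F_lim: "(\<lambda>n. F n z) \<longlonglongrightarrow> exp (z\<^sup>2 / 2)" for z
  proof (rule vitali_entire[where F = F and f = "\<lambda>z. exp (z\<^sup>2 / 2)"])
    fix R :: real assume R: "R > 0"
    show "\<forall>\<^sub>F n in sequentially. F n holomorphic_on ball 0 R"
      using large[of R]
    proof eventually_elim
      case (elim n)
      have "(S \<circ> (\<lambda>u. exp (- of_real (d n) + u / of_real (B n)))) holomorphic_on ball 0 R"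
      proof (rule holomorphic_on_compose_gen[OF _ S_holo])
        show "(\<lambda>u. exp (- complex_of_real (d n) + u / of_real (B n))) holomorphic_on ball 0 R"
          using B[of n] by (intro holomorphic_intros) auto
        show "(\<lambda>u. exp (- complex_of_real (d n) + u / of_real (B n))) ` ball 0 R \<subseteq> ball 0 1"
        proof (rule image_subsetI)
          fix u :: complex assume "u \<in> ball 0 R"
          then have "\<bar>Re u\<bar> \<le> R" using abs_Re_le_cmod[of u] by simp
          from dx[OF this elim] have "norm (exp (- of_real (d n) + u / of_real (B n))) < 1"
            unfolding norm_exp by simp
          then show "exp (- of_real (d n) + u / of_real (B n)) \<in> ball 0 1"
            by (simp only: mem_ball dist_0_norm)
        qed
      qed
      then show ?case unfolding F_def o_def using B[of n] by (intro holomorphic_intros) auto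
    qed
    have "\<forall>\<^sub>F n in sequentially. q n R < exp (R\<^sup>2 / 2) + 1" "\<forall>\<^sub>F n in sequentially. q n (- R) < exp (R\<^sup>2 / 2) + 1"
      using q_lim[of R] q_lim[of "- R"] by (auto intro!: order_tendstoD)
    then have "\<forall>\<^sub>F n in sequentially. \<forall>z\<in>ball 0 R. norm (F n z) \<le> 2 * (exp (R\<^sup>2 / 2) + 1)"
      using large[of R]
    proof eventually_elim
      case (elim n)
      show ?case
      proof
        fix u :: complex assume "u \<in> ball 0 R"
        then have u: "\<bar>Re u\<bar> \<le> R" using abs_Re_le_cmod[of u] by simp
        have "norm (F n u) = norm (S (exp (- of_real (d n) + u / of_real (B n)))) * exp (- (real n * Re u / B n)) / exp (L (d n))"
          by (simp add: F_def norm_mult norm_divide)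
        also have "\<dots> \<le> exp (L (d n - Re u / B n)) * exp (- (real n * Re u / B n)) / exp (L (d n))"
          using S_le[OF dx[OF u elim(3)] norm_exp] by (intro divide_right_mono mult_right_mono) auto
        also have "\<dots> = q n (Re u)" by (simp add: q_def exp_diff exp_minus divide_inverse)
        also have "\<dots> \<le> q n R + q n (- R)" by (rule q_le[OF u elim(3)])
        finally show "norm (F n u) \<le> 2 * (exp (R\<^sup>2 / 2) + 1)" using elim by simp
      qed
    qed
    then show "\<exists>C. \<forall>\<^sub>F n in sequentially. \<forall>z\<in>ball 0 R. norm (F n z) \<le> C" by blast
  next
    fix u :: real
    have "\<forall>\<^sub>F n in sequentially. complex_of_real (q n u) = F n (of_real u)"
      using large[of "\<bar>u\<bar>"]
    proof eventually_elim
      case (elim n)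
      have "S (of_real (exp (- (d n - u / B n)))) = of_real (exp (L (d n - u / B n)))"
        unfolding S_def using sums[OF dx[OF _ elim, of u]] sums_of_real[where 'a = complex]
        by (metis (no_types, lifting) ext of_real_mult of_real_power order_refl sums_unique)
      moreover have "exp (- of_real (d n) + of_real u / of_real (B n)) = complex_of_real (exp (- (d n - u / B n)))"
        by (simp add: exp_of_real[symmetric])
      moreover have "exp (- (of_nat n * of_real u / of_real (B n))) = complex_of_real (exp (- (real n * u / B n)))"
        by (simp add: exp_of_real[symmetric])
      ultimately have "F n (of_real u) = of_real (exp (L (d n - u / B n)) * exp (- (real n * u / B n)) / exp (L (d n)))"
        unfolding F_def by (simp only: of_real_mult of_real_divide)
      also have "exp (L (d n - u / B n)) * exp (- (real n * u / B n)) / exp (L (d n)) = q n u"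
        by (simp add: q_def exp_diff exp_minus divide_inverse)
      finally show ?case by simp
    qed
    moreover have "(\<lambda>n. complex_of_real (q n u)) \<longlonglongrightarrow> of_real (exp (u\<^sup>2 / 2))" by (intro tendsto_of_real q_lim)
    ultimately have "(\<lambda>n. F n (of_real u)) \<longlonglongrightarrow> of_real (exp (u\<^sup>2 / 2))" by (rule Lim_transform_eventually[rotated])
    then show "(\<lambda>n. F n (of_real u)) \<longlonglongrightarrow> exp ((of_real u)\<^sup>2 / 2)" by (simp add: exp_of_real[symmetric])
  qed (intro holomorphic_intros, auto)
  define \<Phi> where "\<Phi> n \<theta> = S (of_real (exp (- d n)) * cis \<theta>) * cis (- (real n * \<theta>)) / of_real (exp (L (d n)))" for n \<theta>
  have F_\<Phi>: "F n (\<i> * of_real t) = \<Phi> n (t / B n)" for n t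
  proof -
    have "exp (- of_real (d n) + \<i> * of_real t / of_real (B n)) = of_real (exp (- d n)) * cis (t / B n)"
      unfolding cis_conv_exp exp_of_real[symmetric] exp_add[symmetric] by simp
    moreover have "exp (- (of_nat n * (\<i> * of_real t) / of_real (B n))) = cis (- (real n * (t / B n)))"
      by (simp add: cis_conv_exp mult_ac)
    ultimately show ?thesis by (simp add: F_def \<Phi>_def)
  qed
  have \<Phi>_lim: "(\<lambda>n. \<Phi> n (t / B n)) \<longlonglongrightarrow> of_real (exp (- (t\<^sup>2 / 2)))" for t
    using F_lim[of "\<i> * of_real t"] unfolding F_\<Phi> by (simp add: power_mult_distrib exp_of_real[symmetric])
  have \<Phi>_cont: "continuous_on UNIV (\<Phi> n)" for n
  proof -
    have "continuous_on UNIV (\<lambda>\<theta>. S (of_real (exp (- d n)) * cis \<theta>))"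
      by (rule continuous_on_compose2[OF holomorphic_on_imp_continuous_on[OF S_holo]])
         (use d[of n] in \<open>auto intro!: continuous_intros simp: norm_mult\<close>)
    then show ?thesis unfolding \<Phi>_def by (intro continuous_intros) auto
  qed
  have \<Phi>_int: "integrable lborel (\<lambda>\<theta>. indicator {a..b} \<theta> *\<^sub>R \<Phi> n \<theta>)" for a b n
    by (rule borel_integrable_compact) (auto intro: continuous_on_subset[OF \<Phi>_cont])
  define a where "a n = c n * exp (- d n) ^ n / exp (L (d n))" for n
  have I: "(LINT \<theta>|lborel. indicator {-pi..pi} \<theta> *\<^sub>R \<Phi> n \<theta>) = of_real (2 * pi * a n)" for n
  proof -
    have "summable (\<lambda>m. norm (c m * exp (- d n) ^ m))"
      using sums_summable[OF sums[OF d]] c by simp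
    from power_series_coeff_integral[OF this, of n]
    have "(LINT \<theta>|lborel. indicator {-pi..pi} \<theta> *\<^sub>R (S (of_real (exp (- d n)) * cis \<theta>) * cis (- (real n * \<theta>))))
      = of_real (2 * pi * (c n * exp (- d n) ^ n))" by (simp add: S_def)
    moreover have "indicator {-pi..pi} \<theta> *\<^sub>R \<Phi> n \<theta> = (indicator {-pi..pi} \<theta> *\<^sub>R (S (of_real (exp (- d n)) * cis \<theta>) * cis (- (real n * \<theta>)))) / of_real (exp (L (d n)))" for \<theta>
      by (simp add: \<Phi>_def scaleR_conv_of_real)
    ultimately show ?thesis by (simp add: a_def)
  qed
  define I1 where "I1 n = (LINT \<theta>|lborel. indicator {-d n..d n} \<theta> *\<^sub>R \<Phi> n \<theta>)" for n
  have I1_lim: "(\<lambda>n. of_real (B n) * I1 n) \<longlonglongrightarrow> of_real (sqrt (2 * pi))"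
  proof -
    \<comment> \<open>The central integrand after the substitution \<theta> = t / B.\<close>
    define s where "s n t = indicator {-d n..d n} (t / B n) *\<^sub>R \<Phi> n (t / B n)" for n t
    have "I1 n = \<bar>1 / B n\<bar> *\<^sub>R (LINT t|lborel. s n t)" for n
      unfolding I1_def s_def using B[of n] lborel_integral_real_affine[of "1 / B n" "\<lambda>\<theta>. indicator {-d n..d n} \<theta> *\<^sub>R \<Phi> n \<theta>" 0] by simp
    then have BI1: "of_real (B n) * I1 n = (LINT t|lborel. s n t)" for n
      using B[of n] by (simp add: scaleR_conv_of_real)
    obtain N where N: "\<And>n \<theta>. n \<ge> N \<Longrightarrow> \<bar>\<theta>\<bar> \<le> d n \<Longrightarrow>
       norm (S (of_real (exp (- d n)) * cis \<theta>)) \<le> exp (- \<kappa> * (\<theta> * B n)\<^sup>2) * exp (L (d n))"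
      using near unfolding eventually_sequentially by blast
    \<comment> \<open>The majorant is available only from index \<open>N\<close> on, so the sequence
      is shifted.\<close>
    have "(\<lambda>n. LINT t|lborel. s (n + N) t) \<longlonglongrightarrow> (LINT t|lborel. complex_of_real (exp (- (t\<^sup>2 / 2))))"
    proof (rule integral_dominated_convergence[where w = "\<lambda>t. exp (- \<kappa> * t\<^sup>2)"])
      show "integrable lborel (\<lambda>t. exp (- \<kappa> * t\<^sup>2))"
      proof -
        define \<sigma> where "\<sigma> = 1 / sqrt (2 * \<kappa>)"
        have \<sigma>: "\<sigma> > 0" "2 * \<sigma>\<^sup>2 = 1 / \<kappa>" using \<kappa> by (auto simp: \<sigma>_def power_divide)
        have "integrable lborel (\<lambda>t. sqrt (2 * pi * \<sigma>\<^sup>2) * normal_density 0 \<sigma> t)"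
          using \<sigma> by (intro integrable_mult_right integrable_normal_density)
        moreover have "sqrt (2 * pi * \<sigma>\<^sup>2) * normal_density 0 \<sigma> t = exp (- \<kappa> * t\<^sup>2)" for t
          using \<sigma> \<kappa> by (simp add: normal_density_def)
        ultimately show ?thesis by simp
      qed
      show "(\<lambda>t. complex_of_real (exp (- (t\<^sup>2 / 2)))) \<in> borel_measurable lborel" by measurable
      show "s (n + N) \<in> borel_measurable lborel" for n
      proof -
        have "\<Phi> (n + N) \<in> borel_measurable borel" by (rule borel_measurable_continuous_onI[OF \<Phi>_cont])
        then show ?thesis unfolding s_def by measurable
      qed
      show "AE t in lborel. (\<lambda>n. s (n + N) t) \<longlonglongrightarrow> of_real (exp (- (t\<^sup>2 / 2)))"
      proof (rule AE_I2)
        fix t :: real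
        have "\<forall>\<^sub>F n in sequentially. \<Phi> n (t / B n) = s n t"
          using large[of "\<bar>t\<bar>"]
        proof eventually_elim
          case (elim n)
          then have "\<bar>t / B n\<bar> \<le> d n" using B[of n] by (simp add: pos_divide_le_eq)
          then have "t / B n \<in> {- d n..d n}" unfolding abs_le_iff atLeastAtMost_iff by linarith
          then show ?case by (simp add: s_def)
        qed
        with \<Phi>_lim[of t] have "(\<lambda>n. s n t) \<longlonglongrightarrow> of_real (exp (- (t\<^sup>2 / 2)))" by (rule Lim_transform_eventually)
        then show "(\<lambda>n. s (n + N) t) \<longlonglongrightarrow> of_real (exp (- (t\<^sup>2 / 2)))" by (rule LIMSEQ_ignore_initial_segment)
      qed
      show "AE t in lborel. norm (s (n + N) t) \<le> exp (- \<kappa> * t\<^sup>2)" for n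
      proof (rule AE_I2)
        fix t :: real
        show "norm (s (n + N) t) \<le> exp (- \<kappa> * t\<^sup>2)"
        proof (cases "\<bar>t / B (n + N)\<bar> \<le> d (n + N)")
          case True
          have "norm (\<Phi> (n + N) (t / B (n + N))) \<le> exp (- \<kappa> * (t / B (n + N) * B (n + N))\<^sup>2)"
            using N[OF _ True] by (simp add: \<Phi>_def norm_mult norm_divide pos_divide_le_eq)
          also have "t / B (n + N) * B (n + N) = t" using B[of "n + N"] by simp
          finally show ?thesis by (auto simp: s_def indicator_def)
        next
          case False
          then have "t / B (n + N) \<notin> {- d (n + N)..d (n + N)}" unfolding abs_le_iff atLeastAtMost_iff by linarith
          then show ?thesis by (simp add: s_def)
        qed
      qed
    qed
    then have "(\<lambda>n. LINT t|lborel. s n t) \<longlonglongrightarrow> (LINT t|lborel. complex_of_real (exp (- (t\<^sup>2 / 2))))"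
      by (rule LIMSEQ_offset)
    also have "(LINT t|lborel. complex_of_real (exp (- (t\<^sup>2 / 2)))) = of_real (LINT t|lborel. exp (- (t\<^sup>2 / 2)))"
      by (rule integral_complex_of_real)
    also have "(LINT t|lborel. exp (- (t\<^sup>2 / 2))) = (LINT t|lborel. sqrt (2 * pi) * normal_density 0 1 t)"
      by (simp add: normal_density_def)
    also have "\<dots> = sqrt (2 * pi)" by (simp del: integral_mult_right_zero add: integral_mult_right)
    finally show ?thesis unfolding BI1 .
  qed
  have I2: "\<forall>\<^sub>F n in sequentially. norm (of_real (B n) * (of_real (2 * pi * a n) - I1 n)) \<le> 2 * pi * \<bar>B n * e n\<bar>"
    using far d_pi
  proof eventually_elim
    case (elim n)
    have "of_real (2 * pi * a n) - I1 n = (LINT \<theta>|lborel. indicator {-pi..pi} \<theta> *\<^sub>R \<Phi> n \<theta> - indicator {-d n..d n} \<theta> *\<^sub>R \<Phi> n \<theta>)"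
      unfolding I[symmetric] I1_def by (rule Bochner_Integration.integral_diff[symmetric, OF \<Phi>_int \<Phi>_int])
    then have "norm (of_real (2 * pi * a n) - I1 n) \<le> (LINT \<theta>|lborel. norm (indicator {-pi..pi} \<theta> *\<^sub>R \<Phi> n \<theta> - indicator {-d n..d n} \<theta> *\<^sub>R \<Phi> n \<theta>))"
      by (simp only: integral_norm_bound)
    also have "\<dots> \<le> (LINT \<theta>|lborel. \<bar>e n\<bar> * indicator {-pi..pi} \<theta>)"
    proof (rule integral_mono)
      show "integrable lborel (\<lambda>\<theta>. norm (indicator {-pi..pi} \<theta> *\<^sub>R \<Phi> n \<theta> - indicator {-d n..d n} \<theta> *\<^sub>R \<Phi> n \<theta>))"
        by (intro integrable_norm Bochner_Integration.integrable_diff \<Phi>_int)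
      show "integrable lborel (\<lambda>\<theta>. \<bar>e n\<bar> * indicator {-pi..pi} \<theta>)" by simp
      fix \<theta> :: real
      show "norm (indicator {-pi..pi} \<theta> *\<^sub>R \<Phi> n \<theta> - indicator {-d n..d n} \<theta> *\<^sub>R \<Phi> n \<theta>) \<le> \<bar>e n\<bar> * indicator {-pi..pi} \<theta>"
      proof (cases "\<bar>\<theta>\<bar> \<le> pi")
        case True
        show ?thesis
        proof (cases "\<bar>\<theta>\<bar> \<le> d n")
          case True
          then show ?thesis using \<open>\<bar>\<theta>\<bar> \<le> pi\<close> by (simp add: indicator_def abs_le_iff)
        next
          case False
          then have "norm (S (of_real (exp (- d n)) * cis \<theta>)) \<le> e n * exp (L (d n))" using elim(1) True by simp
          then have "norm (\<Phi> n \<theta>) \<le> e n" by (simp add: \<Phi>_def norm_mult norm_divide pos_divide_le_eq)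
          then show ?thesis using True False by (auto simp: indicator_def abs_le_iff)
        qed
      next
        case False
        then show ?thesis using elim(2) by (auto simp: indicator_def abs_le_iff)
      qed
    qed
    also have "\<dots> = 2 * pi * \<bar>e n\<bar>" by simp
    finally have "B n * norm (of_real (2 * pi * a n) - I1 n) \<le> B n * (2 * pi * \<bar>e n\<bar>)"
      using B[of n] by (intro mult_left_mono) auto
    then show ?case using B[of n] by (simp add: norm_mult abs_mult)
  qed
  have "(\<lambda>n. 2 * pi * \<bar>B n * e n\<bar>) \<longlonglongrightarrow> 0"
    using tendsto_mult[OF tendsto_const[of "2 * pi"] tendsto_rabs_zero[OF e]] by simp
  then have "(\<lambda>n. of_real (B n) * (of_real (2 * pi * a n) - I1 n)) \<longlonglongrightarrow> 0"
    using I2 by (rule Lim_null_comparison[rotated])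
  from tendsto_add[OF this I1_lim] have "(\<lambda>n. complex_of_real (B n * (2 * pi * a n))) \<longlonglongrightarrow> of_real (sqrt (2 * pi))"
    by (simp add: algebra_simps)
  then have "(\<lambda>n. B n * (2 * pi * a n)) \<longlonglongrightarrow> sqrt (2 * pi)" by (simp only: tendsto_of_real_iff)
  then have "(\<lambda>n. 1 / (2 * pi) * (B n * (2 * pi * a n))) \<longlonglongrightarrow> 1 / (2 * pi) * sqrt (2 * pi)"
    by (intro tendsto_mult tendsto_const)
  moreover have "1 / (2 * pi) * sqrt (2 * pi) = 1 / sqrt (2 * pi)"
    using real_sqrt_mult_self[of "2 * pi"] by (simp add: field_simps)
  ultimately show ?thesis by (simp add: a_def mult_ac)
qed

section \<open>Bounds on the circle and the saddle point\<close>

locale meinardus = dirichlet_data +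
  fixes i :: kind
  assumes adm: "admissible_weights i b"
    and condIII: "condition_III i b (\<rho> r)"
begin

lemma gf_sums:
  assumes "\<delta> > 0"
  shows "(\<lambda>m. coeff_c i b m * exp (- \<delta>) ^ m) sums exp (log_gf i \<delta>)"
  unfolding log_gf_def using assms
  by (intro coeff_c_sums[OF adm] summable_log_gf) auto

definition gf_circle :: "real \<Rightarrow> real \<Rightarrow> complex" where
  "gf_circle \<delta> \<theta> = (\<Sum>m. complex_of_real (coeff_c i b m) * (of_real (exp (- \<delta>)) * cis \<theta>) ^ m)"

lemma norm_gf_circle_le:
  assumes "\<delta> > 0"
  shows "norm (gf_circle \<delta> \<theta>) \<le> exp (- (2 / const_M i) * sine_energy \<delta> \<theta>) * exp (log_gf i \<delta>)"
  unfolding gf_circle_def log_gf_def sine_energy_def using assms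
  by (intro norm_coeff_c_suminf_le[OF adm] summable_log_gf summable_sine_energy) auto

text \<open>The choice \<eta> = \<delta> in the sine bound. The power
  \<open>- (\<rho> r + 2)\<close> is the order of the variance, so this is a Gaussian bound on the
  scale of the standard deviation.\<close>

lemma gf_circle_near:
  obtains \<kappa> \<delta>0 where "\<kappa> > 0" "\<delta>0 > 0"
    "\<And>\<delta> \<theta>. 0 < \<delta> \<Longrightarrow> \<delta> < \<delta>0 \<Longrightarrow> \<bar>\<theta>\<bar> \<le> \<delta> \<Longrightarrow>
       norm (gf_circle \<delta> \<theta>) \<le> exp (- \<kappa> * (\<theta>\<^sup>2 * \<delta> powr (- (\<rho> r + 2)))) * exp (log_gf i \<delta>)"
proof -
  obtain c \<eta>0 where c: "c > 0" "\<eta>0 > 0" and se: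
    "\<And>\<delta> \<theta> \<eta>. 0 < \<delta> \<Longrightarrow> \<delta> \<le> \<eta> \<Longrightarrow> \<bar>\<theta>\<bar> \<le> \<eta> \<Longrightarrow> \<eta> \<le> \<eta>0 \<Longrightarrow> sine_energy \<delta> \<theta> \<ge> c * \<theta>\<^sup>2 * \<eta> powr (- (\<rho> r + 2))"
    using sine_energy_ge by blast
  show ?thesis
  proof (rule that[of "2 / const_M i * c" \<eta>0])
    show "2 / const_M i * c > 0" using c const_M_pos[of i] by simp
    fix \<delta> \<theta> :: real assume d: "0 < \<delta>" "\<delta> < \<eta>0" "\<bar>\<theta>\<bar> \<le> \<delta>"
    have "2 / const_M i * (c * \<theta>\<^sup>2 * \<delta> powr (- (\<rho> r + 2))) \<le> 2 / const_M i * sine_energy \<delta> \<theta>"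
      using se[of \<delta> \<delta> \<theta>] d const_M_pos[of i] by (intro mult_left_mono) auto
    then have "exp (- (2 / const_M i) * sine_energy \<delta> \<theta>) \<le> exp (- (2 / const_M i * c) * (\<theta>\<^sup>2 * \<delta> powr (- (\<rho> r + 2))))"
      by (simp add: mult.assoc)
    then show "norm (gf_circle \<delta> \<theta>) \<le> exp (- (2 / const_M i * c) * (\<theta>\<^sup>2 * \<delta> powr (- (\<rho> r + 2)))) * exp (log_gf i \<delta>)"
      using norm_gf_circle_le[OF d(1), of \<theta>] by (meson mult_right_mono exp_ge_zero order_trans)
  qed (use c in auto)
qed

text \<open>The standard deviation has order \<open>\<delta> powr (- (\<rho> r + 2) / 2)\<close>;
  multiplied with it, this bound still leaves a full factor \<delta>.\<close>

lemma gf_circle_far: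
  obtains \<delta>0 where "\<delta>0 > 0"
    "\<And>\<delta> \<theta>. 0 < \<delta> \<Longrightarrow> \<delta> < \<delta>0 \<Longrightarrow> \<delta> \<le> \<bar>\<theta>\<bar> \<Longrightarrow> \<bar>\<theta>\<bar> \<le> pi \<Longrightarrow>
       norm (gf_circle \<delta> \<theta>) \<le> \<delta> powr (2 + \<rho> r / 2) * exp (log_gf i \<delta>)"
proof -
  obtain c \<eta>0 where c: "c > 0" "\<eta>0 > 0" and se:
    "\<And>\<delta> \<theta> \<eta>. 0 < \<delta> \<Longrightarrow> \<delta> \<le> \<eta> \<Longrightarrow> \<bar>\<theta>\<bar> \<le> \<eta> \<Longrightarrow> \<eta> \<le> \<eta>0 \<Longrightarrow> sine_energy \<delta> \<theta> \<ge> c * \<theta>\<^sup>2 * \<eta> powr (- (\<rho> r + 2))"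
    using sine_energy_ge by blast
  \<comment> \<open>Condition (III) with \<epsilon> = 1, which turns 1 + \<rho>_r / 2 + \<epsilon>
    into the exponent of the claim.\<close>
  have "\<exists>\<delta>0>0. \<forall>\<delta>. 0 < \<delta> \<and> \<delta> < \<delta>0 \<longrightarrow> (\<forall>\<alpha>. sqrt \<delta> \<le> \<bar>\<alpha>\<bar> \<and> \<bar>\<alpha>\<bar> \<le> 1 / 2 \<longrightarrow>
     2 * (\<Sum>k. b (Suc k) * exp (- real (Suc k) * \<delta>) * (sin (pi * real (Suc k) * \<alpha>))\<^sup>2)
             \<ge> (1 + \<rho> r / 2 + 1) * const_M i * \<bar>ln \<delta>\<bar>)"
    using mp[OF spec[OF condIII[unfolded condition_III_def], of 1] zero_less_one] .
  then obtain \<delta>1 where \<delta>1: "\<delta>1 > 0" and III: "\<And>\<delta> \<alpha>. 0 < \<delta> \<Longrightarrow> \<delta> < \<delta>1 \<Longrightarrow> sqrt \<delta> \<le> \<bar>\<alpha>\<bar> \<Longrightarrow> \<bar>\<alpha>\<bar> \<le> 1 / 2 \<Longrightarrow>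
     2 * (\<Sum>k. b (Suc k) * exp (- real (Suc k) * \<delta>) * (sin (pi * real (Suc k) * \<alpha>))\<^sup>2)
             \<ge> (1 + \<rho> r / 2 + 1) * const_M i * \<bar>ln \<delta>\<bar>"
    by blast
  define C where "C = 2 / const_M i * c"
  have C: "C > 0" using c const_M_pos[of i] by (simp add: C_def)
  have "\<forall>\<^sub>F \<delta>::real in at_right 0. exp (- (C * (2 * pi * sqrt \<delta>) powr (- \<rho> r))) \<le> \<delta> powr (2 + \<rho> r / 2)"
    using C rho_r_pos by real_asymp
  moreover have "\<forall>\<^sub>F \<delta>::real in at_right 0. 2 * pi * sqrt \<delta> < \<eta>0" using c by real_asymp
  ultimately have "\<forall>\<^sub>F \<delta>::real in at_right 0. exp (- (C * (2 * pi * sqrt \<delta>) powr (- \<rho> r))) \<le> \<delta> powr (2 + \<rho> r / 2) \<and> 2 * pi * sqrt \<delta> < \<eta>0"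
    by (rule eventually_conj)
  then obtain \<delta>2 where \<delta>2: "\<delta>2 > 0" "\<And>\<delta>. 0 < \<delta> \<Longrightarrow> \<delta> < \<delta>2 \<Longrightarrow> exp (- (C * (2 * pi * sqrt \<delta>) powr (- \<rho> r))) \<le> \<delta> powr (2 + \<rho> r / 2) \<and> 2 * pi * sqrt \<delta> < \<eta>0"
    unfolding eventually_at_right_field by auto
  show ?thesis
  proof (rule that[of "min 1 (min \<delta>1 \<delta>2)"])
    show "min 1 (min \<delta>1 \<delta>2) > 0" using \<delta>1 \<delta>2 by simp
    fix \<delta> \<theta> :: real assume d: "0 < \<delta>" "\<delta> < min 1 (min \<delta>1 \<delta>2)" "\<delta> \<le> \<bar>\<theta>\<bar>" "\<bar>\<theta>\<bar> \<le> pi"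
    have "exp (- (2 / const_M i) * sine_energy \<delta> \<theta>) \<le> \<delta> powr (2 + \<rho> r / 2)"
    \<comment> \<open>With \<alpha> = \<theta> / (2 pi) the threshold is |\<alpha>| = sqrt \<delta>,
      where condition (III) starts. Below it the sine bound with \<eta> = |\<theta>| gives an energy
      of at least order |\<theta>|^(-\<rho>_r), hence at least a negative power of \<delta>, which
      beats every logarithm.\<close>
    proof (cases "\<bar>\<theta>\<bar> \<le> 2 * pi * sqrt \<delta>")
      case True
      have t: "\<bar>\<theta>\<bar> > 0" using d by linarith
      have "\<bar>\<theta>\<bar> \<le> \<eta>0" using True \<delta>2(2)[of \<delta>] d by linarith
      then have "c * \<theta>\<^sup>2 * \<bar>\<theta>\<bar> powr (- (\<rho> r + 2)) \<le> sine_energy \<delta> \<theta>" using d by (intro se) auto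
      moreover have "\<theta>\<^sup>2 * \<bar>\<theta>\<bar> powr (- (\<rho> r + 2)) = \<bar>\<theta>\<bar> powr (- \<rho> r)"
      proof -
        have "\<theta>\<^sup>2 = \<bar>\<theta>\<bar> powr 2" using t by (simp add: powr_numeral)
        then have "\<theta>\<^sup>2 * \<bar>\<theta>\<bar> powr (- (\<rho> r + 2)) = \<bar>\<theta>\<bar> powr (2 + (- (\<rho> r + 2)))" by (simp only: powr_add)
        then show ?thesis by simp
      qed
      moreover have "(2 * pi * sqrt \<delta>) powr (- \<rho> r) \<le> \<bar>\<theta>\<bar> powr (- \<rho> r)"
        using True t rho_r_pos by (intro powr_mono2') auto
      then have "c * (2 * pi * sqrt \<delta>) powr (- \<rho> r) \<le> c * \<bar>\<theta>\<bar> powr (- \<rho> r)" using c by (intro mult_left_mono) auto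
      ultimately have "c * (2 * pi * sqrt \<delta>) powr (- \<rho> r) \<le> sine_energy \<delta> \<theta>" by (simp add: mult.assoc)
      then have "2 / const_M i * (c * (2 * pi * sqrt \<delta>) powr (- \<rho> r)) \<le> 2 / const_M i * sine_energy \<delta> \<theta>"
        using const_M_pos[of i] by (intro mult_left_mono) auto
      then have "exp (- (2 / const_M i) * sine_energy \<delta> \<theta>) \<le> exp (- (C * (2 * pi * sqrt \<delta>) powr (- \<rho> r)))"
        by (simp add: C_def mult.assoc)
      then show ?thesis using \<delta>2(2)[of \<delta>] d by linarith
    next
      case False
      define \<alpha> where "\<alpha> = \<theta> / (2 * pi)"
      have \<alpha>: "\<bar>\<alpha>\<bar> = \<bar>\<theta>\<bar> / (2 * pi)" by (simp add: \<alpha>_def abs_divide)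
      have "sqrt \<delta> \<le> \<bar>\<alpha>\<bar>" "\<bar>\<alpha>\<bar> \<le> 1 / 2"
        using False d unfolding \<alpha> by (simp_all add: pos_le_divide_eq pos_divide_le_eq mult_ac)
      then have "(1 + \<rho> r / 2 + 1) * const_M i * \<bar>ln \<delta>\<bar> \<le>
         2 * (\<Sum>k. b (Suc k) * exp (- real (Suc k) * \<delta>) * (sin (pi * real (Suc k) * \<alpha>))\<^sup>2)"
        using d by (intro III) auto
      also have "(\<Sum>k. b (Suc k) * exp (- real (Suc k) * \<delta>) * (sin (pi * real (Suc k) * \<alpha>))\<^sup>2) = sine_energy \<delta> \<theta>"
        unfolding sine_energy_def exp_minus_power
        by (intro suminf_cong) (simp add: \<alpha>_def mult_ac del: of_nat_Suc)
      also have "\<bar>ln \<delta>\<bar> = - ln \<delta>" using d by simp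
      finally have "(2 + \<rho> r / 2) * (- ln \<delta>) * const_M i \<le> 2 * sine_energy \<delta> \<theta>" by (simp add: mult_ac add.commute)
      then have "(2 + \<rho> r / 2) * (- ln \<delta>) \<le> 2 / const_M i * sine_energy \<delta> \<theta>"
        using const_M_pos[of i] by (simp add: pos_le_divide_eq)
      then have "- (2 / const_M i) * sine_energy \<delta> \<theta> \<le> (2 + \<rho> r / 2) * ln \<delta>" by simp
      then show ?thesis using d by (simp add: powr_def)
    qed
    then show "norm (gf_circle \<delta> \<theta>) \<le> \<delta> powr (2 + \<rho> r / 2) * exp (log_gf i \<delta>)"
      using norm_gf_circle_le[OF d(1), of \<theta>] by (meson mult_right_mono exp_ge_zero order_trans)
  qed
qed

section \<open>The saddle point of the main part\<close>

definition main_deriv :: "real \<Rightarrow> real" where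
  "main_deriv \<delta> = (\<Sum>l=1..r. \<rho> l * h i l * \<delta> powr (- \<rho> l - 1))"

definition main_deriv2 :: "real \<Rightarrow> real" where
  "main_deriv2 \<delta> = (\<Sum>l=1..r. \<rho> l * (\<rho> l + 1) * h i l * \<delta> powr (- \<rho> l - 2))"

lemma main_part_deriv: "\<delta> > 0 \<Longrightarrow> (main_part i has_real_derivative - main_deriv \<delta>) (at \<delta>)"
  unfolding main_part_def[abs_def] main_deriv_def sum_negf[symmetric]
  by (auto intro!: derivative_eq_intros sum.cong simp: mult_ac)

lemma main_deriv_deriv: "\<delta> > 0 \<Longrightarrow> (main_deriv has_real_derivative - main_deriv2 \<delta>) (at \<delta>)"
  unfolding main_deriv_def[abs_def] main_deriv2_def sum_negf[symmetric]
  by (auto intro!: derivative_eq_intros sum.cong simp: algebra_simps)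

lemma r_in: "r \<in> {1..r}" using r_pos by simp

lemma main_deriv2_ge: "\<delta> > 0 \<Longrightarrow> main_deriv2 \<delta> \<ge> \<rho> r * (\<rho> r + 1) * h i r * \<delta> powr (- \<rho> r - 2)"
  unfolding main_deriv2_def using rho_pos h_pos[of _ i] r_in
  by (intro member_le_sum[where f = "\<lambda>l. \<rho> l * (\<rho> l + 1) * h i l * \<delta> powr (- \<rho> l - 2)"]) (auto intro!: mult_nonneg_nonneg simp: less_imp_le)

lemma main_deriv2_pos: "\<delta> > 0 \<Longrightarrow> main_deriv2 \<delta> > 0"
  using main_deriv2_ge[of \<delta>] rho_r_pos h_pos[OF r_in, of i]
  by (intro less_le_trans[OF _ main_deriv2_ge]) (auto intro!: mult_pos_pos)

lemma saddle_point_exists: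
  assumes "N > 0"
  shows "\<exists>\<delta>>0. main_deriv \<delta> = N"
proof -
  \<comment> \<open>At \<open>a\<close> the term l = r alone equals \<open>N\<close>.\<close>
  define a where "a = (\<rho> r * h i r / N) powr (1 / (\<rho> r + 1))"
  have pos: "\<rho> r * h i r / N > 0" using rho_r_pos h_pos[OF r_in, of i] assms by simp
  then have a: "a > 0" unfolding a_def by (simp only: powr_gt_zero less_imp_neq[symmetric] not_False_eq_True)
  have "a powr (- \<rho> r - 1) = (\<rho> r * h i r / N) powr (1 / (\<rho> r + 1) * (- \<rho> r - 1))"
    unfolding a_def by (rule powr_powr)
  also have "1 / (\<rho> r + 1) * (- \<rho> r - 1) = -1" using rho_r_pos by (simp add: field_simps)
  also have "(\<rho> r * h i r / N) powr -1 = inverse (\<rho> r * h i r / N)"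
    unfolding powr_minus using pos by (simp only: powr_one less_imp_le)
  finally have ap: "a powr (- \<rho> r - 1) = N / (\<rho> r * h i r)" by simp
  have "N = \<rho> r * h i r * a powr (- \<rho> r - 1)" using rho_r_pos h_pos[OF r_in, of i] by (simp add: ap)
  also have "\<dots> \<le> main_deriv a"
    unfolding main_deriv_def using rho_pos h_pos[of _ i] r_in
    by (intro member_le_sum[where f = "\<lambda>l. \<rho> l * h i l * a powr (- \<rho> l - 1)"]) (auto intro!: mult_nonneg_nonneg simp: less_imp_le)
  finally have ge: "main_deriv a \<ge> N" .
  define T where "T = (\<Sum>l=1..r. \<rho> l * h i l)"
  have T: "T \<ge> 0" unfolding T_def using rho_pos h_pos[of _ i] by (intro sum_nonneg mult_nonneg_nonneg) (auto intro: less_imp_le)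
  \<comment> \<open>For arguments at least 1 every power is bounded by the power -1, so
    \<open>main_deriv c \<le> T / c\<close>.\<close>
  define c where "c = max a (max 1 (T / N))"
  have c: "c \<ge> a" "c \<ge> 1" "c \<ge> T / N" by (auto simp: c_def)
  have "main_deriv c \<le> (\<Sum>l=1..r. \<rho> l * h i l * c powr (-1))"
    unfolding main_deriv_def using rho_pos h_pos[of _ i] c
    by (intro sum_mono mult_left_mono powr_mono mult_nonneg_nonneg) (auto intro: less_imp_le)
  also have "\<dots> = T / c" using c by (simp add: T_def sum_distrib_right powr_minus divide_inverse)
  also have "\<dots> \<le> N" using c assms by (simp add: pos_divide_le_eq mult.commute)
  finally have le: "main_deriv c \<le> N" .
  have "\<forall>x. a \<le> x \<and> x \<le> c \<longrightarrow> isCont main_deriv x"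
    using a by (auto intro!: DERIV_isCont[OF main_deriv_deriv])
  then obtain x where "a \<le> x" "x \<le> c" "main_deriv x = N"
    using IVT2[of main_deriv c N a] ge le c by blast
  then show ?thesis using a by (intro exI[of _ x]) auto
qed

end

section \<open>Asymptotic expansions in real powers\<close>

text \<open>Generalised polynomials with real exponents. Generating them one monomial at a time
  makes closure under sums and products an induction; exponents may repeat on the way and are
  collected only in \<open>gpoly_representation\<close>.\<close>

inductive_set gpoly :: "real set \<Rightarrow> (real \<Rightarrow> real) set" for S where
  zero: "(\<lambda>_. 0) \<in> gpoly S"
| add_monom: "p \<in> gpoly S \<Longrightarrow> s \<in> S \<Longrightarrow> (\<lambda>x. p x + a * x powr s) \<in> gpoly S"

lemma gpoly_monom: "s \<in> S \<Longrightarrow> (\<lambda>x. a * x powr s) \<in> gpoly S"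
  using gpoly.add_monom[OF gpoly.zero, of s S a] by simp

lemma gpoly_add: "q \<in> gpoly S \<Longrightarrow> p \<in> gpoly S \<Longrightarrow> (\<lambda>x. p x + q x) \<in> gpoly S"
proof (induction rule: gpoly.induct)
  case (add_monom q s a)
  from gpoly.add_monom[OF add_monom.IH[OF add_monom.prems] add_monom.hyps(2), of a]
  show ?case by (simp add: add.assoc)
qed simp

lemma gpoly_mult:
  assumes S: "\<And>s t. s \<in> S \<Longrightarrow> t \<in> S \<Longrightarrow> s + t \<in> S"
    and p: "p \<in> gpoly S" and q: "q \<in> gpoly S"
  shows "(\<lambda>x. p x * q x) \<in> gpoly S"
  using q
proof (induction rule: gpoly.induct)
  case zero then show ?case by (simp add: gpoly.zero)
next
  case (add_monom q t a)
  have "(\<lambda>x. p x * (a * x powr t)) \<in> gpoly S"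
    using p
  proof (induction rule: gpoly.induct)
    case zero then show ?case by (simp add: gpoly.zero)
  next
    case (add_monom p s c)
    have "(\<lambda>x. p x * (a * x powr t) + (c * a) * x powr (s + t)) \<in> gpoly S"
      by (intro gpoly.add_monom add_monom.IH S add_monom.hyps \<open>t \<in> S\<close>)
    then show ?case by (simp add: powr_add algebra_simps)
  qed
  from gpoly_add[OF this add_monom.IH] show ?case by (simp add: algebra_simps)
qed

lemma gpoly_representation:
  assumes "p \<in> gpoly S"
  obtains \<Lambda> a where "finite \<Lambda>" "\<Lambda> \<subseteq> S" "\<And>x. p x = (\<Sum>s\<in>\<Lambda>. a s * x powr s)"
  using assms
proof (induction arbitrary: thesis rule: gpoly.induct)
  case zero
  show ?case by (rule zero[of "{}"]) auto
next
  case (add_monom p s c)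
  obtain \<Lambda> a where L: "finite \<Lambda>" "\<Lambda> \<subseteq> S" "\<And>x. p x = (\<Sum>s\<in>\<Lambda>. a s * x powr s)"
    using add_monom.IH by blast
  define a' where "a' = (\<lambda>t. if t \<in> \<Lambda> then a t else 0)"
  show ?case
  proof (rule add_monom.prems[of "insert s \<Lambda>" "a'(s := a' s + c)"])
    fix x
    have "p x = (\<Sum>t\<in>insert s \<Lambda>. a' t * x powr t)"
      unfolding L(3) by (rule sum.mono_neutral_cong_left) (use L in \<open>auto simp: a'_def\<close>)
    also have "\<dots> = a' s * x powr s + (\<Sum>t\<in>insert s \<Lambda> - {s}. a' t * x powr t)"
      using L(1) by (intro sum.remove) auto
    finally have "p x + c * x powr s = (a'(s := a' s + c)) s * x powr s + (\<Sum>t\<in>insert s \<Lambda> - {s}. (a'(s := a' s + c)) t * x powr t)"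
      by (simp add: algebra_simps)
    also have "\<dots> = (\<Sum>t\<in>insert s \<Lambda>. (a'(s := a' s + c)) t * x powr t)"
      using L(1) by (intro sum.remove[symmetric]) auto
    finally show "p x + c * x powr s = (\<Sum>t\<in>insert s \<Lambda>. (a'(s := a' s + c)) t * x powr t)" .
  qed (use L add_monom.hyps in auto)
qed

text \<open>The tail of the binomial series is z^J times a series which, for |z| < 1/2, is bounded
  by its majorant at 1/2.\<close>

lemma binomial_remainder_bigo:
  fixes p :: real
  shows "(\<lambda>z. (1 + z) powr p - (\<Sum>j<J. (p gchoose j) * z ^ j)) \<in> O[nhds 0](\<lambda>z. z ^ J)"
proof -
  define C where "C = (\<Sum>j. \<bar>p gchoose (j + J)\<bar> * (1/2) ^ j)"
  have summ: "summable (\<lambda>j. \<bar>p gchoose (j + J)\<bar> * (1/2) ^ j)"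
  proof -
    have "summable (\<lambda>j. norm ((p gchoose j) * (1/2) ^ j))"
      by (rule powser_insidea[OF sums_summable[OF gen_binomial_real[of "3/4" p]]]) auto
    then have "summable (\<lambda>j. norm ((p gchoose (j + J)) * (1/2) ^ (j + J)))" by (subst summable_iff_shift)
    then have "summable (\<lambda>j. 2 ^ J * norm ((p gchoose (j + J)) * (1/2) ^ (j + J)))" by (rule summable_mult)
    then show ?thesis by (simp add: abs_mult power_add power_divide)
  qed
  have "\<bar>(1 + z) powr p - (\<Sum>j<J. (p gchoose j) * z ^ j)\<bar> \<le> C * \<bar>z ^ J\<bar>" if z: "\<bar>z\<bar> < 1/2" for z
  proof -
    have s: "(\<lambda>j. (p gchoose j) * z ^ j) sums (1 + z) powr p" by (rule gen_binomial_real) (use z in simp)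
    have eq: "(p gchoose (j + J)) * z ^ (j + J) = z ^ J * ((p gchoose (j + J)) * z ^ j)" for j by (simp add: power_add)
    have le: "norm ((p gchoose (j + J)) * z ^ j) \<le> \<bar>p gchoose (j + J)\<bar> * (1/2) ^ j" for j
      using z by (auto simp: abs_mult power_abs intro!: mult_left_mono power_mono)
    have summ2: "summable (\<lambda>j. (p gchoose (j + J)) * z ^ j)" by (rule summable_comparison_test'[OF summ le])
    have "(1 + z) powr p - (\<Sum>j<J. (p gchoose j) * z ^ j) = (\<Sum>j. (p gchoose (j + J)) * z ^ (j + J))"
      using suminf_minus_initial_segment[OF sums_summable[OF s], of J] sums_unique[OF s] by simp
    also have "\<dots> = z ^ J * (\<Sum>j. (p gchoose (j + J)) * z ^ j)" unfolding eq by (rule suminf_mult[OF summ2])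
    finally have "\<bar>(1 + z) powr p - (\<Sum>j<J. (p gchoose j) * z ^ j)\<bar> = \<bar>z ^ J\<bar> * \<bar>\<Sum>j. (p gchoose (j + J)) * z ^ j\<bar>"
      by (simp add: abs_mult)
    moreover have "\<bar>\<Sum>j. (p gchoose (j + J)) * z ^ j\<bar> \<le> C"
      unfolding C_def using norm_suminf_le[OF le summ] by simp
    then have "\<bar>z ^ J\<bar> * \<bar>\<Sum>j. (p gchoose (j + J)) * z ^ j\<bar> \<le> \<bar>z ^ J\<bar> * C" by (intro mult_left_mono) auto
    ultimately show ?thesis by (simp add: mult.commute)
  qed
  moreover have "\<forall>\<^sub>F z in nhds (0::real). \<bar>z\<bar> < 1/2"
    unfolding eventually_nhds_metric by (intro exI[of _ "1/2"]) (auto simp: dist_real_def)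
  ultimately show ?thesis
    by (intro bigoI[of _ C]) (auto elim!: eventually_mono)
qed

text \<open>A positive null sequence as scale and an additive monoid of nonnegative exponents:
  closure under addition of exponents is what makes truncated expansions stable under
  products.\<close>

locale power_scale =
  fixes S :: "real set" and x :: "nat \<Rightarrow> real"
  assumes S0: "0 \<in> S" and S_add: "\<And>s t. s \<in> S \<Longrightarrow> t \<in> S \<Longrightarrow> s + t \<in> S"
    and S_nonneg: "\<And>s. s \<in> S \<Longrightarrow> s \<ge> 0"
    and x_pos: "\<And>n. x n > 0" and x_lim: "x \<longlonglongrightarrow> 0"
begin

definition gexp :: "real \<Rightarrow> (nat \<Rightarrow> real) set" where
  "gexp N = {u. \<exists>p\<in>gpoly S. (\<lambda>n. u n - p (x n)) \<in> O(\<lambda>n. x n powr N)}"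

lemma x_at_right: "filterlim x (at_right 0) sequentially"
  using x_lim x_pos by (auto simp: filterlim_at less_imp_neq[OF x_pos, symmetric])

lemma powr_bigo:
  assumes "M \<le> N"
  shows "(\<lambda>n. x n powr N) \<in> O(\<lambda>n. x n powr M)"
proof (rule bigoI[of _ 1])
  have "\<forall>\<^sub>F n in sequentially. x n < 1" using x_lim by (rule order_tendstoD) simp
  then show "\<forall>\<^sub>F n in sequentially. norm (x n powr N) \<le> 1 * norm (x n powr M)"
  proof eventually_elim
    case (elim n)
    then show ?case using x_pos[of n] assms powr_mono'[of M N "x n"] by simp
  qed
qed

lemma powr_bigo_1: "N \<ge> 0 \<Longrightarrow> (\<lambda>n. x n powr N) \<in> O(\<lambda>_. 1)"
proof -
  assume "N \<ge> 0"
  have "(\<lambda>n. x n powr 0) \<in> O(\<lambda>_. 1)" using x_pos by (simp add: less_imp_neq[symmetric])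
  with powr_bigo[OF \<open>N \<ge> 0\<close>] show ?thesis by (rule landau_o.big.trans)
qed

lemma gpoly_bigo_1: "p \<in> gpoly S \<Longrightarrow> (\<lambda>n. p (x n)) \<in> O(\<lambda>_. 1)"
proof (induction rule: gpoly.induct)
  case (add_monom p s a)
  have "(\<lambda>n. a * x n powr s) \<in> O(\<lambda>_. 1)"
    using powr_bigo_1[OF S_nonneg[OF add_monom.hyps(2)]] by (cases "a = 0") auto
  with add_monom.IH show ?case by (rule sum_in_bigo)
qed simp

lemma gexpI: "p \<in> gpoly S \<Longrightarrow> (\<lambda>n. u n - p (x n)) \<in> O(\<lambda>n. x n powr N) \<Longrightarrow> u \<in> gexp N"
  unfolding gexp_def by blast

lemma gexp_bigo_1: "u \<in> gexp N \<Longrightarrow> N \<ge> 0 \<Longrightarrow> u \<in> O(\<lambda>_. 1)"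
proof -
  assume "u \<in> gexp N" and N: "N \<ge> 0"
  then obtain p where p: "p \<in> gpoly S" "(\<lambda>n. u n - p (x n)) \<in> O(\<lambda>n. x n powr N)" by (auto simp: gexp_def)
  have "(\<lambda>n. (u n - p (x n)) + p (x n)) \<in> O(\<lambda>_. 1)"
    by (intro sum_in_bigo landau_o.big.trans[OF p(2) powr_bigo_1[OF N]] gpoly_bigo_1 p)
  then show ?thesis by simp
qed

lemma gexp_bigo: "u \<in> O(\<lambda>n. x n powr N) \<Longrightarrow> u \<in> gexp N"
  by (rule gexpI[OF gpoly.zero]) simp

lemma gexp_mono: "u \<in> gexp N \<Longrightarrow> M \<le> N \<Longrightarrow> u \<in> gexp M"
  unfolding gexp_def using landau_o.big.trans[OF _ powr_bigo] by blast

lemma gexp_cong: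
  assumes "u \<in> gexp N" "\<forall>\<^sub>F n in sequentially. u n = v n"
  shows "v \<in> gexp N"
proof -
  obtain p where p: "p \<in> gpoly S" "(\<lambda>n. u n - p (x n)) \<in> O(\<lambda>n. x n powr N)" using assms(1) by (auto simp: gexp_def)
  have "(\<lambda>n. u n - p (x n)) \<in> O(\<lambda>n. x n powr N) \<longleftrightarrow> (\<lambda>n. v n - p (x n)) \<in> O(\<lambda>n. x n powr N)"
    by (rule landau_o.big.in_cong) (use assms(2) in \<open>auto elim!: eventually_mono\<close>)
  then show ?thesis using gexpI[OF p(1)] p(2) by blast
qed

lemma gexp_const: "(\<lambda>_. a) \<in> gexp N"
  by (rule gexpI[OF gpoly_monom[OF S0, of a]]) (use x_pos in \<open>auto simp: less_imp_neq[symmetric]\<close>)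

lemma gexp_add: "u \<in> gexp N \<Longrightarrow> v \<in> gexp N \<Longrightarrow> (\<lambda>n. u n + v n) \<in> gexp N"
proof -
  assume "u \<in> gexp N" "v \<in> gexp N"
  then obtain p q where p: "p \<in> gpoly S" "(\<lambda>n. u n - p (x n)) \<in> O(\<lambda>n. x n powr N)"
    and q: "q \<in> gpoly S" "(\<lambda>n. v n - q (x n)) \<in> O(\<lambda>n. x n powr N)" by (auto simp: gexp_def)
  have "(\<lambda>n. (u n - p (x n)) + (v n - q (x n))) \<in> O(\<lambda>n. x n powr N)" by (rule sum_in_bigo(1)[OF p(2) q(2)])
  then show ?thesis by (intro gexpI[OF gpoly_add[OF q(1) p(1)]]) (simp add: algebra_simps)
qed

lemma gexp_mult:
  assumes N: "N \<ge> 0" and u: "u \<in> gexp N" and v: "v \<in> gexp N"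
  shows "(\<lambda>n. u n * v n) \<in> gexp N"
proof -
  obtain p q where p: "p \<in> gpoly S" "(\<lambda>n. u n - p (x n)) \<in> O(\<lambda>n. x n powr N)"
    and q: "q \<in> gpoly S" "(\<lambda>n. v n - q (x n)) \<in> O(\<lambda>n. x n powr N)" using u v by (auto simp: gexp_def)
  have "(\<lambda>n. u n * (v n - q (x n))) \<in> O(\<lambda>n. 1 * x n powr N)"
    by (rule landau_o.big.mult[OF gexp_bigo_1[OF u N] q(2)])
  moreover have "(\<lambda>n. (u n - p (x n)) * q (x n)) \<in> O(\<lambda>n. x n powr N * 1)"
    by (rule landau_o.big.mult[OF p(2) gpoly_bigo_1[OF q(1)]])
  ultimately have "(\<lambda>n. u n * (v n - q (x n)) + (u n - p (x n)) * q (x n)) \<in> O(\<lambda>n. x n powr N)"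
    by (intro sum_in_bigo) simp_all
  then show ?thesis by (intro gexpI[OF gpoly_mult[OF S_add p(1) q(1)]]) (simp_all add: algebra_simps)
qed

lemma gexp_sum: "(\<And>k. k \<in> I \<Longrightarrow> u k \<in> gexp N) \<Longrightarrow> (\<lambda>n. \<Sum>k\<in>I. u k n) \<in> gexp N"
  by (induction I rule: infinite_finite_induct) (auto intro: gexp_const gexp_add)

lemma gexp_power: "N \<ge> 0 \<Longrightarrow> u \<in> gexp N \<Longrightarrow> (\<lambda>n. u n ^ j) \<in> gexp N"
  by (induction j) (auto intro: gexp_const gexp_mult)

text \<open>Multiplication with a power of the scale gains \<open>s\<close> in the order of the
  error. This gain drives the induction in \<open>saddle_tail_expansion\<close>.\<close>

lemma gexp_shift:
  assumes s: "s \<in> S" and u: "u \<in> gexp N"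
  shows "(\<lambda>n. x n powr s * u n) \<in> gexp (N + s)"
proof -
  obtain p where p: "p \<in> gpoly S" "(\<lambda>n. u n - p (x n)) \<in> O(\<lambda>n. x n powr N)" using u by (auto simp: gexp_def)
  have "(\<lambda>n. x n powr s * (u n - p (x n))) \<in> O(\<lambda>n. x n powr s * x n powr N)"
    by (rule landau_o.big.mult_left[OF p(2)])
  then show ?thesis
    by (intro gexpI[OF gpoly_mult[OF S_add gpoly_monom[OF s, of 1] p(1)]])
       (simp_all add: powr_add algebra_simps)
qed

text \<open>After C is factored out, the binomial series in \<open>y / C\<close> is cut after J
  terms. As \<open>y\<close> is O(x^e), the remainder is O(x^(J e)), and J is taken with J e >=
  N.\<close>

lemma gexp_powr:
  assumes N: "N \<ge> 0" and C: "C > 0" and e: "e > 0"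
    and y: "y \<in> gexp N" "y \<in> O(\<lambda>n. x n powr e)"
  shows "(\<lambda>n. (C + y n) powr p) \<in> gexp N"
proof -
  define J where "J = nat \<lceil>N / e\<rceil>"
  have "N / e \<le> real J" by (simp add: J_def real_nat_ceiling_ge)
  then have J: "N \<le> real J * e" using e by (simp add: pos_divide_le_eq)
  define z where "z n = y n / C" for n
  have zO: "z \<in> O(\<lambda>n. x n powr e)" using y(2) C by (simp add: z_def[abs_def])
  have ze: "z \<in> gexp N"
    using gexp_mult[OF N gexp_const[of "1 / C"] y(1)] by (simp add: z_def[abs_def])
  have "(\<lambda>n. x n powr e) \<longlonglongrightarrow> 0"
  proof -
    have "((\<lambda>t::real. t powr e) \<longlongrightarrow> 0) (at_right 0)" using e by real_asymp
    then show ?thesis by (rule filterlim_compose[OF _ x_at_right])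
  qed
  then have "(\<lambda>n. x n powr e) \<in> o(\<lambda>_. 1)" by (intro smalloI_tendsto) auto
  with zO have "z \<in> o(\<lambda>_. 1)" by (rule landau_o.big_small_trans)
  then have z0: "z \<longlonglongrightarrow> 0" using smalloD_tendsto by fastforce
  define w where "w n = (1 + z n) powr p - (\<Sum>j<J. (p gchoose j) * z n ^ j)" for n
  have "w \<in> O(\<lambda>n. z n ^ J)"
    unfolding w_def[abs_def] by (rule landau_o.big.compose[OF binomial_remainder_bigo z0])
  also have "(\<lambda>n. z n ^ J) \<in> O(\<lambda>n. (x n powr e) ^ J)" by (rule landau_o.big_power[OF zO])
  also have "(\<lambda>n. (x n powr e) ^ J) = (\<lambda>n. x n powr (real J * e))"
  proof
    fix n
    have "x n powr e > 0" using x_pos[of n] by simp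
    then have "(x n powr e) ^ J = (x n powr e) powr real J" by (rule powr_realpow[symmetric])
    then show "(x n powr e) ^ J = x n powr (real J * e)" by (simp add: powr_powr mult.commute)
  qed
  also have "\<dots> \<in> O(\<lambda>n. x n powr N)" by (rule powr_bigo[OF J])
  finally have w: "w \<in> gexp N" by (rule gexp_bigo)
  have "(\<lambda>n. C powr p * (w n + (\<Sum>j<J. (p gchoose j) * z n ^ j))) \<in> gexp N"
    by (intro gexp_mult gexp_add gexp_sum gexp_power gexp_const w ze N)
  moreover have "\<forall>\<^sub>F n in sequentially. C powr p * (w n + (\<Sum>j<J. (p gchoose j) * z n ^ j)) = (C + y n) powr p"
  proof -
    have "\<forall>\<^sub>F n in sequentially. z n > -1" using z0 by (rule order_tendstoD) simp
    then show ?thesis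
    proof eventually_elim
      case (elim n)
      have "C + y n = C * (1 + z n)" using C by (simp add: z_def field_simps)
      then show ?case using elim C by (simp add: w_def powr_mult)
    qed
  qed
  ultimately show ?thesis by (rule gexp_cong)
qed

end

section \<open>Expansion at the saddle point\<close>

context meinardus
begin

text \<open>The sums start at k = 1: the main part has no constant term, so the gap
  \<open>\<rho> r - \<rho> 0\<close> does not arise in the saddle point equation. For r = 1 the set
  is {0}.\<close>

definition exps :: "real set" where
  "exps = {\<Sum>k\<in>{1..<r}. real (d k) * (\<rho> r - \<rho> k) | d :: nat \<Rightarrow> nat. True}"

lemma exps_0: "0 \<in> exps"
  unfolding exps_def by (auto intro!: exI[of _ "\<lambda>_. 0"])

lemma exps_add: "s \<in> exps \<Longrightarrow> t \<in> exps \<Longrightarrow> s + t \<in> exps"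
proof -
  assume "s \<in> exps" "t \<in> exps"
  then obtain d d' :: "nat \<Rightarrow> nat" where "s = (\<Sum>k\<in>{1..<r}. real (d k) * (\<rho> r - \<rho> k))"
    "t = (\<Sum>k\<in>{1..<r}. real (d' k) * (\<rho> r - \<rho> k))" by (auto simp: exps_def)
  then have "s + t = (\<Sum>k\<in>{1..<r}. real (d k + d' k) * (\<rho> r - \<rho> k))"
    by (simp add: sum.distrib distrib_right)
  then show ?thesis unfolding exps_def by (intro CollectI exI[of _ "\<lambda>k. d k + d' k"]) simp
qed

lemma exps_nonneg: "s \<in> exps \<Longrightarrow> s \<ge> 0"
  unfolding exps_def using rho_le by (auto intro!: sum_nonneg mult_nonneg_nonneg)

lemma gap_in_exps: "l \<in> {1..r} \<Longrightarrow> \<rho> r - \<rho> l \<in> exps"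
proof (cases "l = r")
  case True then show ?thesis using exps_0 by simp
next
  case False
  assume "l \<in> {1..r}"
  then have "(\<Sum>k\<in>{1..<r}. real (if k = l then 1 else 0) * (\<rho> r - \<rho> k)) = \<rho> r - \<rho> l"
    using False by (simp add: if_distrib[of real] if_distrib[of "\<lambda>z. z * _"] sum.delta cong: if_cong)
  then show ?thesis unfolding exps_def by (intro CollectI exI[of _ "\<lambda>k. if k = l then 1 else 0"]) simp
qed

text \<open>Coefficients with total at least 2 lead into \<open>Upsilon_tilde\<close>, total 1 gives
  a single gap, and total 0 would mean s = 0. They are extended by 0 at k = 0, where the sums for
  \<open>Upsilon\<close> begin.\<close>

lemma exps_Upsilon:
  assumes "s \<in> exps" "0 < s" "s \<le> \<rho> r"
  shows "s \<in> Upsilon r \<rho>"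
proof -
  obtain d :: "nat \<Rightarrow> nat" where s: "s = (\<Sum>k\<in>{1..<r}. real (d k) * (\<rho> r - \<rho> k))"
    using assms by (auto simp: exps_def)
  define d' where "d' k = (if k = 0 then 0 else d k)" for k
  have split: "{..<r} = insert 0 {1..<r}" using r_pos by auto
  have s': "s = (\<Sum>k<r. real (d' k) * (\<rho> r - \<rho> k))" unfolding s split by (simp add: d'_def)
  show ?thesis
  proof (cases "(\<Sum>k<r. d' k) \<ge> 2")
    case True
    then have "s \<in> Upsilon_tilde r \<rho>" unfolding Upsilon_tilde_def using s' assms by auto
    then show ?thesis by (simp add: Upsilon_def)
  next
    case False
    have "(\<Sum>k<r. d' k) \<noteq> 0"
    proof
      assume "(\<Sum>k<r. d' k) = 0"
      then have "\<forall>k<r. d' k = 0" by simp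
      then have "s = 0" unfolding s' by (intro sum.neutral) auto
      then show False using assms by simp
    qed
    then have "(\<Sum>k<r. d' k) = 1" using False by linarith
    then obtain k where k: "k < r" "d' k = 1" "\<And>j. j < r \<Longrightarrow> j \<noteq> k \<Longrightarrow> d' j = 0"
      by (subst (asm) sum_eq_1_iff) auto
    have "s = real (d' k) * (\<rho> r - \<rho> k)"
      unfolding s' by (subst sum.remove[of _ k]) (use k in \<open>auto intro!: sum.neutral\<close>)
    then show ?thesis using k by (auto simp: Upsilon_def)
  qed
qed

text \<open>The value at \<open>n = 0\<close> is immaterial; \<open>max n 1\<close> only makes the saddle point exist for every index.\<close>

definition \<Delta> :: "nat \<Rightarrow> real" where
  "\<Delta> n = (SOME \<delta>. \<delta> > 0 \<and> main_deriv \<delta> = real (max n 1))"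

lemma \<Delta>: "\<Delta> n > 0" "main_deriv (\<Delta> n) = real (max n 1)"
proof -
  have "\<exists>\<delta>. \<delta> > 0 \<and> main_deriv \<delta> = real (max n 1)"
    using saddle_point_exists[of "real (max n 1)"] by auto
  from someI_ex[OF this] show "\<Delta> n > 0" "main_deriv (\<Delta> n) = real (max n 1)" unfolding \<Delta>_def by auto
qed

lemma h_nonneg: "l \<in> {1..r} \<Longrightarrow> h i l \<ge> 0"
  using h_pos less_imp_le by blast

text \<open>\<open>main_deriv\<close> decreases, so \<Delta> n >= a would force n <=
  \<open>main_deriv a\<close>.\<close>

lemma \<Delta>_lim: "\<Delta> \<longlonglongrightarrow> 0"
proof (rule order_tendstoI)
  fix a :: real assume "a < 0"
  then show "\<forall>\<^sub>F n in sequentially. a < \<Delta> n" using \<Delta>(1) by (auto intro!: always_eventually intro: order.strict_trans)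
next
  fix a :: real assume a: "0 < a"
  show "\<forall>\<^sub>F n in sequentially. \<Delta> n < a"
    using eventually_gt_at_top[of "nat \<lceil>main_deriv a\<rceil>"]
  proof eventually_elim
    case (elim n)
    show ?case
    proof (rule ccontr)
      assume "\<not> \<Delta> n < a"
      then have "main_deriv (\<Delta> n) \<le> main_deriv a"
        unfolding main_deriv_def
      proof (intro sum_mono)
        fix l assume l: "l \<in> {1..r}"
        show "\<rho> l * h i l * \<Delta> n powr (- \<rho> l - 1) \<le> \<rho> l * h i l * a powr (- \<rho> l - 1)"
          using \<open>\<not> \<Delta> n < a\<close> a rho_pos[OF l] h_nonneg[OF l] by (intro mult_left_mono powr_mono2') auto
      qed
      then have "real (max n 1) \<le> main_deriv a" by (simp only: \<Delta>(2))
      then show False using elim by linarith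
    qed
  qed
qed

lemma \<Delta>_at_right: "filterlim \<Delta> (at_right 0) sequentially"
  using \<Delta>_lim \<Delta>(1) by (auto simp: filterlim_at less_imp_neq[OF \<Delta>(1), symmetric])

definition \<xi> :: "nat \<Rightarrow> real" where
  "\<xi> n = real (max n 1) powr (- 1 / (\<rho> r + 1))"

lemma \<xi>_pos: "\<xi> n > 0" by (simp add: \<xi>_def)

lemma \<xi>_lim: "\<xi> \<longlonglongrightarrow> 0"
proof -
  have "(\<lambda>n. real n powr (- 1 / (\<rho> r + 1))) \<longlonglongrightarrow> 0" using rho_r_pos by real_asymp
  moreover have "\<forall>\<^sub>F n in sequentially. real n powr (- 1 / (\<rho> r + 1)) = \<xi> n"
    using eventually_ge_at_top[of 1] by eventually_elim (simp add: \<xi>_def max_def)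
  ultimately show ?thesis by (rule Lim_transform_eventually)
qed

lemma \<xi>_powr: "\<xi> n powr (- (\<rho> r + 1)) = real (max n 1)"
proof -
  have "- 1 / (\<rho> r + 1) * (- (\<rho> r + 1)) = 1" using rho_r_pos by (simp add: field_simps)
  then show ?thesis unfolding \<xi>_def powr_powr by simp
qed

definition saddle_tail :: "nat \<Rightarrow> real" where
  "saddle_tail n = (\<Sum>l\<in>{1..<r}. \<rho> l * h i l * \<Delta> n powr (\<rho> r - \<rho> l))"

definition saddle_lead :: real where "saddle_lead = \<rho> r * h i r"

lemma saddle_lead_pos: "saddle_lead > 0"
  using rho_r_pos h_pos[OF r_in, of i] by (simp add: saddle_lead_def)

lemma saddle_equation: "(\<Delta> n / \<xi> n) powr (\<rho> r + 1) = saddle_lead + saddle_tail n"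
proof -
  have split: "{1..r} = insert r {1..<r}" using r_pos by auto
  have "(\<Delta> n / \<xi> n) powr (\<rho> r + 1) = \<Delta> n powr (\<rho> r + 1) * real (max n 1)"
    unfolding \<xi>_powr[symmetric] powr_minus_divide using \<Delta>(1)[of n] \<xi>_pos[of n] by (simp add: powr_divide)
  also have "\<dots> = (\<Sum>l=1..r. \<rho> l * h i l * \<Delta> n powr (\<rho> r - \<rho> l))"
    unfolding \<Delta>(2)[symmetric] main_deriv_def sum_distrib_left
    by (intro sum.cong) (simp_all add: mult.left_commute[of "\<Delta> n powr _"] flip: powr_add)
  also have "\<dots> = saddle_lead + saddle_tail n"
    unfolding split using \<Delta>(1)[of n] by (simp add: saddle_lead_def saddle_tail_def)
  finally show ?thesis .
qed

text \<open>All powers of \<Delta> reduce to powers of the scale \<xi> and of the one sequence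
  \<open>saddle_lead + saddle_tail n\<close>, to which \<open>gexp_powr\<close> applies.\<close>

lemma \<Delta>_powr: "\<Delta> n powr q = \<xi> n powr q * (saddle_lead + saddle_tail n) powr (q / (\<rho> r + 1))"
proof -
  have "(saddle_lead + saddle_tail n) powr (q / (\<rho> r + 1)) = (\<Delta> n / \<xi> n) powr q"
    unfolding saddle_equation[symmetric] powr_powr using rho_r_pos by simp
  then show ?thesis using \<Delta>(1)[of n] \<xi>_pos[of n] by (simp add: powr_divide)
qed

lemma saddle_tail_lim: "saddle_tail \<longlonglongrightarrow> 0"
proof -
  have "(\<lambda>n. \<Delta> n powr (\<rho> r - \<rho> l)) \<longlonglongrightarrow> 0" if "l \<in> {1..<r}" for l
  proof -
    have "\<rho> r - \<rho> l > 0" using rho_less[of l r] that by auto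
    then have "((\<lambda>t::real. t powr (\<rho> r - \<rho> l)) \<longlongrightarrow> 0) (at_right 0)" by real_asymp
    then show ?thesis by (rule filterlim_compose[OF _ \<Delta>_at_right])
  qed
  then have "(\<lambda>n. \<Sum>l\<in>{1..<r}. \<rho> l * h i l * \<Delta> n powr (\<rho> r - \<rho> l)) \<longlonglongrightarrow> (\<Sum>l\<in>{1..<r}. \<rho> l * h i l * 0)"
    by (intro tendsto_sum tendsto_mult tendsto_const) auto
  then show ?thesis by (simp add: saddle_tail_def[abs_def])
qed

lemma \<Delta>_powr_lim: "(\<lambda>n. \<Delta> n powr q / \<xi> n powr q) \<longlonglongrightarrow> saddle_lead powr (q / (\<rho> r + 1))"
proof -
  have "(\<lambda>n. (saddle_lead + saddle_tail n) powr (q / (\<rho> r + 1))) \<longlonglongrightarrow> (saddle_lead + 0) powr (q / (\<rho> r + 1))"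
    using saddle_lead_pos by (intro tendsto_intros saddle_tail_lim) auto
  moreover have "\<Delta> n powr q / \<xi> n powr q = (saddle_lead + saddle_tail n) powr (q / (\<rho> r + 1))" for n
    unfolding \<Delta>_powr using \<xi>_pos[of n] by simp
  ultimately show ?thesis by simp
qed

sublocale power_scale exps \<xi>
  by unfold_locales (auto intro: exps_0 exps_add exps_nonneg \<xi>_pos \<xi>_lim)

text \<open>The smallest gap, hence the guaranteed gain of one substitution. For r = 1 it is
  \<open>\<rho> 1\<close> and \<open>saddle_tail\<close> is an empty sum, so this case runs through
  the same induction.\<close>

definition last_gap :: real where "last_gap = \<rho> r - \<rho> (r - 1)"

lemma last_gap_pos: "last_gap > 0"
  using rho_less[of "r - 1" r] r_pos by (simp add: last_gap_def)

lemma last_gap_le: "l \<in> {1..<r} \<Longrightarrow> last_gap \<le> \<rho> r - \<rho> l"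
proof -
  assume "l \<in> {1..<r}"
  then consider "l = r - 1" | "l < r - 1" "r - 1 \<le> r" by fastforce
  then show ?thesis using rho_less[of l "r - 1"] by cases (auto simp: last_gap_def)
qed

lemma saddle_tail_bigo: "saddle_tail \<in> O(\<lambda>n. \<xi> n powr last_gap)"
  unfolding saddle_tail_def[abs_def]
proof (intro big_sum_in_bigo)
  fix l assume l: "l \<in> {1..<r}"
  have "(\<lambda>n. \<rho> l * h i l * \<Delta> n powr (\<rho> r - \<rho> l)) \<in> O(\<lambda>n. \<Delta> n powr (\<rho> r - \<rho> l))" by simp
  also have "(\<lambda>n. \<Delta> n powr (\<rho> r - \<rho> l)) \<in> O(\<lambda>n. \<xi> n powr (\<rho> r - \<rho> l))"
    using \<xi>_pos \<Delta>_powr_lim[of "\<rho> r - \<rho> l"] by (intro bigoI_tendsto) (auto simp: less_imp_neq[symmetric])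
  also note powr_bigo[OF last_gap_le[OF l]]
  finally show "(\<lambda>n. \<rho> l * h i l * \<Delta> n powr (\<rho> r - \<rho> l)) \<in> O(\<lambda>n. \<xi> n powr last_gap)" .
qed

lemma saddle_tail_expansion: "saddle_tail \<in> gexp N"
proof -
  define m where "m = last_gap"
  note m = last_gap_pos[folded m_def] and m_le = last_gap_le[folded m_def] and tailO = saddle_tail_bigo[folded m_def]
  \<comment> \<open>Each round inserts the expansion of order k m into the powers
    \<open>\<Delta> n powr (\<rho> r - \<rho> l)\<close> with l < r; the prefactor
    \<open>\<xi> n powr (\<rho> r - \<rho> l)\<close> raises the order by at least m.\<close>
  have step: "saddle_tail \<in> gexp (real k * m)" for k
  proof (induction k)
    case 0
    show ?case
      using gexp_bigo[OF landau_o.big.trans[OF tailO powr_bigo[of 0 m]]] m by simp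
  next
    case (Suc k)
    have "(\<lambda>n. \<rho> l * h i l * \<Delta> n powr (\<rho> r - \<rho> l)) \<in> gexp (real (Suc k) * m)" if l: "l \<in> {1..<r}" for l
    proof -
      have g: "\<rho> r - \<rho> l \<in> exps" using l by (intro gap_in_exps) auto
      have "(\<lambda>n. (saddle_lead + saddle_tail n) powr ((\<rho> r - \<rho> l) / (\<rho> r + 1))) \<in> gexp (real k * m)"
        using m by (intro gexp_powr[OF _ saddle_lead_pos m Suc.IH tailO]) auto
      then have "(\<lambda>n. \<rho> l * h i l * (saddle_lead + saddle_tail n) powr ((\<rho> r - \<rho> l) / (\<rho> r + 1))) \<in> gexp (real k * m)"
        using m by (intro gexp_mult gexp_const) auto
      from gexp_shift[OF g this]
      have "(\<lambda>n. \<rho> l * h i l * \<Delta> n powr (\<rho> r - \<rho> l)) \<in> gexp (real k * m + (\<rho> r - \<rho> l))"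
        unfolding \<Delta>_powr by (simp add: mult_ac)
      then show ?thesis by (rule gexp_mono) (use m_le[OF l] in \<open>simp add: algebra_simps\<close>)
    qed
    then show ?case unfolding saddle_tail_def[abs_def] by (intro gexp_sum)
  qed
  have "N / m \<le> real (nat \<lceil>N / m\<rceil>)" by (rule real_nat_ceiling_ge)
  then have "N \<le> real (nat \<lceil>N / m\<rceil>) * m" using m by (simp add: pos_divide_le_eq)
  with step show ?thesis by (rule gexp_mono)
qed

definition saddle_value :: "nat \<Rightarrow> real" where
  "saddle_value n = real n * \<Delta> n + main_part i (\<Delta> n)"

lemma saddle_value_expansion:
  obtains \<Lambda> a where "finite \<Lambda>" "\<Lambda> \<subseteq> exps"
    "(\<lambda>n. saddle_value n - (\<Sum>s\<in>\<Lambda>. a s * \<xi> n powr (s - \<rho> r))) \<longlonglongrightarrow> 0"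
proof -
  \<comment> \<open>For n >= 1 this is \<open>saddle_value n\<close> times
    \<open>\<xi> n powr \<rho> r\<close>, which brings all exponents into \<open>exps\<close>. The
    order \<open>\<rho> r + 1\<close> leaves an error O(\<xi>) once that factor is removed.\<close>
  define W where "W n = (saddle_lead + saddle_tail n) powr (1 / (\<rho> r + 1))
     + (\<Sum>l\<in>{1..r}. \<xi> n powr (\<rho> r - \<rho> l) * (h i l * (saddle_lead + saddle_tail n) powr (- \<rho> l / (\<rho> r + 1))))" for n
  let ?N = "\<rho> r + 1"
  have N: "?N \<ge> 0" using rho_r_pos by simp
  have pw: "(\<lambda>n. (saddle_lead + saddle_tail n) powr q) \<in> gexp ?N" for q
    by (rule gexp_powr[OF N saddle_lead_pos last_gap_pos saddle_tail_expansion saddle_tail_bigo])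
  have "W \<in> gexp ?N"
    unfolding W_def[abs_def]
  proof (intro gexp_add gexp_sum pw)
    fix l assume l: "l \<in> {1..r}"
    have "(\<lambda>n. \<xi> n powr (\<rho> r - \<rho> l) * (h i l * (saddle_lead + saddle_tail n) powr (- \<rho> l / (\<rho> r + 1)))) \<in> gexp (?N + (\<rho> r - \<rho> l))"
      by (intro gexp_shift gap_in_exps l gexp_mult N gexp_const pw)
    then show "(\<lambda>n. \<xi> n powr (\<rho> r - \<rho> l) * (h i l * (saddle_lead + saddle_tail n) powr (- \<rho> l / (\<rho> r + 1)))) \<in> gexp ?N"
      by (rule gexp_mono) (use rho_le[of l] l in auto)
  qed
  then obtain p where p: "p \<in> gpoly exps" "(\<lambda>n. W n - p (\<xi> n)) \<in> O(\<lambda>n. \<xi> n powr ?N)"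
    unfolding gexp_def by blast
  obtain \<Lambda> a where L: "finite \<Lambda>" "\<Lambda> \<subseteq> exps" "\<And>x. p x = (\<Sum>s\<in>\<Lambda>. a s * x powr s)"
    using gpoly_representation[OF p(1)] by blast
  have "(\<lambda>n. \<xi> n powr (- \<rho> r) * (W n - p (\<xi> n))) \<in> O(\<lambda>n. \<xi> n powr (- \<rho> r) * \<xi> n powr ?N)"
    by (rule landau_o.big.mult_left[OF p(2)])
  also have "(\<lambda>n. \<xi> n powr (- \<rho> r) * \<xi> n powr ?N) = \<xi>"
    unfolding powr_add[symmetric] using \<xi>_pos by (simp add: less_imp_le)
  also have "\<xi> \<in> o(\<lambda>_. 1)" using \<xi>_lim by (intro smalloI_tendsto) auto
  finally have "(\<lambda>n. \<xi> n powr (- \<rho> r) * (W n - p (\<xi> n))) \<in> o(\<lambda>_. 1)" .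
  then have lim: "(\<lambda>n. \<xi> n powr (- \<rho> r) * (W n - p (\<xi> n))) \<longlonglongrightarrow> 0" using smalloD_tendsto by fastforce
  have "\<forall>\<^sub>F n in sequentially. \<xi> n powr (- \<rho> r) * (W n - p (\<xi> n)) = saddle_value n - (\<Sum>s\<in>\<Lambda>. a s * \<xi> n powr (s - \<rho> r))"
    using eventually_ge_at_top[of 1]
  proof eventually_elim
    case (elim n)
    have "real n = \<xi> n powr (- (\<rho> r + 1))" using elim by (simp only: \<xi>_powr max_absorb1)
    moreover have "\<Delta> n = \<xi> n * (saddle_lead + saddle_tail n) powr (1 / (\<rho> r + 1))"
      using \<Delta>_powr[of n 1] \<Delta>(1)[of n] \<xi>_pos[of n] by simp
    moreover have "\<xi> n powr (- (\<rho> r + 1)) * \<xi> n = \<xi> n powr (- \<rho> r)"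
      using powr_add[of "\<xi> n" "- (\<rho> r + 1)" 1] \<xi>_pos[of n] by simp
    ultimately have 1: "real n * \<Delta> n = \<xi> n powr (- \<rho> r) * (saddle_lead + saddle_tail n) powr (1 / (\<rho> r + 1))"
      by (simp only: mult.assoc[symmetric])
    have 2: "main_part i (\<Delta> n) = \<xi> n powr (- \<rho> r) * (\<Sum>l\<in>{1..r}. \<xi> n powr (\<rho> r - \<rho> l) * (h i l * (saddle_lead + saddle_tail n) powr (- \<rho> l / (\<rho> r + 1))))"
      unfolding main_part_def sum_distrib_left
    proof (intro sum.cong refl)
      fix l
      have "\<xi> n powr (- \<rho> l) = \<xi> n powr (- \<rho> r) * \<xi> n powr (\<rho> r - \<rho> l)" unfolding powr_add[symmetric] by simp
      then show "h i l * \<Delta> n powr (- \<rho> l) = \<xi> n powr (- \<rho> r) * (\<xi> n powr (\<rho> r - \<rho> l) * (h i l * (saddle_lead + saddle_tail n) powr (- \<rho> l / (\<rho> r + 1))))"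
        unfolding \<Delta>_powr[of n "- \<rho> l"] by (simp only: mult_ac)
    qed
    have 3: "\<xi> n powr (- \<rho> r) * p (\<xi> n) = (\<Sum>s\<in>\<Lambda>. a s * \<xi> n powr (s - \<rho> r))"
      unfolding L(3) sum_distrib_left
      by (intro sum.cong refl) (simp add: powr_add[symmetric] mult.left_commute)
    show ?case unfolding saddle_value_def 1 2 right_diff_distrib 3 W_def by (simp add: distrib_left)
  qed
  with lim have "(\<lambda>n. saddle_value n - (\<Sum>s\<in>\<Lambda>. a s * \<xi> n powr (s - \<rho> r))) \<longlonglongrightarrow> 0"
    by (rule Lim_transform_eventually)
  with L that show ?thesis by blast
qed

end

section \<open>The main theorem\<close>

text \<open>Each coefficient is at most (\<rho>_r + 1) / m, where m is a positive lower bound of the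
  gaps, so finitely many tuples produce all elements.\<close>

lemma finite_Upsilon:
  assumes gap: "\<And>k. k < r \<Longrightarrow> \<rho> k < \<rho> r"
  shows "finite (Upsilon r \<rho>)"
proof -
  \<comment> \<open>The inserted 1 keeps the minimum meaningful when there are no gaps.\<close>
  define m where "m = Min (insert 1 ((\<lambda>k. \<rho> r - \<rho> k) ` {..<r}))"
  have m: "m > 0" unfolding m_def using gap by (subst Min_gr_iff) auto
  have m_le: "m \<le> \<rho> r - \<rho> k" if "k < r" for k unfolding m_def using that by (intro Min_le) auto
  define N where "N = nat \<lceil>(\<rho> r + 1) / m\<rceil>"
  have "Upsilon_tilde r \<rho> \<subseteq> (\<lambda>d. \<Sum>k<r. real (d k) * (\<rho> r - \<rho> k)) ` (\<Pi>\<^sub>E k\<in>{..<r}. {..N})"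
  proof
    fix s assume "s \<in> Upsilon_tilde r \<rho>"
    then obtain d :: "nat \<Rightarrow> nat" where s: "s = (\<Sum>k<r. real (d k) * (\<rho> r - \<rho> k))" "s \<le> \<rho> r + 1"
      by (auto simp: Upsilon_tilde_def)
    have "d k \<le> N" if "k < r" for k
    proof -
      have "real (d k) * m \<le> real (d k) * (\<rho> r - \<rho> k)" using m_le[OF that] by (intro mult_left_mono) auto
      also have "\<dots> \<le> s" unfolding s(1) using that gap
        by (intro member_le_sum[where f = "\<lambda>k. real (d k) * (\<rho> r - \<rho> k)"]) (auto intro!: mult_nonneg_nonneg simp: less_imp_le)
      finally have "real (d k) \<le> (\<rho> r + 1) / m" using m s(2) by (simp add: pos_le_divide_eq)
      then show ?thesis unfolding N_def by linarith
    qed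
    then show "s \<in> (\<lambda>d. \<Sum>k<r. real (d k) * (\<rho> r - \<rho> k)) ` (\<Pi>\<^sub>E k\<in>{..<r}. {..N})"
      unfolding s(1) by (intro image_eqI[of _ _ "restrict d {..<r}"]) auto
  qed
  then have "finite (Upsilon_tilde r \<rho>)"
    by (rule finite_subset) (intro finite_imageI finite_PiE, auto)
  moreover have "{\<rho> r - \<rho> k | k. k < r} = (\<lambda>k. \<rho> r - \<rho> k) ` {..<r}" by auto
  ultimately show ?thesis by (simp add: Upsilon_def)
qed

lemma bij_betw_lam:
  assumes "finite (Upsilon r \<rho>)"
  shows "bij_betw (lam r \<rho>) {1..card (Upsilon r \<rho>)} (Upsilon r \<rho>)"
proof -
  let ?L = "sorted_list_of_set (Upsilon r \<rho>)"
  have "bij_betw ((!) ?L) {..<length ?L} (set ?L)" by (rule bij_betw_nth) auto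
  then have 1: "bij_betw ((!) ?L) {..<card (Upsilon r \<rho>)} (Upsilon r \<rho>)" using assms by simp
  have 2: "bij_betw (\<lambda>s. s - 1) {1..card (Upsilon r \<rho>)} {..<card (Upsilon r \<rho>)}"
    by (rule bij_betwI[of _ _ _ Suc]) auto
  have "lam r \<rho> = (!) ?L \<circ> (\<lambda>s. s - 1)" by (simp add: lam_def fun_eq_iff)
  then show ?thesis using bij_betw_trans[OF 2 1] by simp
qed

section \<open>The local limit theorem at the saddle point\<close>

context meinardus
begin

text \<open>The approximate standard deviation of the tilted law, taken from the second derivative
  of \<open>main_part\<close>; with it the quadratic Taylor term tends to u^2 / 2.\<close>

definition spread :: "nat \<Rightarrow> real" where "spread n = sqrt (main_deriv2 (\<Delta> n))"

lemma spread_pos: "spread n > 0" by (simp add: spread_def main_deriv2_pos \<Delta>)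

lemma spread_square: "(spread n)\<^sup>2 = main_deriv2 (\<Delta> n)"
  using main_deriv2_pos[OF \<Delta>(1)[of n]] by (simp add: spread_def)

definition curvature :: real where "curvature = \<rho> r * (\<rho> r + 1) * h i r"

lemma curvature_pos: "curvature > 0"
  using rho_r_pos h_pos[OF r_in, of i] by (simp add: curvature_def)

lemma spread_lim: "(\<lambda>n. spread n * \<Delta> n powr ((\<rho> r + 2) / 2)) \<longlonglongrightarrow> sqrt curvature"
proof -
  have "(\<lambda>n. \<Sum>l=1..r. \<rho> l * (\<rho> l + 1) * h i l * \<Delta> n powr (\<rho> r - \<rho> l))
    \<longlonglongrightarrow> (\<Sum>l=1..r. \<rho> l * (\<rho> l + 1) * h i l * (if l = r then 1 else 0))"
  proof (intro tendsto_sum tendsto_mult tendsto_const)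
    fix l assume l: "l \<in> {1..r}"
    show "(\<lambda>n. \<Delta> n powr (\<rho> r - \<rho> l)) \<longlonglongrightarrow> (if l = r then 1 else 0)"
    proof (cases "l = r")
      case True
      then show ?thesis using \<Delta>(1) by (simp add: less_imp_neq[symmetric])
    next
      case False
      then have "\<rho> r - \<rho> l > 0" using rho_less[of l r] l by auto
      then have "((\<lambda>t::real. t powr (\<rho> r - \<rho> l)) \<longlongrightarrow> 0) (at_right 0)" by real_asymp
      then show ?thesis using False filterlim_compose[OF _ \<Delta>_at_right] by fastforce
    qed
  qed
  moreover have "(\<Sum>l=1..r. \<rho> l * (\<rho> l + 1) * h i l * (if l = r then 1 else 0)) = curvature"
    using r_pos by (simp add: curvature_def sum.delta if_distrib cong: if_cong)
  moreover have "(\<Sum>l=1..r. \<rho> l * (\<rho> l + 1) * h i l * \<Delta> n powr (\<rho> r - \<rho> l)) = main_deriv2 (\<Delta> n) * \<Delta> n powr (\<rho> r + 2)" for n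
    unfolding main_deriv2_def sum_distrib_right mult.assoc powr_add[symmetric] by simp
  ultimately have "(\<lambda>n. sqrt (main_deriv2 (\<Delta> n) * \<Delta> n powr (\<rho> r + 2))) \<longlonglongrightarrow> sqrt curvature"
    by (intro tendsto_real_sqrt) simp
  moreover have "sqrt (main_deriv2 (\<Delta> n) * \<Delta> n powr (\<rho> r + 2)) = spread n * \<Delta> n powr ((\<rho> r + 2) / 2)" for n
    unfolding real_sqrt_mult spread_def by (simp add: powr_powr flip: powr_half_sqrt)
  ultimately show ?thesis by simp
qed

lemma \<Delta>_spread: "filterlim (\<lambda>n. \<Delta> n * spread n) at_top sequentially"
proof -
  have "filterlim (\<lambda>t::real. t powr (- \<rho> r / 2)) at_top (at_right 0)" using rho_r_pos by real_asymp
  from filterlim_compose[OF this \<Delta>_at_right]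
  have "filterlim (\<lambda>n. \<Delta> n powr (- \<rho> r / 2)) at_top sequentially" .
  from filterlim_tendsto_pos_mult_at_top[OF spread_lim _ this] curvature_pos
  have "filterlim (\<lambda>n. spread n * \<Delta> n powr ((\<rho> r + 2) / 2) * \<Delta> n powr (- \<rho> r / 2)) at_top sequentially" by simp
  moreover have "spread n * \<Delta> n powr ((\<rho> r + 2) / 2) * \<Delta> n powr (- \<rho> r / 2) = \<Delta> n * spread n" for n
  proof -
    have "\<Delta> n powr ((\<rho> r + 2) / 2) * \<Delta> n powr (- \<rho> r / 2) = \<Delta> n powr 1"
      unfolding powr_add[symmetric] by (simp add: field_simps)
    then show ?thesis using \<Delta>(1)[of n] by (simp add: mult.assoc)
  qed
  ultimately show ?thesis by (simp only:)
qed

text \<open>All summands are powers with exponents between -\<rho>_r - 2 and -2. A relative change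
  of the argument by at most \<tau> thus costs no more than the factor with the extreme exponent,
  whatever the proportions of the summands.\<close>

lemma main_deriv2_ratio:
  assumes \<delta>: "\<delta> > 0" and \<tau>: "0 \<le> \<tau>" "\<tau> < 1" and t: "\<delta> * (1 - \<tau>) \<le> t" "t \<le> \<delta> * (1 + \<tau>)"
  shows "(1 + \<tau>) powr (- \<rho> r - 2) \<le> main_deriv2 t / main_deriv2 \<delta>"
    "main_deriv2 t / main_deriv2 \<delta> \<le> (1 - \<tau>) powr (- \<rho> r - 2)"
proof -
  have p: "\<delta> * (1 - \<tau>) > 0" using \<delta> \<tau> by simp
  then have tp: "t > 0" using t by linarith
  have c: "\<rho> l * (\<rho> l + 1) * h i l \<ge> 0" if "l \<in> {1..r}" for l
    using rho_pos[OF that] h_nonneg[OF that] by simp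
  have "main_deriv2 t \<le> (\<Sum>l=1..r. \<rho> l * (\<rho> l + 1) * h i l * (\<delta> powr (- \<rho> l - 2) * (1 - \<tau>) powr (- \<rho> r - 2)))"
    unfolding main_deriv2_def
  proof (intro sum_mono mult_left_mono c)
    fix l assume l: "l \<in> {1..r}"
    have "t powr (- \<rho> l - 2) \<le> (\<delta> * (1 - \<tau>)) powr (- \<rho> l - 2)"
      using t p rho_pos[OF l] by (intro powr_mono2') auto
    also have "\<dots> = \<delta> powr (- \<rho> l - 2) * (1 - \<tau>) powr (- \<rho> l - 2)" using \<delta> \<tau> by (simp add: powr_mult)
    also have "\<dots> \<le> \<delta> powr (- \<rho> l - 2) * (1 - \<tau>) powr (- \<rho> r - 2)"
      using \<tau> rho_le[of l] l by (intro mult_left_mono powr_mono') auto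
    finally show "t powr (- \<rho> l - 2) \<le> \<delta> powr (- \<rho> l - 2) * (1 - \<tau>) powr (- \<rho> r - 2)" .
  qed
  also have "\<dots> = main_deriv2 \<delta> * (1 - \<tau>) powr (- \<rho> r - 2)"
    unfolding main_deriv2_def sum_distrib_right by (simp add: mult.assoc)
  finally show "main_deriv2 t / main_deriv2 \<delta> \<le> (1 - \<tau>) powr (- \<rho> r - 2)"
    using main_deriv2_pos[OF \<delta>] by (simp add: pos_divide_le_eq mult.commute)
  have "main_deriv2 \<delta> * (1 + \<tau>) powr (- \<rho> r - 2) = (\<Sum>l=1..r. \<rho> l * (\<rho> l + 1) * h i l * (\<delta> powr (- \<rho> l - 2) * (1 + \<tau>) powr (- \<rho> r - 2)))"
    unfolding main_deriv2_def sum_distrib_right by (simp add: mult.assoc)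
  also have "\<dots> \<le> main_deriv2 t"
    unfolding main_deriv2_def
  proof (intro sum_mono mult_left_mono c)
    fix l assume l: "l \<in> {1..r}"
    have "\<delta> powr (- \<rho> l - 2) * (1 + \<tau>) powr (- \<rho> r - 2) \<le> \<delta> powr (- \<rho> l - 2) * (1 + \<tau>) powr (- \<rho> l - 2)"
      using \<tau> rho_le[of l] l by (intro mult_left_mono powr_mono) auto
    also have "\<dots> = (\<delta> * (1 + \<tau>)) powr (- \<rho> l - 2)" using \<delta> \<tau> by (simp add: powr_mult)
    also have "\<dots> \<le> t powr (- \<rho> l - 2)" using t tp rho_pos[OF l] by (intro powr_mono2') auto
    finally show "\<delta> powr (- \<rho> l - 2) * (1 + \<tau>) powr (- \<rho> r - 2) \<le> t powr (- \<rho> l - 2)" .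
  qed
  finally show "(1 + \<tau>) powr (- \<rho> r - 2) \<le> main_deriv2 t / main_deriv2 \<delta>"
    using main_deriv2_pos[OF \<delta>] by (simp add: pos_le_divide_eq mult.commute)
qed

lemma main_part_taylor:
  assumes \<delta>: "\<delta> > 0" and v: "\<bar>v\<bar> < \<delta>" "v \<noteq> 0"
  obtains t where "\<delta> - \<bar>v\<bar> \<le> t" "t \<le> \<delta> + \<bar>v\<bar>"
    "main_part i (\<delta> - v) = main_part i \<delta> + v * main_deriv \<delta> + v\<^sup>2 / 2 * main_deriv2 t"
proof -
  define diff where "diff = (\<lambda>m::nat. if m = 0 then main_part i else if m = 1 then (\<lambda>x. - main_deriv x) else main_deriv2)"
  let ?a = "\<delta> - \<bar>v\<bar>" and ?b = "\<delta> + \<bar>v\<bar>"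
  have "\<exists>t. (if \<delta> - v < \<delta> then \<delta> - v < t \<and> t < \<delta> else \<delta> < t \<and> t < \<delta> - v) \<and>
     main_part i (\<delta> - v) = (\<Sum>m<2. diff m \<delta> / fact m * (\<delta> - v - \<delta>) ^ m) + diff 2 t / fact 2 * (\<delta> - v - \<delta>) ^ 2"
  proof (rule Taylor[where a = ?a and b = ?b])
    show "\<forall>m t. m < 2 \<and> ?a \<le> t \<and> t \<le> ?b \<longrightarrow> (diff m has_real_derivative diff (Suc m) t) (at t)"
    proof (intro allI impI)
      fix m :: nat and t :: real assume m: "m < 2 \<and> ?a \<le> t \<and> t \<le> ?b"
      then have t: "t > 0" using v by linarith
      consider "m = 0" | "m = 1" using m by linarith
      then show "(diff m has_real_derivative diff (Suc m) t) (at t)"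
        using main_part_deriv[OF t] DERIV_minus[OF main_deriv_deriv[OF t]] by cases (simp_all add: diff_def)
    qed
  qed (use v in \<open>auto simp: diff_def\<close>)
  then obtain t where t: "if \<delta> - v < \<delta> then \<delta> - v < t \<and> t < \<delta> else \<delta> < t \<and> t < \<delta> - v"
    "main_part i (\<delta> - v) = (\<Sum>m<2. diff m \<delta> / fact m * (\<delta> - v - \<delta>) ^ m) + diff 2 t / fact 2 * (\<delta> - v - \<delta>) ^ 2"
    by blast
  show ?thesis
  proof (rule that[of t])
    show "\<delta> - \<bar>v\<bar> \<le> t" "t \<le> \<delta> + \<bar>v\<bar>" using t(1) by (auto split: if_splits)
    show "main_part i (\<delta> - v) = main_part i \<delta> + v * main_deriv \<delta> + v\<^sup>2 / 2 * main_deriv2 t"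
      using t(2) by (simp add: diff_def numeral_2_eq_2 lessThan_Suc mult.commute)
  qed
qed

text \<open>In the Taylor expansion of \<open>main_part\<close> the linear term cancels n u / B by
  the choice of \<Delta>, and the quadratic term tends to u^2 / 2. The rest of \<open>log_gf\<close>
  is a convergent function \<open>R\<close> minus a multiple of ln \<delta>; since the relative
  displacement tends to 0, the increments of both vanish in the limit.\<close>

lemma log_gf_increment:
  "(\<lambda>n. log_gf i (\<Delta> n - u / spread n) - log_gf i (\<Delta> n) - real n * u / spread n) \<longlonglongrightarrow> u\<^sup>2 / 2"
\<comment> \<open>Taylor's formula with an intermediate point needs a nonzero displacement, so u = 0
  is separated.\<close>
proof (cases "u = 0")
  case False
  define v where "v n = u / spread n" for n
  \<comment> \<open>The relative displacement |v| / \<Delta>; it tends to 0 because \<Delta> times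
    \<open>spread\<close> tends to infinity.\<close>
  define \<tau> where "\<tau> n = \<bar>u\<bar> * inverse (\<Delta> n * spread n)" for n
  have v0: "v n \<noteq> 0" for n using False spread_pos[of n] by (simp add: v_def)
  have \<tau>v: "\<bar>v n\<bar> = \<Delta> n * \<tau> n" for n
  proof -
    have "\<bar>v n\<bar> = \<bar>u\<bar> / spread n" using spread_pos[of n] by (simp add: v_def abs_divide)
    then show ?thesis using \<Delta>(1)[of n] by (simp add: \<tau>_def divide_inverse)
  qed
  have "(\<lambda>n. inverse (\<Delta> n * spread n)) \<longlonglongrightarrow> 0" by (rule tendsto_inverse_0_at_top[OF \<Delta>_spread])
  then have \<tau>_lim: "\<tau> \<longlonglongrightarrow> 0" unfolding \<tau>_def[abs_def] using tendsto_mult_right_zero by blast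
  have \<tau>_nonneg: "\<tau> n \<ge> 0" for n using \<Delta>(1)[of n] spread_pos[of n] by (simp add: \<tau>_def)
  have \<tau>_small: "\<forall>\<^sub>F n in sequentially. \<tau> n < 1" using \<tau>_lim by (rule order_tendstoD) simp
  define Q where "Q n = main_part i (\<Delta> n - v n) - main_part i (\<Delta> n) - real n * v n" for n
  have Q_eq: "\<forall>\<^sub>F n in sequentially. u\<^sup>2 / 2 * (1 + \<tau> n) powr (- \<rho> r - 2) \<le> Q n \<and> Q n \<le> u\<^sup>2 / 2 * (1 - \<tau> n) powr (- \<rho> r - 2)"
    using \<tau>_small eventually_ge_at_top[of 1]
  proof eventually_elim
    case (elim n)
    have "\<Delta> n * \<tau> n < \<Delta> n * 1" using \<Delta>(1)[of n] elim by (intro mult_strict_left_mono)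
    then have vlt: "\<bar>v n\<bar> < \<Delta> n" by (simp add: \<tau>v)
    obtain t where t: "\<Delta> n - \<bar>v n\<bar> \<le> t" "t \<le> \<Delta> n + \<bar>v n\<bar>"
      "main_part i (\<Delta> n - v n) = main_part i (\<Delta> n) + v n * main_deriv (\<Delta> n) + (v n)\<^sup>2 / 2 * main_deriv2 t"
      using main_part_taylor[OF \<Delta>(1) vlt v0] by blast
    have "main_deriv (\<Delta> n) = real n" using \<Delta>(2)[of n] elim by (simp add: max_def)
    then have "Q n = (v n)\<^sup>2 / 2 * main_deriv2 t" using t(3) by (simp add: Q_def)
    also have "(v n)\<^sup>2 = u\<^sup>2 / main_deriv2 (\<Delta> n)" by (simp add: v_def power_divide spread_square)
    finally have Q: "Q n = u\<^sup>2 / 2 * (main_deriv2 t / main_deriv2 (\<Delta> n))" by simp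
    have tt: "\<Delta> n * (1 - \<tau> n) \<le> t" "t \<le> \<Delta> n * (1 + \<tau> n)" using t(1,2) unfolding \<tau>v by (simp_all add: algebra_simps)
    show ?case
      unfolding Q using main_deriv2_ratio[OF \<Delta>(1) \<tau>_nonneg elim(1) tt]
      by (intro conjI mult_left_mono) auto
  qed
  have lim1: "(\<lambda>n. u\<^sup>2 / 2 * (1 + \<tau> n) powr (- \<rho> r - 2)) \<longlonglongrightarrow> u\<^sup>2 / 2 * (1 + 0) powr (- \<rho> r - 2)"
    by (intro tendsto_intros \<tau>_lim) auto
  have lim2: "(\<lambda>n. u\<^sup>2 / 2 * (1 - \<tau> n) powr (- \<rho> r - 2)) \<longlonglongrightarrow> u\<^sup>2 / 2 * (1 - 0) powr (- \<rho> r - 2)"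
    by (intro tendsto_intros \<tau>_lim) auto
  have Q_lim: "Q \<longlonglongrightarrow> u\<^sup>2 / 2"
    by (rule tendsto_sandwich[of "\<lambda>n. u\<^sup>2 / 2 * (1 + \<tau> n) powr (- \<rho> r - 2)" _ _ "\<lambda>n. u\<^sup>2 / 2 * (1 - \<tau> n) powr (- \<rho> r - 2)"])
       (use Q_eq lim1 lim2 in \<open>auto elim!: eventually_mono\<close>)
  obtain \<kappa> where \<kappa>: "((\<lambda>\<delta>. log_gf i \<delta> - main_part i \<delta> + ind1 i * Re (D 0) * ln \<delta>) \<longlongrightarrow> \<kappa>) (at_right 0)"
    using log_gf_expansion by blast
  define R where "R = (\<lambda>\<delta>. log_gf i \<delta> - main_part i \<delta> + ind1 i * Re (D 0) * ln \<delta>)"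
  have R: "(R \<longlongrightarrow> \<kappa>) (at_right 0)" using \<kappa> by (simp add: R_def)
  have pos: "\<forall>\<^sub>F n in sequentially. \<Delta> n - v n > 0"
    using \<tau>_small
  proof eventually_elim
    case (elim n)
    have "\<Delta> n * \<tau> n < \<Delta> n * 1" using \<Delta>(1)[of n] elim by (intro mult_strict_left_mono)
    then show ?case using \<tau>v[of n] by linarith
  qed
  have v_rel: "(\<lambda>n. v n / \<Delta> n) \<longlonglongrightarrow> 0"
  proof (rule tendsto_rabs_zero_cancel)
    have "\<bar>v n / \<Delta> n\<bar> = \<tau> n" for n using \<Delta>(1)[of n] by (simp add: abs_divide \<tau>v)
    then show "(\<lambda>n. \<bar>v n / \<Delta> n\<bar>) \<longlonglongrightarrow> 0" using \<tau>_lim by simp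
  qed
  have "(\<lambda>n. \<Delta> n * (1 - v n / \<Delta> n)) \<longlonglongrightarrow> 0 * (1 - 0)" by (intro tendsto_intros \<Delta>_lim v_rel)
  moreover have eq: "\<Delta> n * (1 - v n / \<Delta> n) = \<Delta> n - v n" for n using \<Delta>(1)[of n] by (simp add: right_diff_distrib)
  ultimately have "(\<lambda>n. \<Delta> n - v n) \<longlonglongrightarrow> 0" by simp
  then have "filterlim (\<lambda>n. \<Delta> n - v n) (at_right 0) sequentially"
    using pos by (auto simp: filterlim_at elim: eventually_mono)
  from filterlim_compose[OF R this] filterlim_compose[OF R \<Delta>_at_right]
  have RR: "(\<lambda>n. R (\<Delta> n - v n) - R (\<Delta> n)) \<longlonglongrightarrow> \<kappa> - \<kappa>" by (intro tendsto_diff)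
  have "(\<lambda>n. ln (1 - v n / \<Delta> n)) \<longlonglongrightarrow> ln (1 - 0)" by (intro tendsto_intros v_rel) auto
  then have LN: "(\<lambda>n. ind1 i * Re (D 0) * ln (1 - v n / \<Delta> n)) \<longlonglongrightarrow> ind1 i * Re (D 0) * 0" by (intro tendsto_mult tendsto_const) simp
  have "(\<lambda>n. Q n + (R (\<Delta> n - v n) - R (\<Delta> n)) - ind1 i * Re (D 0) * ln (1 - v n / \<Delta> n)) \<longlonglongrightarrow> u\<^sup>2 / 2 + (\<kappa> - \<kappa>) - ind1 i * Re (D 0) * 0"
    by (intro tendsto_diff tendsto_add Q_lim RR LN)
  moreover have "\<forall>\<^sub>F n in sequentially. Q n + (R (\<Delta> n - v n) - R (\<Delta> n)) - ind1 i * Re (D 0) * ln (1 - v n / \<Delta> n)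
     = log_gf i (\<Delta> n - u / spread n) - log_gf i (\<Delta> n) - real n * u / spread n"
    using pos
  proof eventually_elim
    case (elim n)
    have "1 - v n / \<Delta> n > 0" using elim \<Delta>(1)[of n] by (simp add: pos_divide_less_eq)
    then have "ln (\<Delta> n - v n) = ln (\<Delta> n) + ln (1 - v n / \<Delta> n)"
      unfolding eq[symmetric] using \<Delta>(1)[of n] by (intro ln_mult_pos) auto
    moreover have "real n * u / spread n = real n * v n" by (simp add: v_def)
    ultimately show ?case unfolding Q_def R_def v_def[symmetric] by (simp add: distrib_left)
  qed
  ultimately have "(\<lambda>n. log_gf i (\<Delta> n - u / spread n) - log_gf i (\<Delta> n) - real n * u / spread n)
     \<longlonglongrightarrow> u\<^sup>2 / 2 + (\<kappa> - \<kappa>) - ind1 i * Re (D 0) * 0"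
    by (rule Lim_transform_eventually)
  then show ?thesis by simp
qed simp

lemma main_deriv2_le:
  obtains C where "C > 0" "\<And>\<delta>. 0 < \<delta> \<Longrightarrow> \<delta> \<le> 1 \<Longrightarrow> main_deriv2 \<delta> \<le> C * \<delta> powr (- (\<rho> r + 2))"
proof (rule that[of "\<Sum>l=1..r. \<rho> l * (\<rho> l + 1) * h i l"])
  have c: "\<rho> l * (\<rho> l + 1) * h i l > 0" if "l \<in> {1..r}" for l
    using rho_pos[OF that] h_pos[OF that, of i] by simp
  show "(\<Sum>l=1..r. \<rho> l * (\<rho> l + 1) * h i l) > 0" using r_in by (intro sum_pos c) auto
  fix \<delta> :: real assume \<delta>: "0 < \<delta>" "\<delta> \<le> 1"
  show "main_deriv2 \<delta> \<le> (\<Sum>l=1..r. \<rho> l * (\<rho> l + 1) * h i l) * \<delta> powr (- (\<rho> r + 2))"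
    unfolding main_deriv2_def sum_distrib_right
    using c \<delta> rho_le by (intro sum_mono mult_left_mono powr_mono') (auto simp: less_imp_le)
qed

theorem saddle_point_local_limit:
  "(\<lambda>n. coeff_c i b n * exp (- \<Delta> n) ^ n / exp (log_gf i (\<Delta> n)) * spread n) \<longlonglongrightarrow> 1 / sqrt (2 * pi)"
proof -
  obtain \<kappa> \<delta>1 where near: "\<kappa> > 0" "\<delta>1 > 0"
    "\<And>\<delta> \<theta>. 0 < \<delta> \<Longrightarrow> \<delta> < \<delta>1 \<Longrightarrow> \<bar>\<theta>\<bar> \<le> \<delta> \<Longrightarrow>
       norm (gf_circle \<delta> \<theta>) \<le> exp (- \<kappa> * (\<theta>\<^sup>2 * \<delta> powr (- (\<rho> r + 2)))) * exp (log_gf i \<delta>)"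
    using gf_circle_near by blast
  obtain \<delta>2 where far: "\<delta>2 > 0"
    "\<And>\<delta> \<theta>. 0 < \<delta> \<Longrightarrow> \<delta> < \<delta>2 \<Longrightarrow> \<delta> \<le> \<bar>\<theta>\<bar> \<Longrightarrow> \<bar>\<theta>\<bar> \<le> pi \<Longrightarrow>
       norm (gf_circle \<delta> \<theta>) \<le> \<delta> powr (2 + \<rho> r / 2) * exp (log_gf i \<delta>)"
    using gf_circle_far by blast
  obtain C where C: "C > 0" "\<And>\<delta>. 0 < \<delta> \<Longrightarrow> \<delta> \<le> 1 \<Longrightarrow> main_deriv2 \<delta> \<le> C * \<delta> powr (- (\<rho> r + 2))"
    using main_deriv2_le by blast
  have small: "\<forall>\<^sub>F n in sequentially. \<Delta> n < a" if "a > 0" for a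
    using \<Delta>_lim that by (rule order_tendstoD)
  have circle: "(\<Sum>m. complex_of_real (coeff_c i b m) * (complex_of_real (exp (- \<Delta> n)) * cis \<theta>) ^ m) = gf_circle (\<Delta> n) \<theta>" for n \<theta>
    by (simp add: gf_circle_def)
  show ?thesis
  \<comment> \<open>Dividing \<kappa> by \<open>C\<close> converts the Gaussian bound in powers of
    \<Delta> into one in \<open>spread\<close>, since \<open>main_deriv2 \<delta>\<close> is at most
    \<open>C * \<delta> powr (- (\<rho> r + 2))\<close>.\<close>
  proof (rule local_limit_gaussian[where c = "coeff_c i b" and L = "log_gf i" and d = \<Delta> and B = spread and \<kappa> = "\<kappa> / C" and e = "\<lambda>n. \<Delta> n powr (2 + \<rho> r / 2)", unfolded circle])
    show "coeff_c i b m \<ge> 0" for m by (rule coeff_c_nonneg[OF adm])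
    show "\<kappa> / C > 0" using near C by simp
    show "\<forall>\<^sub>F n in sequentially. \<Delta> n \<le> pi" using small[of pi] by (auto elim: eventually_mono)
    show "\<forall>\<^sub>F n in sequentially. \<forall>\<theta>. \<bar>\<theta>\<bar> \<le> \<Delta> n \<longrightarrow>
       norm (gf_circle (\<Delta> n) \<theta>) \<le> exp (- (\<kappa> / C) * (\<theta> * spread n)\<^sup>2) * exp (log_gf i (\<Delta> n))"
      using small[OF near(2)] small[OF zero_less_one]
    proof eventually_elim
      case (elim n)
      show ?case
      proof (intro allI impI)
        fix \<theta> assume \<theta>: "\<bar>\<theta>\<bar> \<le> \<Delta> n"
        have "\<theta>\<^sup>2 * main_deriv2 (\<Delta> n) \<le> \<theta>\<^sup>2 * (C * \<Delta> n powr (- (\<rho> r + 2)))"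
          using C(2)[of "\<Delta> n"] \<Delta>(1)[of n] elim by (intro mult_left_mono) auto
        then have "(\<theta> * spread n)\<^sup>2 \<le> C * (\<theta>\<^sup>2 * \<Delta> n powr (- (\<rho> r + 2)))"
          unfolding power_mult_distrib spread_square by (simp add: mult_ac)
        then have "\<kappa> / C * (\<theta> * spread n)\<^sup>2 \<le> \<kappa> / C * (C * (\<theta>\<^sup>2 * \<Delta> n powr (- (\<rho> r + 2))))"
          using near(1) C(1) by (intro mult_left_mono) auto
        also have "\<dots> = \<kappa> * (\<theta>\<^sup>2 * \<Delta> n powr (- (\<rho> r + 2)))" using C(1) by simp
        finally have "exp (- \<kappa> * (\<theta>\<^sup>2 * \<Delta> n powr (- (\<rho> r + 2)))) \<le> exp (- (\<kappa> / C) * (\<theta> * spread n)\<^sup>2)" by simp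
        then show "norm (gf_circle (\<Delta> n) \<theta>) \<le> exp (- (\<kappa> / C) * (\<theta> * spread n)\<^sup>2) * exp (log_gf i (\<Delta> n))"
          using near(3)[OF \<Delta>(1) elim(1) \<theta>] by (meson mult_right_mono exp_ge_zero order_trans)
      qed
    qed
    show "\<forall>\<^sub>F n in sequentially. \<forall>\<theta>. \<Delta> n \<le> \<bar>\<theta>\<bar> \<and> \<bar>\<theta>\<bar> \<le> pi \<longrightarrow>
       norm (gf_circle (\<Delta> n) \<theta>) \<le> \<Delta> n powr (2 + \<rho> r / 2) * exp (log_gf i (\<Delta> n))"
      using small[OF far(1)] by eventually_elim (use far(2) \<Delta>(1) in auto)
    have "(\<lambda>n. spread n * \<Delta> n powr ((\<rho> r + 2) / 2) * \<Delta> n) \<longlonglongrightarrow> sqrt curvature * 0"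
      by (intro tendsto_mult spread_lim \<Delta>_lim)
    moreover have "spread n * \<Delta> n powr (2 + \<rho> r / 2) = spread n * \<Delta> n powr ((\<rho> r + 2) / 2) * \<Delta> n" for n
    proof -
      have "\<Delta> n powr (2 + \<rho> r / 2) = \<Delta> n powr ((\<rho> r + 2) / 2 + 1)" by (simp add: add_divide_distrib)
      also have "\<dots> = \<Delta> n powr ((\<rho> r + 2) / 2) * \<Delta> n powr 1" by (rule powr_add)
      finally show ?thesis using \<Delta>(1)[of n] by simp
    qed
    ultimately show "(\<lambda>n. spread n * \<Delta> n powr (2 + \<rho> r / 2)) \<longlonglongrightarrow> 0" by (simp only: mult_zero_right)
  qed (use gf_sums \<Delta>(1) spread_pos \<Delta>_spread log_gf_increment in auto)
qed

lemma \<xi>_eq: "n \<ge> 1 \<Longrightarrow> \<xi> n powr q = real n powr (- q / (\<rho> r + 1))"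
  by (simp add: \<xi>_def powr_powr max_absorb1)

text \<open>The local limit theorem brings the power (\<rho>_r + 2) / 2 of \<Delta> through 1 /
  \<open>spread\<close>, and exp(\<open>log_gf\<close>) brings the power -1(i) D(0); together they
  give \<open>q\<close>. The ratio of powers of \<Delta> and \<xi> converges, and all limits merge
  into \<open>H\<close>.\<close>

theorem coeff_c_asymptotics:
  defines "q \<equiv> (\<rho> r + 2) / 2 - ind1 i * Re (D 0)"
  shows "\<exists>H>0. (\<lambda>n. coeff_c i b n / (\<xi> n powr q * exp (saddle_value n))) \<longlonglongrightarrow> H"
proof -
  obtain \<kappa> where \<kappa>: "((\<lambda>\<delta>. log_gf i \<delta> - main_part i \<delta> + ind1 i * Re (D 0) * ln \<delta>) \<longlongrightarrow> \<kappa>) (at_right 0)"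
    using log_gf_expansion by blast
  define R where "R = (\<lambda>\<delta>. log_gf i \<delta> - main_part i \<delta> + ind1 i * Re (D 0) * ln \<delta>)"
  have R: "(\<lambda>n. R (\<Delta> n)) \<longlonglongrightarrow> \<kappa>" unfolding R_def by (rule filterlim_compose[OF \<kappa> \<Delta>_at_right])
  define X where "X n = coeff_c i b n * exp (- \<Delta> n) ^ n / exp (log_gf i (\<Delta> n)) * spread n" for n
  have X: "X \<longlonglongrightarrow> 1 / sqrt (2 * pi)" unfolding X_def[abs_def] by (rule saddle_point_local_limit)
  \<comment> \<open>A product of factors with known limits that equals the ratio of the claim
    exactly, for every n.\<close>
  define Y where "Y n = X n * exp (R (\<Delta> n)) * (\<Delta> n powr q / \<xi> n powr q) / (spread n * \<Delta> n powr ((\<rho> r + 2) / 2))" for n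
  have "Y \<longlonglongrightarrow> 1 / sqrt (2 * pi) * exp \<kappa> * saddle_lead powr (q / (\<rho> r + 1)) / sqrt curvature"
    unfolding Y_def[abs_def] using curvature_pos
    by (intro tendsto_divide tendsto_mult tendsto_exp X R \<Delta>_powr_lim spread_lim) auto
  moreover have "Y = (\<lambda>n. coeff_c i b n / (\<xi> n powr q * exp (saddle_value n)))"
  proof
    fix n
    define d where "d = \<Delta> n"
    have d: "d > 0" by (simp add: d_def \<Delta>)
    have eR: "exp (R d) = exp (log_gf i d) * d powr (ind1 i * Re (D 0)) / exp (main_part i d)"
      using d by (simp add: R_def exp_add exp_diff powr_def)
    have dq: "d powr q * d powr (ind1 i * Re (D 0)) = d powr ((\<rho> r + 2) / 2)"
      unfolding powr_add[symmetric] q_def by simp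
    have ed: "exp (- d) ^ n = 1 / exp (real n * d)"
      unfolding exp_minus_power by (simp add: exp_minus divide_inverse)
    have "Y n = coeff_c i b n * (1 / exp (real n * d)) / exp (log_gf i d) * spread n * (exp (log_gf i d) * d powr (ind1 i * Re (D 0)) / exp (main_part i d))
       * (d powr q / \<xi> n powr q) / (spread n * (d powr q * d powr (ind1 i * Re (D 0))))"
      unfolding Y_def X_def d_def[symmetric] eR ed dq ..
    also have "\<dots> = coeff_c i b n / (\<xi> n powr q * (exp (real n * d) * exp (main_part i d)))"
      using d spread_pos[of n] by simp
    finally show "Y n = coeff_c i b n / (\<xi> n powr q * exp (saddle_value n))"
      by (simp add: saddle_value_def exp_add d_def)
  qed
  ultimately have "(\<lambda>n. coeff_c i b n / (\<xi> n powr q * exp (saddle_value n))) \<longlonglongrightarrow>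
     1 / sqrt (2 * pi) * exp \<kappa> * saddle_lead powr (q / (\<rho> r + 1)) / sqrt curvature" by (simp only:)
  moreover have "1 / sqrt (2 * pi) * exp \<kappa> * saddle_lead powr (q / (\<rho> r + 1)) / sqrt curvature > 0"
    using curvature_pos saddle_lead_pos by simp
  ultimately show ?thesis by blast
qed

section \<open>Matching the exponents of the saddle value with the elements of
  \<open>Upsilon\<close>\<close>

lemma sum_lam:
  fixes f :: "real \<Rightarrow> real"
  shows "(\<Sum>s | s \<in> {1..card (Upsilon r \<rho>)} \<and> lam r \<rho> s \<le> x. f (lam r \<rho> s)) = (\<Sum>t | t \<in> Upsilon r \<rho> \<and> t \<le> x. f t)"
proof -
  have fin: "finite (Upsilon r \<rho>)" by (rule finite_Upsilon) (use rho_less in auto)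
  note bij = bij_betw_lam[OF fin]
  have "bij_betw (lam r \<rho>) {s. s \<in> {1..card (Upsilon r \<rho>)} \<and> lam r \<rho> s \<le> x} {t. t \<in> Upsilon r \<rho> \<and> t \<le> x}"
  proof (rule bij_betw_subset[OF bij])
    show "lam r \<rho> ` {s. s \<in> {1..card (Upsilon r \<rho>)} \<and> lam r \<rho> s \<le> x} = {t. t \<in> Upsilon r \<rho> \<and> t \<le> x}"
    proof (intro equalityI subsetI)
      fix t assume t: "t \<in> {t. t \<in> Upsilon r \<rho> \<and> t \<le> x}"
      then have "t \<in> lam r \<rho> ` {1..card (Upsilon r \<rho>)}" using bij_betw_imp_surj_on[OF bij] by simp
      then obtain s where "t = lam r \<rho> s" "s \<in> {1..card (Upsilon r \<rho>)}" by blast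
      with t show "t \<in> lam r \<rho> ` {s. s \<in> {1..card (Upsilon r \<rho>)} \<and> lam r \<rho> s \<le> x}" by simp
    next
      fix t assume "t \<in> lam r \<rho> ` {s. s \<in> {1..card (Upsilon r \<rho>)} \<and> lam r \<rho> s \<le> x}"
      then obtain s where s: "t = lam r \<rho> s" "s \<in> {1..card (Upsilon r \<rho>)}" "lam r \<rho> s \<le> x" by blast
      with bij_betwE[OF bij] show "t \<in> {t. t \<in> Upsilon r \<rho> \<and> t \<le> x}" by simp
    qed
  qed auto
  then show ?thesis by (rule sum.reindex_bij_betw)
qed

theorem main_asymptotics:
  "\<exists>(H::real) (P :: nat \<Rightarrow> real) (K :: nat \<Rightarrow> nat \<Rightarrow> real). H > 0 \<and>
    (\<lambda>n. coeff_c i b n) \<sim>[at_top]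
    (\<lambda>n. H * real n powr (- ((2 + \<rho> r - 2 * Re (D 0) * ind1 i) / (2 * (\<rho> r + 1)))) *
       exp ((\<Sum>l=0..r. P l * real n powr (\<rho> l / (\<rho> r + 1))) +
            (\<Sum>l=0..r. const_h i \<rho> A D l *
               (\<Sum>s | s \<in> {1..card (Upsilon r \<rho>)} \<and> lam r \<rho> s \<le> \<rho> l.
                  K s l * real n powr ((\<rho> l - lam r \<rho> s) / (\<rho> r + 1))))))"
proof -
  define q where "q = (\<rho> r + 2) / 2 - ind1 i * Re (D 0)"
  obtain H0 where H0: "H0 > 0" "(\<lambda>n. coeff_c i b n / (\<xi> n powr q * exp (saddle_value n))) \<longlonglongrightarrow> H0"
    using coeff_c_asymptotics unfolding q_def by blast
  obtain \<Lambda> a where L: "finite \<Lambda>" "\<Lambda> \<subseteq> exps"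
    "(\<lambda>n. saddle_value n - (\<Sum>s\<in>\<Lambda>. a s * \<xi> n powr (s - \<rho> r))) \<longlonglongrightarrow> 0"
    using saddle_value_expansion by blast
  \<comment> \<open>Extension by 0, so that every element of \<open>Upsilon\<close> has a
    coefficient.\<close>
  define \<alpha> where "\<alpha> s = (if s \<in> \<Lambda> then a s else 0)" for s
  \<comment> \<open>All terms are booked under l = r: the exponent s = 0 goes to \<open>P r\<close>,
    the remaining ones are elements of \<open>Upsilon\<close> and go to \<open>K\<close> at l = r,
    with the positive prefactor \<open>h i r\<close> divided out.\<close>
  define P where "P l = (if l = r then \<alpha> 0 else 0)" for l
  define K where "K s l = (if l = r then \<alpha> (lam r \<rho> s) / h i r else 0)" for s l
  define E where "E n = (\<Sum>l=0..r. P l * real n powr (\<rho> l / (\<rho> r + 1))) +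
            (\<Sum>l=0..r. h i l * (\<Sum>s | s \<in> {1..card (Upsilon r \<rho>)} \<and> lam r \<rho> s \<le> \<rho> l.
                  K s l * real n powr ((\<rho> l - lam r \<rho> s) / (\<rho> r + 1))))" for n
  have finU: "finite (Upsilon r \<rho>)" by (rule finite_Upsilon) (use rho_less in auto)
  have U_pos: "t > 0" if "t \<in> Upsilon r \<rho>" for t
    using that rho_less by (auto simp: Upsilon_def Upsilon_tilde_def)
  let ?U = "{t. t \<in> Upsilon r \<rho> \<and> t \<le> \<rho> r}"
  have E_eq: "E n = (\<Sum>s\<in>\<Lambda> \<inter> {..\<rho> r}. a s * \<xi> n powr (s - \<rho> r))" if n: "n \<ge> 1" for n
  proof -
    have tm: "\<xi> n powr (t - \<rho> r) = real n powr ((\<rho> r - t) / (\<rho> r + 1))" for t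
      unfolding \<xi>_eq[OF n] by simp
    have "(\<Sum>l=0..r. P l * real n powr (\<rho> l / (\<rho> r + 1))) = (\<Sum>l\<in>{r}. P l * real n powr (\<rho> l / (\<rho> r + 1)))"
      by (rule sum.mono_neutral_right) (auto simp: P_def)
    then have 1: "(\<Sum>l=0..r. P l * real n powr (\<rho> l / (\<rho> r + 1))) = \<alpha> 0 * \<xi> n powr (0 - \<rho> r)"
      unfolding tm by (simp add: P_def)
    have "(\<Sum>l=0..r. h i l * (\<Sum>s | s \<in> {1..card (Upsilon r \<rho>)} \<and> lam r \<rho> s \<le> \<rho> l.
                  K s l * real n powr ((\<rho> l - lam r \<rho> s) / (\<rho> r + 1))))
        = (\<Sum>l\<in>{r}. h i l * (\<Sum>s | s \<in> {1..card (Upsilon r \<rho>)} \<and> lam r \<rho> s \<le> \<rho> l.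
                  K s l * real n powr ((\<rho> l - lam r \<rho> s) / (\<rho> r + 1))))"
      by (rule sum.mono_neutral_right) (auto simp: K_def)
    also have "\<dots> = h i r * (\<Sum>s | s \<in> {1..card (Upsilon r \<rho>)} \<and> lam r \<rho> s \<le> \<rho> r.
                  \<alpha> (lam r \<rho> s) / h i r * \<xi> n powr (lam r \<rho> s - \<rho> r))"
      unfolding tm by (simp add: K_def)
    also have "\<dots> = (\<Sum>t\<in>?U. h i r * (\<alpha> t / h i r * \<xi> n powr (t - \<rho> r)))"
      unfolding sum_lam[of "\<lambda>t. \<alpha> t / h i r * \<xi> n powr (t - \<rho> r)" "\<rho> r"] by (rule sum_distrib_left)
    also have "\<dots> = (\<Sum>t\<in>?U. \<alpha> t * \<xi> n powr (t - \<rho> r))"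
      using h_pos[OF r_in, of i] by (intro sum.cong) auto
    finally have "E n = \<alpha> 0 * \<xi> n powr (0 - \<rho> r) + (\<Sum>t\<in>?U. \<alpha> t * \<xi> n powr (t - \<rho> r))"
      unfolding E_def 1 by (simp only:)
    also have "\<dots> = (\<Sum>t\<in>insert 0 ?U. \<alpha> t * \<xi> n powr (t - \<rho> r))"
      using finU U_pos by (subst sum.insert) auto
    also have "\<dots> = (\<Sum>t\<in>\<Lambda> \<inter> {..\<rho> r}. a t * \<xi> n powr (t - \<rho> r))"
    proof (rule sum.mono_neutral_cong_right)
      show "\<Lambda> \<inter> {..\<rho> r} \<subseteq> insert 0 ?U"
      proof
        fix t assume "t \<in> \<Lambda> \<inter> {..\<rho> r}"
        then have "t \<in> exps" "t \<le> \<rho> r" using L(2) by auto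
        then show "t \<in> insert 0 ?U" using exps_Upsilon[of t] exps_nonneg[of t] by (cases "t = 0") auto
      qed
      show "\<forall>t\<in>insert 0 ?U - \<Lambda> \<inter> {..\<rho> r}. \<alpha> t * \<xi> n powr (t - \<rho> r) = 0"
        using rho_r_pos by (auto simp: \<alpha>_def)
    qed (use finU in \<open>auto simp: \<alpha>_def\<close>)
    finally show ?thesis .
  qed
  \<comment> \<open>Exponents s above \<open>\<rho> r\<close> give positive powers of \<xi>, which
    vanish in the limit and may be dropped from the exponential.\<close>
  have rest: "(\<lambda>n. \<Sum>s\<in>\<Lambda> - {..\<rho> r}. a s * \<xi> n powr (s - \<rho> r)) \<longlonglongrightarrow> (\<Sum>s\<in>\<Lambda> - {..\<rho> r}. a s * 0)"
  proof (intro tendsto_sum tendsto_mult tendsto_const)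
    fix s assume "s \<in> \<Lambda> - {..\<rho> r}"
    then have "s - \<rho> r > 0" by auto
    then have "((\<lambda>t::real. t powr (s - \<rho> r)) \<longlongrightarrow> 0) (at_right 0)" by real_asymp
    then show "(\<lambda>n. \<xi> n powr (s - \<rho> r)) \<longlonglongrightarrow> 0" by (rule filterlim_compose[OF _ x_at_right])
  qed
  have "(\<lambda>n. saddle_value n - (\<Sum>s\<in>\<Lambda>. a s * \<xi> n powr (s - \<rho> r)) + (\<Sum>s\<in>\<Lambda> - {..\<rho> r}. a s * \<xi> n powr (s - \<rho> r))) \<longlonglongrightarrow> 0"
    using tendsto_add[OF L(3) rest] by simp
  moreover have "\<forall>\<^sub>F n in sequentially. saddle_value n - (\<Sum>s\<in>\<Lambda>. a s * \<xi> n powr (s - \<rho> r)) + (\<Sum>s\<in>\<Lambda> - {..\<rho> r}. a s * \<xi> n powr (s - \<rho> r))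
      = saddle_value n - E n"
    using eventually_ge_at_top[of 1]
  proof eventually_elim
    case (elim n)
    show ?case unfolding E_eq[OF elim] using sum.Int_Diff[OF L(1), of "\<lambda>s. a s * \<xi> n powr (s - \<rho> r)" "{..\<rho> r}"] by simp
  qed
  ultimately have "(\<lambda>n. saddle_value n - E n) \<longlonglongrightarrow> 0" by (rule Lim_transform_eventually)
  then have "(\<lambda>n. coeff_c i b n / (\<xi> n powr q * exp (saddle_value n)) * exp (saddle_value n - E n)) \<longlonglongrightarrow> H0 * exp 0"
    by (intro tendsto_mult H0 tendsto_exp)
  moreover have "\<forall>\<^sub>F n in sequentially. coeff_c i b n / (\<xi> n powr q * exp (saddle_value n)) * exp (saddle_value n - E n)
     = coeff_c i b n / (real n powr (- ((2 + \<rho> r - 2 * Re (D 0) * ind1 i) / (2 * (\<rho> r + 1)))) * exp (E n))"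
    using eventually_ge_at_top[of 1]
  proof eventually_elim
    case (elim n)
    have "- q / (\<rho> r + 1) = - ((2 + \<rho> r - 2 * Re (D 0) * ind1 i) / (2 * (\<rho> r + 1)))"
    proof -
      have "q = (2 + \<rho> r - 2 * Re (D 0) * ind1 i) / 2" by (simp add: q_def field_simps)
      then show ?thesis by (simp only: minus_divide_left[symmetric] divide_divide_eq_left)
    qed
    then have "\<xi> n powr q = real n powr (- ((2 + \<rho> r - 2 * Re (D 0) * ind1 i) / (2 * (\<rho> r + 1))))"
      unfolding \<xi>_eq[OF elim] by (simp only:)
    then show ?case by (simp add: exp_diff)
  qed
  ultimately have "(\<lambda>n. coeff_c i b n / (real n powr (- ((2 + \<rho> r - 2 * Re (D 0) * ind1 i) / (2 * (\<rho> r + 1)))) * exp (E n))) \<longlonglongrightarrow> H0 * exp 0"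
    by (rule Lim_transform_eventually)
  then have "(\<lambda>n. coeff_c i b n) \<sim>[at_top] (\<lambda>n. H0 * (real n powr (- ((2 + \<rho> r - 2 * Re (D 0) * ind1 i) / (2 * (\<rho> r + 1)))) * exp (E n)))"
    using H0(1) by (intro asymp_equivI'_const) auto
  then have "(\<lambda>n. coeff_c i b n) \<sim>[at_top] (\<lambda>n. H0 * real n powr (- ((2 + \<rho> r - 2 * Re (D 0) * ind1 i) / (2 * (\<rho> r + 1)))) * exp (E n))"
    by (simp only: mult.assoc)
  with H0(1) show ?thesis unfolding E_def by blast
qed

end

theorem theorem1:
  fixes i :: kind and b :: "nat \<Rightarrow> real" and r :: nat and \<rho> A :: "nat \<Rightarrow> real"
    and C0 :: real and D :: "complex \<Rightarrow> complex"
  assumes "admissible_weights i b"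
    and "condition_I b r \<rho> A C0 D"
    and "condition_II C0 D"
    and "condition_III i b (\<rho> r)"
  shows "\<exists>(H::real) (P :: nat \<Rightarrow> real) (K :: nat \<Rightarrow> nat \<Rightarrow> real). H > 0 \<and>
    (\<lambda>n. coeff_c i b n) \<sim>[at_top]
    (\<lambda>n. H * real n powr (- ((2 + \<rho> r - 2 * Re (D 0) * ind1 i) / (2 * (\<rho> r + 1)))) *
       exp ((\<Sum>l=0..r. P l * real n powr (\<rho> l / (\<rho> r + 1))) +
            (\<Sum>l=0..r. const_h i \<rho> A D l *
               (\<Sum>s | s \<in> {1..card (Upsilon r \<rho>)} \<and> lam r \<rho> s \<le> \<rho> l.
                  K s l * real n powr ((\<rho> l - lam r \<rho> s) / (\<rho> r + 1))))))"
proof -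
  interpret meinardus b r \<rho> A C0 D i
    using assms by unfold_locales (auto simp: admissible_weights_def)
  show ?thesis by (rule main_asymptotics)
qed

end
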